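(* Let $P$ be a polyhedron. If $\nu^+$ is a pc-valuation on $\nabla(P)^+$ that assigns $1$ to each vl-Schauder hat of $\nabla(P)$, then $\nu^+(f)=\alpha^+(f)$ for all $f\in\nabla(P)^+$, where $\alpha^+(f)=\chi(\mathrm{supp}(f))=\chi(|\overline{Z_{K_f,f}}|)$ for any triangulation $K_f$ of $P$ linearizing $f$.
   Context: Simplices are (closed) convex hulls of finitely many affinely independent points (the vertices) of a Euclidean space. A simplicial complex is a finite set of simplices closed under taking faces and such that any two of its simplices intersect either in the empty set or in a common face. The polyhedron $|K|$ of a simplicial complex $K$ is the union of its simplices. A polyhedron is a subset $P$ of some $\mathbb{R}^n$ with $P=|K|$ for some simplicial complex $K$; any such $K$ is a triangulation of $P$. For a polyhedron $Q$, the Euler-Poincaré characteristic is $\chi(Q)=\sum_{m\geq 0}(-1)^m\alpha_m$, where $\alpha_m$ is the number of $m$-dimensional simplices of any triangulation of $Q$ (independent of the triangulation); $\chi(\emptyset)=0$. $\nabla(P)$ is the vector lattice (pointwise operations) of all continuous functions $f\colon P\to\mathbb{R}$ that are piecewise linear, i.e. for which there are finitely many affine linear functions $f_1,\dots,f_m\colon\mathbb{R}^n\to\mathbb{R}$ such that for every $s\in P$ there is $i$ with $f(s)=f_i(s)$. $\nabla(P)^+=\{f\in\nabla(P): f\geq 0\}$. A triangulation $K$ of $P$ linearizes $f$ if $f$ is (affine) linear on each simplex of $K$; such a triangulation always exists. For a vector lattice $V$ with positive cone $V^+$, a pc-valuation on $V^+$ is a function $\nu^+\colon V^+\to\mathbb{R}$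 such that: (P1) $\nu^+(0)=0$; (P2) for all $x,y\in V^+$, $\nu^+(x\vee y)=\nu^+(x)+\nu^+(y)-\nu^+(x\wedge y)$; (P3) for all $x,y\in V^+$, $\nu^+(x+y)=\nu^+(x\vee y)$. A vl-Schauder hat is an element $h\in\nabla(P)$ for which there are a triangulation $K_h$ of $P$ linearizing $h$ and a vertex $\bar x$ of $K_h$ such that $h(\bar x)=1$ and $h(x)=0$ for every other vertex $x$ of $K_h$. For a simplicial complex $K$, $K'$ denotes its first barycentric subdivision. For a subcomplex $L$ of $K$, the supplement $\overline{L}$ of $L$ in $K$ is the subcomplex of $K'$ consisting of those simplices of $K'$ having no vertex in $L'$. For $f\in\nabla(P)^+$ and a triangulation $K_f$ linearizing $f$, $Z_{K_f,f}$ is the subcomplex of $K_f$ of those simplices on which $f$ is identically zero, and $\overline{Z_{K_f,f}}$ is its supplement in $K_f$. The support is $\mathrm{supp}(f)=P\setminus f^{-1}(0)$ (no closure taken); it is homotopy equivalent to $|\overline{Z_{K_f,f}}|$, so $\chi(|\overline{Z_{K_f,f}}|)$ does not depend on the choice of $K_f$ and equals the (homological) Euler-Poincaré characteristic of $\mathrm{supp}(f)$, i.e. the alternating sum of the ranks of its homology groups. *)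

theory Defs
  imports
    "HOL-Analysis.Analysis"
    "HOL-Homology.Homology"
    "HOL-Library.Function_Algebras"
    "HOL-Library.Extended_Nat"
begin

section \<open>Polyhedra, subdivisions and supplements\<close>

text \<open>
  The library's \<^const>\<open>simplicial_complex\<close> regards the empty set as a face of every simplex (of
  dimension -1), so a nonempty complex contains it.  It contributes neither to the polyhedron
  nor to the Euler characteristic below.  The library's \<^const>\<open>triangulation\<close> is not required to be
  closed under faces, and its \<^const>\<open>polyhedron\<close> is an intersection of half-spaces; neither is the
  notion needed here.
\<close>

definition triangulates :: "'a::euclidean_space set set \<Rightarrow> 'a set \<Rightarrow> bool" where
  "triangulates K P \<longleftrightarrow> simplicial_complex K \<and> \<Union>K = P"

definition compact_polyhedron :: "'a::euclidean_space set \<Rightarrow> bool" where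
  "compact_polyhedron P \<longleftrightarrow> (\<exists>K. triangulates K P)"

definition complex_vertices :: "'a::euclidean_space set set \<Rightarrow> 'a set" where
  "complex_vertices K = {v. {v} \<in> K}"

definition simplex_vertices :: "'a::euclidean_space set \<Rightarrow> 'a set" where
  "simplex_vertices S = {v. v extreme_point_of S}"

definition barycenter :: "'a::euclidean_space set \<Rightarrow> 'a" where
  "barycenter S = (1 / real (card (simplex_vertices S))) *\<^sub>R (\<Sum>v\<in>simplex_vertices S. v)"

text \<open>The empty chain yields the empty simplex.\<close>

definition barycentric_subdivision :: "'a::euclidean_space set set \<Rightarrow> 'a set set" where
  "barycentric_subdivision K =
     {convex hull (barycenter ` C) | C. C \<subseteq> K - {{}} \<and> chain_subset C}"

text \<open>The supplement of the subcomplex \<open>L\<close> in \<open>K\<close>.\<close>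

definition supplement :: "'a::euclidean_space set set \<Rightarrow> 'a set set \<Rightarrow> 'a set set" where
  "supplement L K =
     {S \<in> barycentric_subdivision K.
        simplex_vertices S \<inter> complex_vertices (barycentric_subdivision L) = {}}"

text \<open>There are no simplices of dimension greater than \<open>DIM('a)\<close>.\<close>

definition complex_euler_char :: "'a::euclidean_space set set \<Rightarrow> int" where
  "complex_euler_char K = (\<Sum>m\<le>DIM('a). (-1) ^ m * int (card {S \<in> K. int m simplex S}))"

text \<open>The common value of \<^const>\<open>complex_euler_char\<close> on all triangulations of the polyhedron \<open>Q\<close>.\<close>

definition polyhedron_euler_char :: "'a::euclidean_space set \<Rightarrow> int" where
  "polyhedron_euler_char Q = (THE c. \<forall>K. triangulates K Q \<longrightarrow> complex_euler_char K = c)"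


section \<open>The homological Euler characteristic\<close>

definition int_independent :: "('b, 'c) monoid_scheme \<Rightarrow> 'b set \<Rightarrow> bool" where
  "int_independent G B \<longleftrightarrow> B \<subseteq> carrier G \<and>
     (\<forall>n::'b \<Rightarrow> int. finprod G (\<lambda>b. b [^]\<^bsub>G\<^esub> n b) B = \<one>\<^bsub>G\<^esub> \<longrightarrow> (\<forall>b\<in>B. n b = 0))"

text \<open>
  The rank of an abelian group, written multiplicatively: the largest cardinality of a finite
  family independent over the integers.
\<close>

definition abelian_rank :: "('b, 'c) monoid_scheme \<Rightarrow> enat" where
  "abelian_rank G = (SUP B\<in>{B. finite B \<and> int_independent G B}. enat (card B))"

text \<open>
  Meaningful for spaces all of whose Betti numbers are finite and almost all of whose Betti
  numbers are zero, such as the supports of piecewise linear functions on a polyhedron.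
\<close>

definition homological_euler_char :: "'a topology \<Rightarrow> int" where
  "homological_euler_char X =
     (\<Sum>p::nat | abelian_rank (homology_group (int p) X) \<noteq> 0.
        (-1) ^ p * int (the_enat (abelian_rank (homology_group (int p) X))))"


section \<open>Piecewise linear functions\<close>

definition affine_linear :: "('a::euclidean_space \<Rightarrow> real) \<Rightarrow> bool" where
  "affine_linear g \<longleftrightarrow> (\<exists>l c. linear l \<and> g = (\<lambda>x. l x + c))"

text \<open>
  A function on \<open>P\<close> is represented by its extension by zero to the whole space; the pointwise
  operations and the pointwise order on functions then restrict to those of functions on \<open>P\<close>.
\<close>

definition nabla :: "'a::euclidean_space set \<Rightarrow> ('a \<Rightarrow> real) set" where
  "nabla P = {f. (\<forall>x. x \<notin> P \<longrightarrow> f x = 0) \<and> continuous_on P f \<and>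
     (\<exists>F. finite F \<and> (\<forall>g\<in>F. affine_linear g) \<and> (\<forall>s\<in>P. \<exists>g\<in>F. f s = g s))}"

definition linearizes :: "'a::euclidean_space set set \<Rightarrow> ('a \<Rightarrow> real) \<Rightarrow> bool" where
  "linearizes K f \<longleftrightarrow> (\<forall>S\<in>K. \<exists>g. affine_linear g \<and> (\<forall>x\<in>S. f x = g x))"

definition schauder_hat :: "'a::euclidean_space set \<Rightarrow> ('a \<Rightarrow> real) \<Rightarrow> bool" where
  "schauder_hat P h \<longleftrightarrow> h \<in> nabla P \<and>
     (\<exists>K v. triangulates K P \<and> linearizes K h \<and> v \<in> complex_vertices K \<and> h v = 1 \<and>
        (\<forall>w\<in>complex_vertices K. w \<noteq> v \<longrightarrow> h w = 0))"

definition zero_subcomplex :: "'a::euclidean_space set set \<Rightarrow> ('a \<Rightarrow> real) \<Rightarrow> 'a set set" where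
  "zero_subcomplex K f = {S \<in> K. \<forall>x\<in>S. f x = 0}"

definition supp :: "'a::euclidean_space set \<Rightarrow> ('a \<Rightarrow> real) \<Rightarrow> 'a set" where
  "supp P f = P - f -` {0}"

definition alpha_plus :: "'a::euclidean_space set \<Rightarrow> ('a \<Rightarrow> real) \<Rightarrow> int" where
  "alpha_plus P f = homological_euler_char (top_of_set (supp P f))"


section \<open>Valuations\<close>

definition positive_cone :: "'v::{zero,ord} set \<Rightarrow> 'v set" where
  "positive_cone V = {x \<in> V. 0 \<le> x}"

text \<open>
  \<open>V\<close> is the carrier of a vector lattice whose zero, addition and lattice operations are
  those of the ambient type.
\<close>

definition pc_valuation :: "'v::{zero,plus,lattice} set \<Rightarrow> ('v \<Rightarrow> real) \<Rightarrow> bool" where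
  "pc_valuation V \<nu> \<longleftrightarrow> \<nu> 0 = 0 \<and>
     (\<forall>x\<in>positive_cone V. \<forall>y\<in>positive_cone V. \<nu> (sup x y) = \<nu> x + \<nu> y - \<nu> (inf x y)) \<and>
     (\<forall>x\<in>positive_cone V. \<forall>y\<in>positive_cone V. \<nu> (x + y) = \<nu> (sup x y))"

end

theory Submission
  imports Defs
begin

text \<open>
  The support of \<open>f\<close> is open in \<open>P\<close>, and \<open>supp (sup f g)\<close>, \<open>supp (inf f g)\<close> are the union and the
  intersection of the supports; so by Mayer-Vietoris the homological Euler characteristic of the support
  satisfies the same inclusion-exclusion formula as \<open>\<nu>\<close>.  The pc-condition makes \<open>\<nu> f\<close> depend on \<open>f\<close>
  only up to mutual domination by constant multiples.  If \<open>K\<close> linearizes \<open>f\<close>, then \<open>f\<close> is equivalent in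
  this sense to the supremum of the barycentric coordinate functions of the vertices where \<open>f > 0\<close>, and
  an infimum of such coordinate functions over a set \<open>T\<close> of vertices is either zero or, if \<open>T\<close> spans a
  simplex, a multiple of the Schauder hat at the barycenter of \<open>T\<close> in a star subdivision; its support is
  the open star of \<open>T\<close>, which is contractible.  Hence both sides agree term by term.  The same
  inclusion-exclusion over open stars of vertices identifies the homological with the combinatorial
  Euler characteristic of a polyhedron, and the support retracts by deformation onto the supplement.
\<close>

section \<open>Rank of an abelian group\<close>

text \<open>The Euler characteristic of a support is defined through homology groups, so additivity
  has to be built on rank-nullity for abelian groups; inclusion-exclusion for two open sets then
  follows from excision and the long exact sequences of two pairs. Open stars are used instead of
  closed simplices because excision wants open sets. Ranks in \<open>enat\<close> and a sum over a
  possibly infinite set of degrees make finiteness of the Betti numbers a condition that every such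
  step has to carry along.

  The other obstacle is that hats live on subdivisions. Complexes are therefore handled through
  vertex sets and uniqueness of barycentric coordinates: that a subdivision is again a complex
  amounts to inverting a formula for coordinates, and no intersection of subdivided simplices is
  examined.

  The hypothesis fixes \<open>\<nu>\<close> only on hats of height 1. This is the origin of the
  factor \<open>card T\<close> in front of a minimum of coordinates over \<open>T\<close>: these
  coordinates all equal \<open>1 / card T\<close> at the barycenter of \<open>T\<close>.\<close>

context comm_group begin

lemma int_pow_finprod:
  fixes n :: int
  assumes "finite A" "f \<in> A \<rightarrow> carrier G"
  shows "(finprod G f A) [^] n = finprod G (\<lambda>a. f a [^] n) A"
  using assms
proof (induction A rule: finite_induct)
  case (insert a A)
  then have "f \<in> A \<rightarrow> carrier G" "f a \<in> carrier G" by auto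
  with insert show ?case
    by (simp add: Pi_def int_pow_distrib)
qed (simp add: int_pow_def2)

text \<open>Exponents multiply like matrices. A relation among products of elements of
  \<open>S\<close> thereby becomes a relation among the elements of \<open>S\<close>
  themselves.\<close>

lemma finprod_finprod_int_pow:
  fixes m :: "'i \<Rightarrow> int" and N :: "'i \<Rightarrow> 'a \<Rightarrow> int"
  assumes "finite J" "finite S" "S \<subseteq> carrier G"
  shows "finprod G (\<lambda>s. (finprod G (\<lambda>t. t [^] N s t) S) [^] m s) J =
         finprod G (\<lambda>t. t [^] (\<Sum>s\<in>J. N s t * m s)) S"
  using assms(1)
proof (induction J rule: finite_induct)
  case empty
  then show ?case using assms by (simp add: finprod_one_eqI)
next
  case (insert j J)
  have S: "\<And>t. t \<in> S \<Longrightarrow> t \<in> carrier G" using assms(3) by auto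
  have "finprod G (\<lambda>s. (finprod G (\<lambda>t. t [^] N s t) S) [^] m s) (insert j J)
      = (finprod G (\<lambda>t. t [^] N j t) S) [^] m j \<otimes> finprod G (\<lambda>t. t [^] (\<Sum>s\<in>J. N s t * m s)) S"
    using insert S by (simp add: Pi_def)
  also have "(finprod G (\<lambda>t. t [^] N j t) S) [^] m j = finprod G (\<lambda>t. t [^] (N j t * m j)) S"
    using S assms(2) by (subst int_pow_finprod) (auto simp: int_pow_pow intro!: finprod_cong')
  also have "\<dots> \<otimes> finprod G (\<lambda>t. t [^] (\<Sum>s\<in>J. N s t * m s)) S
      = finprod G (\<lambda>t. t [^] (N j t * m j) \<otimes> t [^] (\<Sum>s\<in>J. N s t * m s)) S"
    using S by (subst finprod_multf) auto
  also have "\<dots> = finprod G (\<lambda>t. t [^] (\<Sum>s\<in>insert j J. N s t * m s)) S"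
    using S insert by (intro finprod_cong') (auto simp: int_pow_mult)
  finally show ?case .
qed

end

lemma (in group_hom) hom_finprod:
  assumes "comm_group G" "comm_group H" "finite A" "g \<in> A \<rightarrow> carrier G"
  shows "h (finprod G g A) = finprod H (\<lambda>a. h (g a)) A"
proof -
  interpret G: comm_group G by fact
  interpret H: comm_group H by fact
  show ?thesis
    using assms(3,4) by (induction A rule: finite_induct) (auto simp: Pi_def)
qed

text \<open>Indexing makes a repeated element count as a relation, and lets families be joined along
  a disjoint sum without checking that their values differ.\<close>

definition int_independent_family :: "('b, 'c) monoid_scheme \<Rightarrow> ('i \<Rightarrow> 'b) \<Rightarrow> 'i set \<Rightarrow> bool" where
  "int_independent_family G b I \<longleftrightarrow> b ` I \<subseteq> carrier G \<and>
     (\<forall>n::'i \<Rightarrow> int. finprod G (\<lambda>i. b i [^]\<^bsub>G\<^esub> n i) I = \<one>\<^bsub>G\<^esub> \<longrightarrow> (\<forall>i\<in>I. n i = 0))"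

lemma int_independent_iff_family: "int_independent G B \<longleftrightarrow> int_independent_family G (\<lambda>b. b) B"
  by (simp add: int_independent_def int_independent_family_def)

lemma int_independentD:
  assumes "int_independent G B" "finprod G (\<lambda>b. b [^]\<^bsub>G\<^esub> (n b :: int)) B = \<one>\<^bsub>G\<^esub>" "b \<in> B"
  shows "n b = 0"
  using assms unfolding int_independent_def by blast

lemma int_independent_familyD:
  assumes "int_independent_family G b I" "finprod G (\<lambda>i. b i [^]\<^bsub>G\<^esub> (n i :: int)) I = \<one>\<^bsub>G\<^esub>" "i \<in> I"
  shows "n i = 0"
  using assms unfolding int_independent_family_def by blast

lemma int_independent_family_mono:
  assumes "comm_group G" "int_independent_family G b I" "J \<subseteq> I" "finite I"
  shows "int_independent_family G b J"
proof -
  interpret comm_group G by fact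
  have b: "\<And>i. i \<in> I \<Longrightarrow> b i \<in> carrier G" using assms by (auto simp: int_independent_family_def)
  show ?thesis
    unfolding int_independent_family_def
  proof (intro conjI allI impI)
    show "b ` J \<subseteq> carrier G" using b assms by auto
  next
    fix n :: "_ \<Rightarrow> int" assume n: "finprod G (\<lambda>i. b i [^]\<^bsub>G\<^esub> n i) J = \<one>\<^bsub>G\<^esub>"
    have "finprod G (\<lambda>i. b i [^]\<^bsub>G\<^esub> (if i \<in> J then n i else 0)) I = finprod G (\<lambda>i. b i [^]\<^bsub>G\<^esub> n i) J"
      by (rule finprod_mono_neutral_cong_right) (use assms b in auto)
    with n have "\<forall>i\<in>I. (if i \<in> J then n i else 0) = 0"
      using int_independent_familyD[OF assms(2), of "\<lambda>i. if i \<in> J then n i else 0"] by auto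
    with assms show "\<forall>i\<in>J. n i = 0" by (metis in_mono)
  qed
qed

text \<open>Equal members at two indices satisfy the relation with exponents 1 and -1.\<close>

lemma int_independent_family_inj_on:
  assumes "comm_group G" "int_independent_family G b I" "finite I"
  shows "inj_on b I"
proof (rule inj_onI, rule ccontr)
  interpret comm_group G by fact
  fix x y assume xy: "x \<in> I" "y \<in> I" "b x = b y" "x \<noteq> y"
  then have "int_independent_family G b {x, y}"
    using int_independent_family_mono[OF assms(1,2) _ assms(3)] by auto
  moreover have "b x \<in> carrier G" "b y \<in> carrier G"
    using xy assms by (auto simp: int_independent_family_def)
  then have "finprod G (\<lambda>i. b i [^]\<^bsub>G\<^esub> (if i = x then 1 else - 1 :: int)) {x, y} = \<one>\<^bsub>G\<^esub>"
    using xy by (simp add: Pi_def int_pow_neg)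
  ultimately show False
    using int_independent_familyD[of G b "{x, y}" "\<lambda>i. if i = x then 1 else - 1" x] by simp
qed

lemma int_independent_family_image:
  assumes "comm_group G" "int_independent_family G b I" "finite I"
  shows "int_independent G (b ` I)"
proof -
  interpret comm_group G by fact
  have inj: "inj_on b I" using int_independent_family_inj_on assms by blast
  have b: "b \<in> I \<rightarrow> carrier G" using assms(2) by (auto simp: int_independent_family_def)
  have "finprod G (\<lambda>x. x [^]\<^bsub>G\<^esub> n x) (b ` I) = finprod G (\<lambda>i. b i [^]\<^bsub>G\<^esub> n (b i)) I" for n :: "_ \<Rightarrow> int"
    using b inj by (subst finprod_reindex) auto
  with assms(2) b show ?thesis
    by (auto simp: int_independent_def int_independent_family_def)
qed

text \<open>Taken on subsets, so that kernels and images need not be turned into groups.\<close>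

definition rank_of :: "('b, 'c) monoid_scheme \<Rightarrow> 'b set \<Rightarrow> enat" where
  "rank_of G K = (SUP B\<in>{B. finite B \<and> B \<subseteq> K \<and> int_independent G B}. enat (card B))"

lemma abelian_rank_eq: "abelian_rank G = rank_of G (carrier G)"
proof -
  have "{B. finite B \<and> int_independent G B} = {B. finite B \<and> B \<subseteq> carrier G \<and> int_independent G B}"
    unfolding int_independent_def by blast
  then show ?thesis by (simp add: abelian_rank_def rank_of_def)
qed

lemma card_le_rank_of:
  assumes "comm_group G" "int_independent_family G b I" "finite I" "b ` I \<subseteq> K"
  shows "enat (card I) \<le> rank_of G K"
proof -
  have "card I = card (b ` I)"
    using int_independent_family_inj_on[OF assms(1-3)] by (simp add: card_image)
  moreover have "b ` I \<in> {B. finite B \<and> B \<subseteq> K \<and> int_independent G B}"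
    using int_independent_family_image[OF assms(1-3)] assms(3,4) by blast
  ultimately show ?thesis
    unfolding rank_of_def using SUP_upper[of "b ` I" _ "\<lambda>B. enat (card B)"] by simp
qed

lemma rank_of_le:
  assumes "\<And>B. finite B \<Longrightarrow> B \<subseteq> K \<Longrightarrow> int_independent G B \<Longrightarrow> enat (card B) \<le> r"
  shows "rank_of G K \<le> r"
  unfolding rank_of_def using assms by (intro SUP_least) blast

lemma rank_of_one:
  assumes "comm_group G"
  shows "rank_of G {\<one>\<^bsub>G\<^esub>} = 0"
proof -
  interpret comm_group G by fact
  have "B = {}" if "B \<subseteq> {\<one>\<^bsub>G\<^esub>}" "int_independent G B" for B
  proof (rule ccontr)
    assume "B \<noteq> {}"
    with that have "B = {\<one>\<^bsub>G\<^esub>}" by auto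
    moreover have "finprod G (\<lambda>b. b [^]\<^bsub>G\<^esub> (1::int)) {\<one>\<^bsub>G\<^esub>} = \<one>\<^bsub>G\<^esub>" by (simp add: Pi_def)
    ultimately show False using int_independentD[OF that(2), of "\<lambda>_. 1" "\<one>\<^bsub>G\<^esub>"] by simp
  qed
  then have "rank_of G {\<one>\<^bsub>G\<^esub>} \<le> 0"
    by (intro rank_of_le) (metis card.empty zero_enat_def order_refl)
  then show ?thesis by simp
qed

text \<open>For finite \<open>c\<close> both families are bounded, so their suprema in
  \<open>enat\<close> are attained and the hypothesis applies to the maximizing pair.\<close>

lemma SUP_add_SUP_le:
  fixes f :: "'i \<Rightarrow> enat"
  assumes "\<And>x y. x \<in> A \<Longrightarrow> y \<in> B \<Longrightarrow> f x + g y \<le> c" "A \<noteq> {}" "B \<noteq> {}"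
  shows "(SUP x\<in>A. f x) + (SUP y\<in>B. g y) \<le> c"
proof (cases c)
  case (enat k)
  have fin: "Sup (h ` C) \<in> h ` C" if "C \<noteq> {}" "\<And>x. x \<in> C \<Longrightarrow> h x \<le> enat k" for h :: "'z \<Rightarrow> enat" and C
  proof -
    have "finite (h ` C)"
      using that by (intro finite_enat_bounded) auto
    then show ?thesis using that(1) by (metis Max_Sup Max_in image_is_empty)
  qed
  obtain x0 y0 where "x0 \<in> A" "y0 \<in> B" using assms by auto
  have "f x \<le> enat k" if "x \<in> A" for x
    using assms(1)[OF that \<open>y0 \<in> B\<close>] enat by (cases "f x"; cases "g y0") auto
  moreover have "g y \<le> enat k" if "y \<in> B" for y
    using assms(1)[OF \<open>x0 \<in> A\<close> that] enat by (cases "f x0"; cases "g y") auto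
  ultimately have "Sup (f ` A) \<in> f ` A" "Sup (g ` B) \<in> g ` B"
    using fin[of A f] fin[of B g] assms(2,3) by simp_all
  then obtain x y where "x \<in> A" "Sup (f ` A) = f x" "y \<in> B" "Sup (g ` B) = g y"
    unfolding image_iff by (elim bexE) blast
  then show ?thesis using assms(1)[of x y] by (simp only:)
qed simp

text \<open>Rank-nullity over the integers. An independent set is split into a part with independent
  image and a rest that can be pushed into the kernel, though only after passing to nonzero powers,
  as there is no division. Conversely, an independent set of the kernel together with lifts of an
  independent set of the image is independent.\<close>

theorem rank_of_kernel_image:
  assumes G: "comm_group G" and H: "comm_group H" and f: "f \<in> hom G H"
  shows "rank_of G (carrier G) = rank_of G (kernel G H f) + rank_of H (f ` carrier G)"
proof (rule antisym)
  interpret G: comm_group G by fact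
  interpret H: comm_group H by fact
  interpret group_hom G H f
    using f by (simp add: group_hom_def group_hom_axioms_def G.group_axioms H.group_axioms)
  show "rank_of G (carrier G) \<le> rank_of G (kernel G H f) + rank_of H (f ` carrier G)"
  proof (rule rank_of_le)
    fix S assume S: "finite S" "S \<subseteq> carrier G" "int_independent G S"
    \<comment> \<open>A maximal \<open>T\<close> forces each further \<open>s\<close> into a
      relation modulo the kernel involving \<open>s\<close> and \<open>T\<close> only.\<close>
    define \<T> where "\<T> = {T. T \<subseteq> S \<and> int_independent_family H f T}"
    have "{} \<in> \<T>" by (auto simp: \<T>_def int_independent_family_def)
    moreover have "finite \<T>" using S by (auto simp: \<T>_def)
    ultimately obtain T where T: "T \<in> \<T>" and max: "\<And>T'. T' \<in> \<T> \<Longrightarrow> T \<subseteq> T' \<Longrightarrow> T' = T"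
      using finite_has_maximal by (metis empty_iff)
    have TS: "T \<subseteq> S" and Tind: "int_independent_family H f T" using T by (auto simp: \<T>_def)
    have carr: "\<And>s. s \<in> S \<Longrightarrow> s \<in> carrier G" using S by auto
    have finT: "finite T" using TS S finite_subset by blast
    have "\<exists>n::_ \<Rightarrow> int. n s \<noteq> 0 \<and> (\<forall>t. t \<notin> insert s T \<longrightarrow> n t = 0) \<and>
            f (finprod G (\<lambda>t. t [^]\<^bsub>G\<^esub> n t) S) = \<one>\<^bsub>H\<^esub>" if s: "s \<in> S - T" for s
    proof -
      have "insert s T \<notin> \<T>" using max[of "insert s T"] s by auto
      then have "\<not> int_independent_family H f (insert s T)" using s TS by (auto simp: \<T>_def)
      moreover have "f ` insert s T \<subseteq> carrier H" using s TS carr by auto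
      ultimately obtain n :: "_ \<Rightarrow> int" and i where n: "finprod H (\<lambda>i. f i [^]\<^bsub>H\<^esub> n i) (insert s T) = \<one>\<^bsub>H\<^esub>"
        and i: "i \<in> insert s T" "n i \<noteq> 0"
        unfolding int_independent_family_def by blast
      \<comment> \<open>With exponent 0 at \<open>s\<close> the relation would be one among the
        images of \<open>T\<close> alone.\<close>
      have ns: "n s \<noteq> 0"
      proof
        assume n0: "n s = 0"
        have "finprod H (\<lambda>i. f i [^]\<^bsub>H\<^esub> n i) (insert s T) = finprod H (\<lambda>i. f i [^]\<^bsub>H\<^esub> n i) T"
          using s finT TS carr n0
          by (subst H.finprod_insert) (auto intro!: H.l_one H.finprod_closed)
        with n have "\<forall>i\<in>T. n i = 0"
          using int_independent_familyD[OF Tind, of n] by auto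
        with n0 i show False by auto
      qed
      define n' where "n' t = (if t \<in> insert s T then n t else 0)" for t
      have "f (finprod G (\<lambda>t. t [^]\<^bsub>G\<^esub> n' t) S) = finprod H (\<lambda>t. f (t [^]\<^bsub>G\<^esub> n' t)) S"
        using carr S by (intro hom_finprod G H) auto
      also have "\<dots> = finprod H (\<lambda>t. f t [^]\<^bsub>H\<^esub> n t) (insert s T)"
        using s TS carr S by (intro H.finprod_mono_neutral_cong_right) (auto simp: n'_def hom_int_pow)
      finally show ?thesis
        using n ns by (intro exI[of _ n']) (auto simp: n'_def)
    qed
    then obtain N :: "_ \<Rightarrow> _ \<Rightarrow> int" where N: "\<And>s. s \<in> S - T \<Longrightarrow> N s s \<noteq> 0"
      "\<And>s t. s \<in> S - T \<Longrightarrow> t \<notin> insert s T \<Longrightarrow> N s t = 0"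
      "\<And>s. s \<in> S - T \<Longrightarrow> f (finprod G (\<lambda>t. t [^]\<^bsub>G\<^esub> N s t) S) = \<one>\<^bsub>H\<^esub>"
      by metis
    define k where "k s = finprod G (\<lambda>t. t [^]\<^bsub>G\<^esub> N s t) S" for s
    have k: "k s \<in> carrier G" for s
      unfolding k_def using carr by (intro G.finprod_closed) auto
    have "int_independent_family G k (S - T)"
      unfolding int_independent_family_def
    proof (intro conjI allI impI ballI)
      show "k ` (S - T) \<subseteq> carrier G" using k by auto
    next
      fix m :: "_ \<Rightarrow> int" and t
      assume m: "finprod G (\<lambda>s. k s [^]\<^bsub>G\<^esub> m s) (S - T) = \<one>\<^bsub>G\<^esub>" and t: "t \<in> S - T"
      have "finprod G (\<lambda>t. t [^]\<^bsub>G\<^esub> (\<Sum>s\<in>S-T. N s t * m s)) S = \<one>\<^bsub>G\<^esub>"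
        using m S by (simp add: k_def G.finprod_finprod_int_pow)
      then have "(\<Sum>s\<in>S-T. N s t * m s) = 0"
        using int_independentD[OF S(3), of "\<lambda>t. \<Sum>s\<in>S-T. N s t * m s"] t by blast
      \<comment> \<open>The row \<open>N s\<close> is supported on \<open>insert s T\<close>, so on
        \<open>S - T\<close> the matrix is diagonal, with nonzero entries.\<close>
      moreover have "(\<Sum>s\<in>S-T. N s t * m s) = (\<Sum>s\<in>{t}. N s t * m s)"
        using S t N(2) by (intro sum.mono_neutral_right) auto
      ultimately show "m t = 0" using N(1)[OF t] by simp
    qed
    then have "enat (card (S - T)) \<le> rank_of G (kernel G H f)"
      by (rule card_le_rank_of[OF G]) (use S N(3) k in \<open>auto simp: kernel_def k_def\<close>)
    moreover have "enat (card T) \<le> rank_of H (f ` carrier G)"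
      by (rule card_le_rank_of[OF H Tind finT]) (use TS carr in auto)
    moreover have "card S = card (S - T) + card T"
      using TS S finT by (metis card_Diff_subset card_mono le_add_diff_inverse2)
    ultimately show "enat (card S) \<le> rank_of G (kernel G H f) + rank_of H (f ` carrier G)"
      by (metis add_mono plus_enat_simps(1))
  qed
  show "rank_of G (kernel G H f) + rank_of H (f ` carrier G) \<le> rank_of G (carrier G)"
    unfolding rank_of_def[of G "kernel G H f"] rank_of_def[of H]
  proof (rule SUP_add_SUP_le)
    fix B C assume "B \<in> {B. finite B \<and> B \<subseteq> kernel G H f \<and> int_independent G B}"
      and "C \<in> {C. finite C \<and> C \<subseteq> f ` carrier G \<and> int_independent H C}"
    then have B: "finite B" "B \<subseteq> kernel G H f" "int_independent G B"
      and C: "finite C" "C \<subseteq> f ` carrier G" "int_independent H C" by auto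
    define g where "g c = (SOME x. x \<in> carrier G \<and> f x = c)" for c
    have g: "g c \<in> carrier G" "f (g c) = c" if "c \<in> C" for c
    proof -
      have "\<exists>x. x \<in> carrier G \<and> f x = c" using that C by auto
      from someI_ex[OF this] show "g c \<in> carrier G" "f (g c) = c" by (simp_all add: g_def)
    qed
    have Bc: "\<And>b. b \<in> B \<Longrightarrow> b \<in> carrier G \<and> f b = \<one>\<^bsub>H\<^esub>" using B by (auto simp: kernel_def)
    have Cc: "\<And>c. c \<in> C \<Longrightarrow> c \<in> carrier H" using C by auto
    define b where "b = case_sum (\<lambda>x. x) g"
    have split: "finprod G (\<lambda>i. b i [^]\<^bsub>G\<^esub> n i) (B <+> C) =
       finprod G (\<lambda>x. x [^]\<^bsub>G\<^esub> n (Inl x)) B \<otimes>\<^bsub>G\<^esub> finprod G (\<lambda>c. g c [^]\<^bsub>G\<^esub> n (Inr c)) C" for n :: "_ \<Rightarrow> int"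
    proof -
      have "finprod G (\<lambda>i. b i [^]\<^bsub>G\<^esub> n i) (Inl ` B \<union> Inr ` C) =
         finprod G (\<lambda>i. b i [^]\<^bsub>G\<^esub> n i) (Inl ` B) \<otimes>\<^bsub>G\<^esub> finprod G (\<lambda>i. b i [^]\<^bsub>G\<^esub> n i) (Inr ` C)"
        by (rule G.finprod_Un_disjoint) (use B(1) C(1) Bc g(1) in \<open>auto simp: b_def\<close>)
      also have "finprod G (\<lambda>i. b i [^]\<^bsub>G\<^esub> n i) (Inl ` B) = finprod G (\<lambda>x. x [^]\<^bsub>G\<^esub> n (Inl x)) B"
        by (subst G.finprod_reindex) (use Bc in \<open>auto simp: b_def\<close>)
      also have "finprod G (\<lambda>i. b i [^]\<^bsub>G\<^esub> n i) (Inr ` C) = finprod G (\<lambda>c. g c [^]\<^bsub>G\<^esub> n (Inr c)) C"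
        by (subst G.finprod_reindex) (use g(1) in \<open>auto simp: b_def\<close>)
      finally show ?thesis by (simp add: Plus_def)
    qed
    have "int_independent_family G b (B <+> C)"
      unfolding int_independent_family_def
    proof (intro conjI allI impI)
      show "b ` (B <+> C) \<subseteq> carrier G" using Bc g by (auto simp: b_def)
    next
      fix n :: "_ \<Rightarrow> int" assume n: "finprod G (\<lambda>i. b i [^]\<^bsub>G\<^esub> n i) (B <+> C) = \<one>\<^bsub>G\<^esub>"
      let ?x = "finprod G (\<lambda>x. x [^]\<^bsub>G\<^esub> n (Inl x)) B" and ?y = "finprod G (\<lambda>c. g c [^]\<^bsub>G\<^esub> n (Inr c)) C"
      have xc: "?x \<in> carrier G" "?y \<in> carrier G"
        using Bc g by (auto intro!: G.finprod_closed)
      have "f ?x = finprod H (\<lambda>x. f (x [^]\<^bsub>G\<^esub> n (Inl x))) B"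
        using Bc B by (intro hom_finprod G H) auto
      also have "\<dots> = \<one>\<^bsub>H\<^esub>" using Bc by (intro H.finprod_one_eqI) (auto simp: hom_int_pow)
      finally have fx: "f ?x = \<one>\<^bsub>H\<^esub>" .
      have "f ?y = finprod H (\<lambda>c. f (g c [^]\<^bsub>G\<^esub> n (Inr c))) C"
        using g C by (intro hom_finprod G H) auto
      also have "\<dots> = finprod H (\<lambda>c. c [^]\<^bsub>H\<^esub> n (Inr c)) C"
        using g Cc by (intro H.finprod_cong') (auto simp: hom_int_pow)
      finally have fy: "f ?y = finprod H (\<lambda>c. c [^]\<^bsub>H\<^esub> n (Inr c)) C" .
      have "f (?x \<otimes>\<^bsub>G\<^esub> ?y) = \<one>\<^bsub>H\<^esub>" using n split[of n] by simp
      then have "finprod H (\<lambda>c. c [^]\<^bsub>H\<^esub> n (Inr c)) C = \<one>\<^bsub>H\<^esub>"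
        using xc fx fy by (metis H.l_one hom_closed hom_mult)
      then have nC: "\<forall>c\<in>C. n (Inr c) = 0"
        using int_independentD[OF C(3), of "\<lambda>c. n (Inr c)"] by blast
      then have "?y = \<one>\<^bsub>G\<^esub>" by (intro G.finprod_one_eqI) auto
      then have "?x = \<one>\<^bsub>G\<^esub>" using n split[of n] xc by simp
      then have "\<forall>x\<in>B. n (Inl x) = 0"
        using int_independentD[OF B(3), of "\<lambda>c. n (Inl c)"] by blast
      with nC show "\<forall>i\<in>B <+> C. n i = 0" by auto
    qed
    moreover from this have "b ` (B <+> C) \<subseteq> carrier G"
      by (simp add: int_independent_family_def)
    ultimately have "enat (card (B <+> C)) \<le> rank_of G (carrier G)"
      using B(1) C(1) by (intro card_le_rank_of[OF G]) simp_all
    then show "enat (card B) + enat (card C) \<le> rank_of G (carrier G)"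
      using B C by (simp add: card_Plus)
  next
    have "int_independent G {}" "int_independent H {}" by (simp_all add: int_independent_def)
    then show "{B. finite B \<and> B \<subseteq> kernel G H f \<and> int_independent G B} \<noteq> {}"
      and "{B. finite B \<and> B \<subseteq> f ` carrier G \<and> int_independent H B} \<noteq> {}"
      by (metis (mono_tags, lifting) empty_Collect_eq empty_subsetI finite.emptyI)+
  qed
qed

lemma abelian_rank_iso:
  assumes "comm_group G" "comm_group H" "G \<cong> H"
  shows "abelian_rank G = abelian_rank H"
proof -
  interpret G: comm_group G by fact
  interpret H: comm_group H by fact
  obtain f where f: "f \<in> iso G H" using assms by (auto simp: is_iso_def)
  then have h: "f \<in> hom G H" "f ` carrier G = carrier H" "inj_on f (carrier G)"
    by (auto simp: iso_def bij_betw_def)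
  interpret group_hom G H f
    using h by (simp add: group_hom_def group_hom_axioms_def G.group_axioms H.group_axioms)
  have "kernel G H f = {\<one>\<^bsub>G\<^esub>}" using h(3) by (simp add: inj_iff_trivial_ker)
  then show ?thesis
    using rank_of_kernel_image[OF assms(1,2) h(1)] h(2) rank_of_one[OF assms(1)]
    by (simp add: abelian_rank_eq)
qed

lemma abelian_rank_trivial_group:
  assumes "comm_group G" "trivial_group G"
  shows "abelian_rank G = 0"
  using assms rank_of_one[of G] by (simp add: abelian_rank_eq trivial_group_def)

lemma abelian_rank_integer_group: "abelian_rank integer_group = 1"
proof (rule antisym)
  interpret comm_group integer_group by (rule abelian_integer_group)
  show "abelian_rank integer_group \<le> 1"
    unfolding abelian_rank_eq
  proof (rule rank_of_le)
    fix B assume B: "finite B" "int_independent integer_group B"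
    have "card B \<le> 1"
    proof (rule ccontr)
      assume "\<not> card B \<le> 1"
      then obtain x y where xy: "x \<in> B" "y \<in> B" "x \<noteq> y"
        using B(1) by (metis One_nat_def card_le_Suc0_iff_eq)
      then have "int_independent_family integer_group (\<lambda>b. b) {x, y}"
        using int_independent_family_mono[OF abelian_integer_group, of "\<lambda>b. b" B "{x,y}"] B
        by (auto simp: int_independent_iff_family)
      \<comment> \<open>In additive terms the relation is \<open>y * x - x * y = 0\<close>; its
        exponents are not both zero because \<open>x\<close> and \<open>y\<close> differ.\<close>
      moreover have "finprod integer_group (\<lambda>i. i [^]\<^bsub>integer_group\<^esub> (if i = x then y else - x)) {x, y} = \<one>\<^bsub>integer_group\<^esub>"
        using xy by (simp add: Pi_def)
      ultimately have "(if i = x then y else - x) = 0" if "i \<in> {x, y}" for i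
        using int_independent_familyD[of integer_group "\<lambda>b. b" "{x, y}" "\<lambda>i. if i = x then y else - x" i] that by blast
      from this[of x] this[of y] show False using xy by auto
    qed
    then show "enat (card B) \<le> 1" by (simp add: one_enat_def)
  qed
  have "int_independent_family integer_group (\<lambda>b. b) {1}"
    by (auto simp: int_independent_family_def Pi_def)
  from card_le_rank_of[OF abelian_integer_group this, of "carrier integer_group"]
  show "1 \<le> abelian_rank integer_group" by (simp add: abelian_rank_eq one_enat_def)
qed

section \<open>The homological Euler characteristic\<close>

definition alternating_sum :: "(nat \<Rightarrow> enat) \<Rightarrow> int" where
  "alternating_sum b = (\<Sum>p::nat | b p \<noteq> 0. (-1) ^ p * int (the_enat (b p)))"

text \<open>Outside this class an alternating sum carries no information: \<open>the_enat\<close> is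
  unspecified at infinity, and a sum over infinitely many degrees is 0 by convention.\<close>

definition finite_type :: "(nat \<Rightarrow> enat) \<Rightarrow> bool" where
  "finite_type b \<longleftrightarrow> (\<forall>p. b p \<noteq> \<infinity>) \<and> (\<exists>N. \<forall>p\<ge>N. b p = 0)"

lemma alternating_sum_enat:
  assumes "\<And>p. p \<ge> N \<Longrightarrow> b p = 0"
  shows "alternating_sum (\<lambda>p. enat (b p)) = (\<Sum>p<N. (-1) ^ p * int (b p))"
  unfolding alternating_sum_def
proof (rule sum.mono_neutral_cong_left)
  show "{p. enat (b p) \<noteq> 0} \<subseteq> {..<N}"
    using assms by (force simp: zero_enat_def not_less[symmetric])
qed (auto simp: zero_enat_def)

lemma telescoping_alternating_sum:
  "(\<Sum>p<N. (-1) ^ p * (int (d (Suc p)) + int (d p))) = int (d 0) - (-1) ^ N * int (d N)"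
  by (induction N) (auto simp: algebra_simps)

lemma finite_typeI:
  assumes "\<And>p. b p \<noteq> \<infinity>" "\<And>p. p \<ge> N \<Longrightarrow> b p = 0"
  shows "finite_type b"
  unfolding finite_type_def using assms by blast

lemma finite_typeE:
  assumes "finite_type b"
  obtains N where "\<forall>p. b p \<noteq> \<infinity>" "\<forall>p\<ge>N. b p = 0"
proof -
  from assms obtain N where "\<forall>p\<ge>N. b p = 0" unfolding finite_type_def by (elim conjE exE)
  with assms show thesis by (intro that[of N]) (simp_all add: finite_type_def)
qed

lemma finite_type_add:
  "finite_type (\<lambda>p. b p + c p) \<longleftrightarrow> finite_type b \<and> finite_type c"
proof
  assume a: "finite_type b \<and> finite_type c"
  obtain M where M: "\<forall>p. b p \<noteq> \<infinity>" "\<forall>p\<ge>M. b p = 0"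
    by (rule finite_typeE[OF conjunct1[OF a]])
  obtain N where N: "\<forall>p. c p \<noteq> \<infinity>" "\<forall>p\<ge>N. c p = 0"
    by (rule finite_typeE[OF conjunct2[OF a]])
  show "finite_type (\<lambda>p. b p + c p)"
  proof (rule finite_typeI[of _ "max M N"])
    show "b p + c p \<noteq> \<infinity>" for p using M(1) N(1) by (metis plus_eq_infty_iff_enat)
  qed (use M N in auto)
next
  assume "finite_type (\<lambda>p. b p + c p)"
  then obtain N where N: "\<forall>p. b p + c p \<noteq> \<infinity>" "\<forall>p\<ge>N. b p + c p = 0"
    by (rule finite_typeE)
  have "b p \<noteq> \<infinity>" "c p \<noteq> \<infinity>" for p
    using N(1) by (metis plus_eq_infty_iff_enat)+
  then have "finite_type b" "finite_type c"
    using N(2) by (auto intro!: finite_typeI[of _ N] simp del: not_infinity_eq)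
  then show "finite_type b \<and> finite_type c" ..
qed

lemma finite_type_Suc: "finite_type b \<longleftrightarrow> finite_type (\<lambda>p. b (Suc p)) \<and> b 0 \<noteq> \<infinity>"
proof
  assume a: "finite_type (\<lambda>p. b (Suc p)) \<and> b 0 \<noteq> \<infinity>"
  then obtain N where N: "\<forall>p. b (Suc p) \<noteq> \<infinity>" "\<forall>p\<ge>N. b (Suc p) = 0"
    using finite_typeE[OF conjunct1[OF a]] by metis
  show "finite_type b"
  proof (rule finite_typeI)
    show "b p \<noteq> \<infinity>" for p using N a by (cases p) auto
    show "b p = 0" if "p \<ge> Suc N" for p using N that by (cases p) auto
  qed
next
  assume "finite_type b"
  then obtain N where N: "\<forall>p. b p \<noteq> \<infinity>" "\<forall>p\<ge>N. b p = 0"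
    by (rule finite_typeE)
  have "finite_type (\<lambda>p. b (Suc p))" by (rule finite_typeI[of _ N]) (use N in auto)
  with N show "finite_type (\<lambda>p. b (Suc p)) \<and> b 0 \<noteq> \<infinity>" by auto
qed

lemma finite_type_enatE:
  assumes "finite_type b"
  obtains c N where "b = (\<lambda>p. enat (c p))" "\<forall>p\<ge>N. c p = 0"
proof -
  obtain N where N: "\<forall>p. b p \<noteq> \<infinity>" "\<forall>p\<ge>N. b p = 0"
    using finite_typeE[OF assms] by metis
  show thesis
  proof (rule that)
    show "b = (\<lambda>p. enat (the_enat (b p)))"
      using N by (intro ext) (metis not_infinity_eq the_enat.simps)
    show "\<forall>p\<ge>N. the_enat (b p) = 0" using N by (simp add: zero_enat_def)
  qed
qed

text \<open>
  The hypotheses describe a long exact sequence with ranks \<open>a\<close>, \<open>x\<close>, \<open>r\<close> in degree \<open>p\<close>, the ranks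
  of the images of its maps being \<open>i\<close>, \<open>j\<close>, \<open>d\<close>.
\<close>

lemma alternating_sum_long_exact:
  assumes a: "\<And>p. a p = d (Suc p) + i p" and x: "\<And>p. x p = i p + j p" and r: "\<And>p. r p = j p + d p"
    and d0: "d 0 = 0"
  shows "finite_type a \<Longrightarrow> finite_type x \<Longrightarrow> finite_type r"
    and "finite_type a \<Longrightarrow> finite_type r \<Longrightarrow> finite_type x"
    and "finite_type a \<Longrightarrow> finite_type x \<Longrightarrow> alternating_sum x = alternating_sum a + alternating_sum r"
proof -
  have a': "a = (\<lambda>p. d (Suc p) + i p)" and x': "x = (\<lambda>p. i p + j p)" and r': "r = (\<lambda>p. j p + d p)"
    using a x r by auto
  have "finite_type d \<longleftrightarrow> finite_type (\<lambda>p. d (Suc p))"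
    using d0 finite_type_Suc[of d] by simp
  then have fa: "finite_type a \<longleftrightarrow> finite_type d \<and> finite_type i"
    unfolding a' by (simp only: finite_type_add)
  have fx: "finite_type x \<longleftrightarrow> finite_type i \<and> finite_type j"
    unfolding x' by (simp only: finite_type_add)
  have fr: "finite_type r \<longleftrightarrow> finite_type j \<and> finite_type d"
    unfolding r' by (simp only: finite_type_add)
  show "finite_type a \<Longrightarrow> finite_type x \<Longrightarrow> finite_type r"
    and "finite_type a \<Longrightarrow> finite_type r \<Longrightarrow> finite_type x"
    using fa fx fr by auto
  assume "finite_type a" "finite_type x"
  then have "finite_type i" "finite_type j" "finite_type d" using fa fx by auto
  obtain i' K where i: "i = (\<lambda>p. enat (i' p))" "\<forall>p\<ge>K. i' p = 0"
    by (rule finite_type_enatE[OF \<open>finite_type i\<close>])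
  obtain j' L where j: "j = (\<lambda>p. enat (j' p))" "\<forall>p\<ge>L. j' p = 0"
    by (rule finite_type_enatE[OF \<open>finite_type j\<close>])
  obtain d' M where d: "d = (\<lambda>p. enat (d' p))" "\<forall>p\<ge>M. d' p = 0"
    by (rule finite_type_enatE[OF \<open>finite_type d\<close>])
  \<comment> \<open>A common cutoff for the three sequences; the ranks of the boundary maps
    telescope up to it, with zero at both ends.\<close>
  define N where "N = max K (max L M)"
  have as: "alternating_sum a = (\<Sum>p<N. (-1) ^ p * int (d' (Suc p) + i' p))"
    unfolding a' i(1) d(1) plus_enat_simps
    by (rule alternating_sum_enat) (use i d in \<open>auto simp: N_def\<close>)
  have xs: "alternating_sum x = (\<Sum>p<N. (-1) ^ p * int (i' p + j' p))"
    unfolding x' i(1) j(1) plus_enat_simps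
    by (rule alternating_sum_enat) (use i j in \<open>auto simp: N_def\<close>)
  have rs: "alternating_sum r = (\<Sum>p<N. (-1) ^ p * int (j' p + d' p))"
    unfolding r' j(1) d(1) plus_enat_simps
    by (rule alternating_sum_enat) (use j d in \<open>auto simp: N_def\<close>)
  have "d' 0 = 0" "d' N = 0" using d0 d by (auto simp: zero_enat_def N_def)
  then have "(\<Sum>p<N. (-1) ^ p * (int (d' (Suc p)) + int (d' p))) = 0"
    by (simp add: telescoping_alternating_sum)
  moreover have "alternating_sum a + alternating_sum r - alternating_sum x =
      (\<Sum>p<N. (-1) ^ p * (int (d' (Suc p)) + int (d' p)))"
    unfolding as xs rs sum.distrib[symmetric] sum_subtractf[symmetric]
    by (intro sum.cong) (auto simp: algebra_simps)
  ultimately show "alternating_sum x = alternating_sum a + alternating_sum r" by simp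
qed

section \<open>Betti numbers of pairs, excision and Mayer-Vietoris\<close>

definition betti :: "'a topology \<Rightarrow> 'a set \<Rightarrow> nat \<Rightarrow> enat" where
  "betti X S p = abelian_rank (relative_homology_group (int p) X S)"

lemma homological_euler_char_eq: "homological_euler_char X = alternating_sum (betti X {})"
  by (simp add: homological_euler_char_def alternating_sum_def betti_def)

text \<open>Rank-nullity for each of the three maps in the sequence of the pair, the kernel of one
  being the image of its predecessor. Here \<open>d p\<close> is the rank of the boundary map
  leaving degree \<open>p\<close>, hence the shift in the first equation; \<open>d 0\<close>
  vanishes because its target is the homology in degree -1.\<close>

lemma betti_long_exact:
  obtains d i j where
    "\<forall>p. betti (subtopology X S) {} p = d (Suc p) + i p" "\<forall>p. betti X {} p = i p + j p"
    "\<forall>p. betti X S p = j p + d p" "d 0 = 0"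
proof -
  let ?A = "subtopology X S"
  let ?d = "\<lambda>q. rank_of (homology_group (q - 1) ?A) (hom_boundary q X S ` carrier (relative_homology_group q X S))"
  let ?i = "\<lambda>q. rank_of (homology_group q X) (hom_induced q ?A {} X {} id ` carrier (homology_group q ?A))"
  let ?j = "\<lambda>q. rank_of (relative_homology_group q X S) (hom_induced q X {} X S id ` carrier (homology_group q X))"
  have a: "abelian_rank (homology_group q ?A) = ?d (q + 1) + ?i q" for q
    using rank_of_kernel_image[OF abelian_relative_homology_group abelian_relative_homology_group hom_induced_empty_hom, of q ?A X id]
      homology_exactness_axiom_2[of "q + 1" X S]
    by (simp add: abelian_rank_eq)
  have x: "abelian_rank (homology_group q X) = ?i q + ?j q" for q
    using rank_of_kernel_image[OF abelian_relative_homology_group abelian_relative_homology_group hom_induced_hom, of q X "{}" X S id]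
      homology_exactness_axiom_3[of q X S]
    by (simp add: abelian_rank_eq)
  have r: "abelian_rank (relative_homology_group q X S) = ?j q + ?d q" for q
    using rank_of_kernel_image[OF abelian_relative_homology_group abelian_relative_homology_group hom_boundary_hom, of q X S]
      homology_exactness_axiom_1[of q X S]
    by (simp add: abelian_rank_eq)
  have "?d 0 + ?i (-1) = 0"
    using a[of "-1"] abelian_rank_trivial_group[OF abelian_relative_homology_group, of "-1" ?A "{}"] by simp
  then have "?d 0 = 0" by simp
  then show thesis
    using that[of "\<lambda>p. ?d (int p)" "\<lambda>p. ?i (int p)" "\<lambda>p. ?j (int p)"] a x r
    by (simp add: betti_def add.commute)
qed

lemma finite_type_betti_long_exact:
  assumes "finite_type (betti (subtopology X S) {})"
  shows "finite_type (betti X {}) \<Longrightarrow> finite_type (betti X S)"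
    and "finite_type (betti X S) \<Longrightarrow> finite_type (betti X {})"
    and "finite_type (betti X {}) \<Longrightarrow>
      alternating_sum (betti X {}) = alternating_sum (betti (subtopology X S) {}) + alternating_sum (betti X S)"
proof -
  obtain d i j where
    "\<forall>p. betti (subtopology X S) {} p = d (Suc p) + i p" "\<forall>p. betti X {} p = i p + j p"
    "\<forall>p. betti X S p = j p + d p" "d 0 = 0"
    by (rule betti_long_exact)
  note * = alternating_sum_long_exact[OF this(1-3)[rule_format] this(4)]
  show "finite_type (betti X {}) \<Longrightarrow> finite_type (betti X S)"
    and "finite_type (betti X S) \<Longrightarrow> finite_type (betti X {})"
    and "finite_type (betti X {}) \<Longrightarrow>
      alternating_sum (betti X {}) = alternating_sum (betti (subtopology X S) {}) + alternating_sum (betti X S)"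
    using * assms by simp_all
qed

text \<open>Excising \<open>U - V\<close> from the pair of \<open>U \<union> V\<close> and
  \<open>U\<close> leaves the pair of \<open>V\<close> and \<open>U \<inter> V\<close>. Openness of
  \<open>V\<close> makes \<open>U - V\<close> closed, and openness of \<open>U\<close> makes
  \<open>U\<close> its own interior.\<close>

lemma betti_excision:
  fixes U V :: "'a::topological_space set"
  assumes "openin (top_of_set (U \<union> V)) U" "openin (top_of_set (U \<union> V)) V"
  shows "betti (top_of_set V) (U \<inter> V) = betti (top_of_set (U \<union> V)) U"
proof
  fix p
  let ?X = "top_of_set (U \<union> V)"
  have "closedin ?X (U \<union> V - V)" using assms(2) by (metis closedin_diff closedin_topspace topspace_euclidean_subtopology)
  then have "?X closure_of (U - V) = U - V" by (simp add: closure_of_eq Un_Diff)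
  moreover have "?X interior_of U = U" using assms(1) by (simp add: interior_of_eq)
  ultimately have "?X closure_of (U - V) \<subseteq> ?X interior_of U" by auto
  from homology_excision_axiom[OF this, of "U \<union> V" "int p"]
  have "relative_homology_group (int p) (subtopology ?X (U \<union> V - (U - V))) (U - (U - V))
      \<cong> relative_homology_group (int p) (subtopology ?X (U \<union> V)) U"
    by (auto simp: is_iso_def)
  moreover have "U \<union> V - (U - V) = V" "U - (U - V) = U \<inter> V" by auto
  ultimately have "relative_homology_group (int p) (top_of_set V) (U \<inter> V) \<cong> relative_homology_group (int p) ?X U"
    by (simp add: subtopology_subtopology Int_absorb1)
  then show "betti (top_of_set V) (U \<inter> V) p = betti ?X U p"
    unfolding betti_def by (intro abelian_rank_iso) auto
qed

definition finite_betti :: "'a::topological_space set \<Rightarrow> bool" where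
  "finite_betti S \<longleftrightarrow> finite_type (betti (top_of_set S) {})"

abbreviation euler_char :: "'a::topological_space set \<Rightarrow> int" where
  "euler_char S \<equiv> homological_euler_char (top_of_set S)"

text \<open>The pair of \<open>U \<union> V\<close> and \<open>U\<close> and the pair of
  \<open>V\<close> and \<open>U \<inter> V\<close> have the same relative Betti numbers, so
  comparing their two additivity formulas gives the result without a Mayer-Vietoris sequence.
  Finiteness passes from the parts to the relative term and from there to the union.\<close>

theorem euler_char_Mayer_Vietoris:
  fixes U V :: "'a::topological_space set"
  assumes "openin (top_of_set (U \<union> V)) U" "openin (top_of_set (U \<union> V)) V"
    and "finite_betti U" "finite_betti V" "finite_betti (U \<inter> V)"
  shows "finite_betti (U \<union> V)" "euler_char (U \<union> V) = euler_char U + euler_char V - euler_char (U \<inter> V)"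
proof -
  let ?X = "top_of_set (U \<union> V)"
  have sub: "subtopology (top_of_set V) (U \<inter> V) = top_of_set (U \<inter> V)" "subtopology ?X U = top_of_set U"
    by (simp_all add: subtopology_subtopology Int_absorb1)
  note fin = assms(3-5)[unfolded finite_betti_def]
  have "finite_type (betti (top_of_set V) (U \<inter> V))"
    by (rule finite_type_betti_long_exact(1)) (use fin sub in simp_all)
  then have rel: "finite_type (betti ?X U)" using betti_excision[OF assms(1,2)] by simp
  have tot: "finite_type (betti ?X {})"
    by (rule finite_type_betti_long_exact(2)[of _ U]) (use fin sub rel in simp_all)
  then show "finite_betti (U \<union> V)" by (simp add: finite_betti_def)
  have "alternating_sum (betti ?X {}) = alternating_sum (betti (top_of_set U) {}) + alternating_sum (betti ?X U)"
    using finite_type_betti_long_exact(3)[of ?X U] tot fin sub by simp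
  moreover have "alternating_sum (betti (top_of_set V) {}) =
      alternating_sum (betti (top_of_set (U \<inter> V)) {}) + alternating_sum (betti (top_of_set V) (U \<inter> V))"
    using finite_type_betti_long_exact(3)[of "top_of_set V" "U \<inter> V"] fin sub by simp
  ultimately show "euler_char (U \<union> V) = euler_char U + euler_char V - euler_char (U \<inter> V)"
    using betti_excision[OF assms(1,2)] by (simp add: homological_euler_char_eq)
qed

lemma betti_homotopy_equivalent:
  assumes "X homotopy_equivalent_space Y"
  shows "betti X {} = betti Y {}"
  unfolding betti_def fun_eq_iff
  using homotopy_equivalent_space_imp_isomorphic_homology_groups[OF assms]
  by (auto intro!: abelian_rank_iso)

lemma euler_char_homotopy_eqv:
  assumes "S homotopy_eqv T"
  shows "euler_char S = euler_char T" "finite_betti S \<longleftrightarrow> finite_betti T"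
  using betti_homotopy_equivalent[OF assms] by (simp_all add: homological_euler_char_eq finite_betti_def)

lemma euler_char_empty: "finite_betti ({} :: 'a::topological_space set)" "euler_char ({} :: 'a set) = 0"
proof -
  have "betti (top_of_set ({} :: 'a set)) {} = (\<lambda>_. 0)"
    unfolding betti_def fun_eq_iff
    by (auto intro!: abelian_rank_trivial_group trivial_homology_group_empty)
  then show "finite_betti ({} :: 'a::topological_space set)" "euler_char ({} :: 'a set) = 0"
    unfolding finite_betti_def homological_euler_char_eq finite_type_def alternating_sum_def by simp_all
qed

lemma euler_char_contractible:
  fixes S :: "'a::real_normed_vector set"
  assumes "contractible S" "S \<noteq> {}"
  shows "finite_betti S" "euler_char S = 1"
proof -
  have pt: "betti (top_of_set {0::'a}) {} = (\<lambda>p. enat (if p = 0 then 1 else 0))"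
  proof
    fix p
    show "betti (top_of_set {0::'a}) {} p = enat (if p = 0 then 1 else 0)"
    proof (cases "p = 0")
      case True
      have "abelian_rank (homology_group 0 (top_of_set {0::'a})) = abelian_rank integer_group"
        by (intro abelian_rank_iso homology_coefficients[of _ 0]) (auto simp: abelian_integer_group)
      with True show ?thesis by (simp add: betti_def abelian_rank_integer_group one_enat_def)
    next
      case False
      have "trivial_group (homology_group (int p) (top_of_set {0::'a}))"
        using False by (intro homology_dimension_axiom[of _ 0]) auto
      with False show ?thesis by (simp add: betti_def abelian_rank_trivial_group zero_enat_def)
    qed
  qed
  have "finite_betti {0::'a}"
    unfolding finite_betti_def pt finite_type_def by (auto simp: zero_enat_def)
  moreover have "euler_char {0::'a} = 1"
    unfolding homological_euler_char_eq pt
    by (subst alternating_sum_enat[of 1]) auto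
  moreover have "S homotopy_eqv {0::'a}" using assms by (simp add: homotopy_eqv_sing)
  ultimately show "finite_betti S" "euler_char S = 1"
    using euler_char_homotopy_eqv[of S "{0::'a}"] by simp_all
qed

text \<open>The lattice is abstract because the formula is applied both to open sets with the Euler
  characteristic and to functions with the valuation. By distributivity the meet of
  \<open>h w\<close> with the join of the others is a join of the elements \<open>?h i\<close>, so
  the induction must allow \<open>h\<close> to vary; meets of these are the meets of
  \<open>h\<close> over index sets containing \<open>w\<close>. The predicate \<open>G\<close>
  collects whatever additivity presupposes.\<close>

lemma inclusion_exclusion_lattice:
  fixes h :: "'i \<Rightarrow> 'l::distrib_lattice" and \<phi> :: "'l \<Rightarrow> 'b::comm_ring_1"
  assumes add: "\<And>x y. G x \<Longrightarrow> G y \<Longrightarrow> G (inf x y) \<Longrightarrow> G (sup x y) \<and> \<phi> (sup x y) = \<phi> x + \<phi> y - \<phi> (inf x y)"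
    and "finite I" "I \<noteq> {}" "\<And>T. T \<subseteq> I \<Longrightarrow> T \<noteq> {} \<Longrightarrow> G (Inf_fin (h ` T))"
  shows "G (Sup_fin (h ` I)) \<and>
         \<phi> (Sup_fin (h ` I)) = (\<Sum>T\<in>Pow I - {{}}. (-1) ^ (card T + 1) * \<phi> (Inf_fin (h ` T)))"
  using assms(2-4)
proof (induction I arbitrary: h rule: finite_ne_induct)
  case (singleton w)
  have "Pow {w} - {{}} = {{w}}" by auto
  then show ?case using singleton[of "{w}"] by simp
next
  case (insert w I)
  let ?h = "\<lambda>i. inf (h w) (h i)"
  have fin: "finite T" if "T \<subseteq> I" for T using that insert.hyps finite_subset by blast
  have Inf_insert: "Inf_fin (h ` insert w T) = inf (h w) (Inf_fin (h ` T))" if "T \<subseteq> I" "T \<noteq> {}" for T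
    using that fin by simp
  have Inf_h: "Inf_fin (?h ` T) = Inf_fin (h ` insert w T)" if "T \<subseteq> I" "T \<noteq> {}" for T
    using fin[OF that(1)] that(2) Inf_insert[OF that]
  proof (induction T rule: finite_ne_induct)
    case (insert v T)
    have "Inf_fin (?h ` insert v T) = inf (inf (h w) (h v)) (Inf_fin (?h ` T))"
      using insert by simp
    also have "Inf_fin (?h ` T) = inf (h w) (Inf_fin (h ` T))"
      using insert by simp
    finally show ?case using insert by (simp add: inf.left_commute inf.assoc)
  qed simp
  have Sup_h: "inf (h w) (Sup_fin (h ` I)) = Sup_fin (?h ` I)"
    using insert.hyps by (subst inf_Sup1_distrib) (auto simp: image_image Setcompr_eq_image)
  have 1: "G (Sup_fin (h ` I)) \<and> \<phi> (Sup_fin (h ` I)) =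
      (\<Sum>T\<in>Pow I - {{}}. (-1) ^ (card T + 1) * \<phi> (Inf_fin (h ` T)))"
    using insert.prems by (intro insert.IH) auto
  have 2: "G (Sup_fin (?h ` I)) \<and> \<phi> (Sup_fin (?h ` I)) =
      (\<Sum>T\<in>Pow I - {{}}. (-1) ^ (card T + 1) * \<phi> (Inf_fin (?h ` T)))"
    by (intro insert.IH) (metis Inf_h insert.prems insert_mono insert_not_empty)
  have Gw: "G (h w)" using insert.prems[of "{w}"] by simp
  have step: "G (sup (h w) (Sup_fin (h ` I))) \<and> \<phi> (sup (h w) (Sup_fin (h ` I))) =
      \<phi> (h w) + \<phi> (Sup_fin (h ` I)) - \<phi> (Sup_fin (?h ` I))"
    using add[of "h w" "Sup_fin (h ` I)"] Gw 1 2 unfolding Sup_h by blast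
  have Sup_ins: "Sup_fin (h ` insert w I) = sup (h w) (Sup_fin (h ` I))"
    using insert.hyps by simp
  have Pow_eq: "Pow (insert w I) - {{}} = insert {w} (Pow I - {{}} \<union> insert w ` (Pow I - {{}}))"
    unfolding Pow_insert by auto
  have inj: "inj_on (insert w) (Pow I - {{}})"
    using insert.hyps(3) by (auto simp: inj_on_def)
  let ?f = "\<lambda>T. (-1) ^ (card T + 1) * \<phi> (Inf_fin (h ` T))"
  have "sum ?f (Pow (insert w I) - {{}}) = ?f {w} + sum ?f (Pow I - {{}} \<union> insert w ` (Pow I - {{}}))"
    unfolding Pow_eq using insert.hyps by (subst sum.insert) auto
  also have "sum ?f (Pow I - {{}} \<union> insert w ` (Pow I - {{}})) =
      sum ?f (Pow I - {{}}) + sum ?f (insert w ` (Pow I - {{}}))"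
    using insert.hyps by (intro sum.union_disjoint) auto
  also have "sum ?f (insert w ` (Pow I - {{}})) = (\<Sum>T\<in>Pow I - {{}}. ?f (insert w T))"
    by (simp add: sum.reindex[OF inj])
  also have "\<dots> = (\<Sum>T\<in>Pow I - {{}}. - ((-1) ^ (card T + 1) * \<phi> (Inf_fin (?h ` T))))"
  proof (rule sum.cong)
    fix T assume T: "T \<in> Pow I - {{}}"
    then have "card (insert w T) = Suc (card T)" using insert.hyps fin by (auto simp: card_insert_if)
    then show "?f (insert w T) = - ((-1) ^ (card T + 1) * \<phi> (Inf_fin (?h ` T)))"
      using Inf_h[of T] T by simp
  qed simp
  also have "\<dots> = - \<phi> (Sup_fin (?h ` I))" using 2 by (simp add: sum_negf)
  finally show ?case unfolding Sup_ins using step 1 by simp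
qed

section \<open>Simplicial complexes through vertex sets and barycentric coordinates\<close>

text \<open>Vanishing off the simplex makes weights on different simplices comparable as functions
  on the whole space.\<close>

definition weights :: "'a set \<Rightarrow> ('a \<Rightarrow> real) \<Rightarrow> bool" where
  "weights \<sigma> u \<longleftrightarrow> (\<forall>v\<in>\<sigma>. 0 \<le> u v) \<and> (\<forall>v. v \<notin> \<sigma> \<longrightarrow> u v = 0) \<and> sum u \<sigma> = 1"

lemma weightsD:
  assumes "weights \<sigma> u"
  shows "0 \<le> u v" "v \<notin> \<sigma> \<Longrightarrow> u v = 0" "sum u \<sigma> = 1"
  using assms by (cases "v \<in> \<sigma>"; force simp: weights_def)+

lemma weights_sum_superset:
  fixes f :: "'a \<Rightarrow> 'b::real_vector"
  assumes "weights \<sigma> u" "\<sigma> \<subseteq> V" "finite V"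
  shows "sum u V = 1" "(\<Sum>v\<in>V. u v *\<^sub>R f v) = (\<Sum>v\<in>\<sigma>. u v *\<^sub>R f v)"
proof -
  have "sum u V = sum u \<sigma>"
    using assms by (intro sum.mono_neutral_right) (auto simp: weights_def)
  then show "sum u V = 1" using assms by (simp add: weights_def)
  show "(\<Sum>v\<in>V. u v *\<^sub>R f v) = (\<Sum>v\<in>\<sigma>. u v *\<^sub>R f v)"
    using assms by (intro sum.mono_neutral_right) (auto simp: weights_def)
qed

lemma weights_support:
  assumes "weights \<sigma> u" "finite \<sigma>"
  shows "weights {v. u v \<noteq> 0} u" "{v. u v \<noteq> 0} \<subseteq> \<sigma>" "{v. u v \<noteq> 0} \<noteq> {}"
proof -
  show sub: "{v. u v \<noteq> 0} \<subseteq> \<sigma>" using assms(1) by (auto simp: weights_def)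
  have "sum u {v. u v \<noteq> 0} = sum u \<sigma>"
    using sub assms by (intro sum.mono_neutral_left) auto
  then have "sum u {v. u v \<noteq> 0} = 1" using assms(1) by (simp add: weights_def)
  then show "weights {v. u v \<noteq> 0} u" "{v. u v \<noteq> 0} \<noteq> {}"
    using weightsD(1)[OF assms(1)] by (simp add: weights_def, metis sum.empty zero_neq_one)
qed

lemma weights_mono: "weights \<sigma> u \<Longrightarrow> \<sigma> \<subseteq> \<tau> \<Longrightarrow> finite \<tau> \<Longrightarrow> weights \<tau> u"
  unfolding weights_def[of \<tau>] using weights_sum_superset(1)[of \<sigma> u \<tau>] weightsD(1,2)[of \<sigma> u] by blast

lemma convex_hull_weights:
  assumes "finite \<sigma>"
  shows "convex hull \<sigma> = {(\<Sum>v\<in>\<sigma>. u v *\<^sub>R v) | u. weights \<sigma> u}"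
proof (intro equalityI subsetI)
  fix x assume "x \<in> convex hull \<sigma>"
  then obtain u where u: "\<forall>v\<in>\<sigma>. 0 \<le> u v" "sum u \<sigma> = 1" "(\<Sum>v\<in>\<sigma>. u v *\<^sub>R v) = x"
    using assms by (auto simp: convex_hull_finite)
  define w where "w v = (if v \<in> \<sigma> then u v else 0)" for v
  have "weights \<sigma> w" "(\<Sum>v\<in>\<sigma>. w v *\<^sub>R v) = x" using u by (auto simp: w_def weights_def)
  then show "x \<in> {(\<Sum>v\<in>\<sigma>. u v *\<^sub>R v) | u. weights \<sigma> u}" by auto
qed (use assms in \<open>auto simp: convex_hull_finite weights_def\<close>)

lemma affine_linear_sum:
  assumes "affine_linear g" "finite \<sigma>" "sum u \<sigma> = 1"
  shows "g (\<Sum>v\<in>\<sigma>. u v *\<^sub>R v) = (\<Sum>v\<in>\<sigma>. u v * g v)"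
proof -
  obtain l c where l: "linear l" "g = (\<lambda>x. l x + c)" using assms by (auto simp: affine_linear_def)
  have "(\<Sum>v\<in>\<sigma>. u v * g v) = (\<Sum>v\<in>\<sigma>. u v *\<^sub>R l v) + sum u \<sigma> * c"
    by (simp add: l(2) algebra_simps sum.distrib sum_distrib_left)
  also have "(\<Sum>v\<in>\<sigma>. u v *\<^sub>R l v) = l (\<Sum>v\<in>\<sigma>. u v *\<^sub>R v)"
    using l(1) by (simp add: linear_sum linear_scale)
  finally show ?thesis using assms l by simp
qed

lemma affine_linear_zero: "affine_linear (\<lambda>_. 0)"
  unfolding affine_linear_def by (rule exI[of _ "\<lambda>_. 0"], rule exI[of _ 0]) (simp add: linear_zero)

text \<open>Translating one vertex to the origin turns affine into linear independence, where
  prescribed values extend linearly.\<close>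

lemma affine_linear_interpolation:
  assumes "\<not> affine_dependent (\<sigma> :: 'a::euclidean_space set)"
  obtains g where "affine_linear g" "\<forall>v\<in>\<sigma>. g v = c v"
proof (cases "\<sigma> = {}")
  case True
  with affine_linear_zero show thesis using that by blast
next
  case False
  then obtain a where a: "a \<in> \<sigma>" by auto
  have ind: "independent ((\<lambda>x. -a + x) ` (\<sigma> - {a}))"
    using assms a by (simp add: affine_dependent_iff_dependent2)
  obtain l where l: "linear l" "\<forall>y\<in>(\<lambda>x. -a + x) ` (\<sigma> - {a}). l y = c (a + y) - c a"
    using linear_independent_extend[OF ind, of "\<lambda>y. c (a + y) - c a"] by blast
  show thesis
  proof (rule that)
    show "affine_linear (\<lambda>x. l x + (c a - l a))" using l(1) by (auto simp: affine_linear_def)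
    show "\<forall>v\<in>\<sigma>. l v + (c a - l a) = c v"
    proof
      fix v assume v: "v \<in> \<sigma>"
      show "l v + (c a - l a) = c v"
      proof (cases "v = a")
        case False
        then have "l (- a + v) = c (a + (- a + v)) - c a" using l(2) v by blast
        moreover have "l (- a + v) = l v - l a" using l(1) by (simp add: linear_diff)
        ultimately show ?thesis by simp
      qed simp
    qed
  qed
qed

lemma affine_linear_continuous_on: "affine_linear g \<Longrightarrow> continuous_on S g"
  unfolding affine_linear_def using linear_continuous_on linear_conv_bounded_linear
  by (auto intro!: continuous_intros)

text \<open>
  \<open>F\<close> consists of the vertex sets of the simplices of a geometric simplicial complex.  That any two
  simplices are proper and meet in a common face is expressed by the uniqueness of barycentric
  coordinates across all simplices.
\<close>

locale vertex_scheme =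
  fixes F :: "'a::euclidean_space set set"
  assumes finite_F: "finite F"
    and finite_simplex: "\<sigma> \<in> F \<Longrightarrow> finite \<sigma>"
    and down_closed: "\<sigma> \<in> F \<Longrightarrow> \<tau> \<subseteq> \<sigma> \<Longrightarrow> \<tau> \<in> F"
    and weights_inject: "\<sigma> \<in> F \<Longrightarrow> \<tau> \<in> F \<Longrightarrow> weights \<sigma> u \<Longrightarrow> weights \<tau> w \<Longrightarrow>
      (\<Sum>v\<in>\<sigma>. u v *\<^sub>R v) = (\<Sum>v\<in>\<tau>. w v *\<^sub>R v) \<Longrightarrow> u = w"
begin

definition vertices :: "'a set" where "vertices = \<Union>F"

definition realization :: "'a set" where "realization = (\<Union>\<sigma>\<in>F. convex hull \<sigma>)"

definition simplices :: "'a set set" where "simplices = (\<lambda>\<sigma>. convex hull \<sigma>) ` F"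

text \<open>The value 0 off the polyhedron agrees with the convention of \<open>nabla\<close>, so
  coordinate functions are themselves members of it.\<close>

definition coord :: "'a \<Rightarrow> 'a \<Rightarrow> real" where
  "coord x = (if x \<in> realization then THE u. \<exists>\<sigma>\<in>F. weights \<sigma> u \<and> x = (\<Sum>v\<in>\<sigma>. u v *\<^sub>R v) else (\<lambda>_. 0))"

lemma finite_vertices: "finite vertices"
  using finite_F finite_simplex by (auto simp: vertices_def)

lemma simplex_subset_vertices: "\<sigma> \<in> F \<Longrightarrow> \<sigma> \<subseteq> vertices"
  by (auto simp: vertices_def)

lemma vertex_iff: "v \<in> vertices \<longleftrightarrow> {v} \<in> F"
proof
  assume "v \<in> vertices"
  then obtain \<sigma> where "\<sigma> \<in> F" "v \<in> \<sigma>" by (auto simp: vertices_def)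
  then show "{v} \<in> F" using down_closed[of \<sigma> "{v}"] by simp
qed (auto simp: vertices_def)

lemma Union_simplices: "\<Union>simplices = realization"
  by (auto simp: simplices_def realization_def)

lemma weights_in_realization:
  assumes "\<sigma> \<in> F" "weights \<sigma> u"
  shows "(\<Sum>v\<in>\<sigma>. u v *\<^sub>R v) \<in> convex hull \<sigma>" "(\<Sum>v\<in>\<sigma>. u v *\<^sub>R v) \<in> realization"
  using assms finite_simplex by (auto simp: realization_def convex_hull_weights)

lemma coord_eqI:
  assumes "\<sigma> \<in> F" "weights \<sigma> u" "x = (\<Sum>v\<in>\<sigma>. u v *\<^sub>R v)"
  shows "coord x = u"
proof -
  have "(THE u. \<exists>\<sigma>\<in>F. weights \<sigma> u \<and> x = (\<Sum>v\<in>\<sigma>. u v *\<^sub>R v)) = u"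
  proof (rule the_equality)
    show "w = u" if "\<exists>\<tau>\<in>F. weights \<tau> w \<and> x = (\<Sum>v\<in>\<tau>. w v *\<^sub>R v)" for w
      using that weights_inject[OF assms(1) _ assms(2)] assms(3) by auto
  qed (use assms in blast)
  then show ?thesis using weights_in_realization(2)[OF assms(1,2)] assms(3) by (simp add: coord_def)
qed

lemma coord_simplex:
  assumes "\<sigma> \<in> F" "x \<in> convex hull \<sigma>"
  shows "weights \<sigma> (coord x)" "(\<Sum>v\<in>\<sigma>. coord x v *\<^sub>R v) = x"
proof -
  obtain u where u: "weights \<sigma> u" "x = (\<Sum>v\<in>\<sigma>. u v *\<^sub>R v)"
    using assms finite_simplex by (auto simp: convex_hull_weights)
  then have "coord x = u" by (rule coord_eqI[OF assms(1)])
  with u show "weights \<sigma> (coord x)" "(\<Sum>v\<in>\<sigma>. coord x v *\<^sub>R v) = x" by auto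
qed

lemma coord_nonneg: "0 \<le> coord x v"
proof (cases "x \<in> realization")
  case True
  then obtain \<sigma> where "\<sigma> \<in> F" "x \<in> convex hull \<sigma>" by (auto simp: realization_def)
  then show ?thesis using weightsD(1)[OF coord_simplex(1)] by simp
qed (simp add: coord_def)

lemma coord_outside: "x \<notin> realization \<Longrightarrow> coord x v = 0"
  by (simp add: coord_def)

lemma coord_support:
  assumes "x \<in> realization"
  shows "{v. coord x v \<noteq> 0} \<in> F" "{v. coord x v \<noteq> 0} \<noteq> {}" "weights {v. coord x v \<noteq> 0} (coord x)"
    "x = (\<Sum>v\<in>{v. coord x v \<noteq> 0}. coord x v *\<^sub>R v)"
proof -
  obtain \<sigma> where \<sigma>: "\<sigma> \<in> F" "x \<in> convex hull \<sigma>" using assms by (auto simp: realization_def)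
  note s = weights_support[OF coord_simplex(1)[OF \<sigma>] finite_simplex[OF \<sigma>(1)]]
  show "{v. coord x v \<noteq> 0} \<in> F" using down_closed[OF \<sigma>(1) s(2)] .
  show "{v. coord x v \<noteq> 0} \<noteq> {}" "weights {v. coord x v \<noteq> 0} (coord x)" using s by auto
  show "x = (\<Sum>v\<in>{v. coord x v \<noteq> 0}. coord x v *\<^sub>R v)"
    using weights_sum_superset(2)[OF s(1) s(2) finite_simplex[OF \<sigma>(1)], of "\<lambda>v. v"] coord_simplex(2)[OF \<sigma>]
    by simp
qed

lemma coord_not_vertex: "v \<notin> vertices \<Longrightarrow> coord x v = 0"
  using coord_support(1)[of x] coord_outside[of x v] by (cases "x \<in> realization") (force simp: vertices_def)+

lemma sum_coord:
  assumes "x \<in> realization"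
  shows "sum (coord x) vertices = 1" "(\<Sum>v\<in>vertices. coord x v *\<^sub>R v) = x"
proof -
  note * = weights_sum_superset[OF coord_support(3)[OF assms]
    simplex_subset_vertices[OF coord_support(1)[OF assms]] finite_vertices]
  show "sum (coord x) vertices = 1" by (rule *(1))
  show "(\<Sum>v\<in>vertices. coord x v *\<^sub>R v) = x"
    using *(2)[of "\<lambda>v. v"] coord_support(4)[OF assms] by metis
qed

lemma in_convex_hull_iff:
  assumes "\<sigma> \<in> F" "x \<in> realization"
  shows "x \<in> convex hull \<sigma> \<longleftrightarrow> {v. coord x v \<noteq> 0} \<subseteq> \<sigma>"
proof
  assume "x \<in> convex hull \<sigma>"
  then show "{v. coord x v \<noteq> 0} \<subseteq> \<sigma>"
    using coord_simplex(1)[OF assms(1)] by (auto simp: weights_def)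
next
  assume s: "{v. coord x v \<noteq> 0} \<subseteq> \<sigma>"
  have "x \<in> convex hull {v. coord x v \<noteq> 0}"
    using weights_in_realization(1)[OF coord_support(1,3)[OF assms(2)]] coord_support(4)[OF assms(2)]
    by simp
  then show "x \<in> convex hull \<sigma>" using hull_mono[OF s] by blast
qed

lemma vertex_in_realization: "v \<in> vertices \<Longrightarrow> v \<in> realization"
  unfolding vertex_iff realization_def by (rule UN_I[of "{v}"]) auto

lemma coord_vertex:
  assumes "v \<in> vertices"
  shows "coord v = (\<lambda>w. if w = v then 1 else 0)"
  by (rule coord_eqI[of "{v}"]) (use assms in \<open>auto simp: vertex_iff weights_def\<close>)

text \<open>An affine dependence, scaled down and added to the uniform weights, gives other weights
  for the same point.\<close>

lemma not_affine_dependent: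
  assumes "\<sigma> \<in> F"
  shows "\<not> affine_dependent \<sigma>"
proof
  assume "affine_dependent \<sigma>"
  then obtain U v where U: "sum U \<sigma> = 0" "v \<in> \<sigma>" "U v \<noteq> 0" "(\<Sum>v\<in>\<sigma>. U v *\<^sub>R v) = 0"
    using affine_dependent_explicit_finite finite_simplex[OF assms] by blast
  define n where "n = real (card \<sigma>)"
  \<comment> \<open>Since \<open>M\<close> bounds each absolute value of \<open>U\<close>, a
    perturbation by \<open>U v / (n * M)\<close> never exceeds the uniform weight
    \<open>1 / n\<close>.\<close>
  define M where "M = (\<Sum>v\<in>\<sigma>. \<bar>U v\<bar>)"
  have fin: "finite \<sigma>" using finite_simplex assms by blast
  have n: "n > 0" using U(2) fin by (auto simp: n_def card_gt_0_iff)
  have UM: "\<bar>U w\<bar> \<le> M" if "w \<in> \<sigma>" for w unfolding M_def using that fin by (intro member_le_sum) auto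
  have M: "M > 0" using UM[OF U(2)] U(3) by linarith
  define u where "u w = (if w \<in> \<sigma> then 1 / n else 0)" for w
  define w where "w v = (if v \<in> \<sigma> then 1 / n + U v / (n * M) else 0)" for v
  have pos: "0 \<le> 1 / n + U w / (n * M)" if "w \<in> \<sigma>" for w
  proof -
    have "- M \<le> U w" using UM[OF that] by linarith
    then have "0 \<le> (M + U w) / (n * M)" using n M by simp
    also have "\<dots> = 1 / n + U w / (n * M)" using n M by (simp add: field_simps)
    finally show ?thesis .
  qed
  have one: "(\<Sum>v\<in>\<sigma>. 1 / n) = 1" using n by (simp add: n_def)
  have "weights \<sigma> u" using n one by (auto simp: weights_def u_def)
  moreover have "weights \<sigma> w"
    using pos one U(1) by (auto simp: weights_def w_def sum.distrib sum_divide_distrib[symmetric])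
  moreover have "(\<Sum>v\<in>\<sigma>. u v *\<^sub>R v) = (\<Sum>v\<in>\<sigma>. w v *\<^sub>R v)"
  proof -
    have "(\<Sum>v\<in>\<sigma>. w v *\<^sub>R v) = (\<Sum>v\<in>\<sigma>. u v *\<^sub>R v) + (\<Sum>v\<in>\<sigma>. (1 / (n * M)) *\<^sub>R (U v *\<^sub>R v))"
      unfolding sum.distrib[symmetric] by (intro sum.cong) (auto simp: w_def u_def algebra_simps)
    also have "(\<Sum>v\<in>\<sigma>. (1 / (n * M)) *\<^sub>R (U v *\<^sub>R v)) = 0"
      unfolding scaleR_sum_right[symmetric] U(4) by simp
    finally show ?thesis by simp
  qed
  ultimately have "u = w" using weights_inject[OF assms assms] by simp
  then have "u v = w v" by simp
  then show False using U n M by (simp add: u_def w_def)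
qed

lemma convex_hull_Int:
  assumes "\<sigma> \<in> F" "\<tau> \<in> F"
  shows "convex hull \<sigma> \<inter> convex hull \<tau> = convex hull (\<sigma> \<inter> \<tau>)"
proof (intro equalityI subsetI)
  fix x assume x: "x \<in> convex hull \<sigma> \<inter> convex hull \<tau>"
  then have "x \<in> realization" using assms by (auto simp: realization_def)
  then show "x \<in> convex hull (\<sigma> \<inter> \<tau>)"
    using x assms in_convex_hull_iff down_closed[of \<sigma> "\<sigma> \<inter> \<tau>"] by auto
qed (use hull_mono[of "\<sigma> \<inter> \<tau>" \<sigma>] hull_mono[of "\<sigma> \<inter> \<tau>" \<tau>] in auto)

lemma simplex_convex_hull_iff:
  assumes "\<sigma> \<in> F"
  shows "n simplex (convex hull \<sigma>) \<longleftrightarrow> n = int (card \<sigma>) - 1"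
proof -
  have "(int (card \<sigma>) - 1) simplex (convex hull \<sigma>)"
    using not_affine_dependent[OF assms] by (intro simplex_convex_hull) auto
  then show ?thesis using aff_dim_simplex by metis
qed

lemma simplicial_complex_simplices: "simplicial_complex simplices"
  unfolding simplicial_complex_def
proof (intro conjI allI impI ballI)
  show "finite simplices" using finite_F by (simp add: simplices_def)
  show "\<exists>n. n simplex S" if "S \<in> simplices" for S
    using that simplex_convex_hull_iff by (auto simp: simplices_def)
  show "T \<in> simplices" if "S \<in> simplices \<and> T face_of S" for T S
    using that not_affine_dependent down_closed
    by (auto simp: simplices_def face_of_convex_hull_affine_independent)
  show "(S \<inter> T) face_of S" if ST: "S \<in> simplices \<and> T \<in> simplices" for S T
  proof -
    obtain \<sigma> \<tau> where "\<sigma> \<in> F" "S = convex hull \<sigma>" "\<tau> \<in> F" "T = convex hull \<tau>"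
      using ST unfolding simplices_def by blast
    then show ?thesis
      using face_of_convex_hull_affine_independent[OF not_affine_dependent] convex_hull_Int
      by (metis inf_le1)
  qed
qed

lemma triangulates_realization: "triangulates simplices realization"
  by (simp add: triangulates_def simplicial_complex_simplices Union_simplices)

lemma simplex_vertices_convex_hull: "\<sigma> \<in> F \<Longrightarrow> simplex_vertices (convex hull \<sigma>) = \<sigma>"
  using not_affine_dependent by (auto simp: simplex_vertices_def extreme_point_of_convex_hull_affine_independent)

lemma inj_on_convex_hull: "inj_on (\<lambda>\<sigma>. convex hull \<sigma>) F"
  by (rule inj_on_inverseI[of _ simplex_vertices]) (rule simplex_vertices_convex_hull)

lemma complex_vertices_simplices: "complex_vertices simplices = vertices"
proof -
  have "\<sigma> = {v}" if "\<sigma> \<in> F" "convex hull \<sigma> = {v}" for \<sigma> v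
    using simplex_vertices_convex_hull[OF that(1)] that(2) by (auto simp: simplex_vertices_def)
  then show ?thesis
    by (force simp: complex_vertices_def simplices_def vertex_iff)
qed

text \<open>Affine independence gives an \<open>m\<close>-simplex \<open>m + 1\<close> vertices and
  bounds \<open>m\<close> by the dimension of the space, so grouping by dimension loses no
  simplex.\<close>

lemma complex_euler_char_simplices:
  "complex_euler_char simplices = (\<Sum>\<sigma>\<in>F - {{}}. (-1) ^ (card \<sigma> + 1))"
proof -
  have "{S \<in> simplices. int m simplex S} = (\<lambda>\<sigma>. convex hull \<sigma>) ` {\<sigma> \<in> F. card \<sigma> = m + 1}" for m
    by (auto simp: simplices_def simplex_convex_hull_iff)
  then have "card {S \<in> simplices. int m simplex S} = card {\<sigma> \<in> F. card \<sigma> = m + 1}" for m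
    using inj_on_subset[OF inj_on_convex_hull] by (simp add: card_image)
  then have "complex_euler_char simplices = (\<Sum>m\<le>DIM('a). (-1) ^ m * int (card {\<sigma> \<in> F. card \<sigma> = m + 1}))"
    by (simp add: complex_euler_char_def)
  \<comment> \<open>Truncated subtraction would place the empty simplex in dimension 0, hence its
    removal; the sign uses \<open>card \<sigma> + 1\<close>, which has the parity of the
    dimension.\<close>
  also have "\<dots> = (\<Sum>m\<le>DIM('a). \<Sum>\<sigma>\<in>{\<sigma> \<in> F - {{}}. card \<sigma> - 1 = m}. (-1) ^ (card \<sigma> + 1))"
  proof (rule sum.cong)
    fix m
    have "card \<sigma> > 0" if "\<sigma> \<in> F" "\<sigma> \<noteq> {}" for \<sigma>
      using that finite_simplex by (simp add: card_gt_0_iff)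
    then have "{\<sigma> \<in> F - {{}}. card \<sigma> - 1 = m} = {\<sigma> \<in> F. card \<sigma> = m + 1}"
      by fastforce
    moreover have "(\<Sum>\<sigma>\<in>{\<sigma> \<in> F. card \<sigma> = m + 1}. (-1) ^ (card \<sigma> + 1)) =
        (\<Sum>\<sigma>\<in>{\<sigma> \<in> F. card \<sigma> = m + 1}. (-1 :: int) ^ m)"
      by (intro sum.cong) auto
    ultimately show "(-1) ^ m * int (card {\<sigma> \<in> F. card \<sigma> = m + 1}) =
        (\<Sum>\<sigma>\<in>{\<sigma> \<in> F - {{}}. card \<sigma> - 1 = m}. (-1) ^ (card \<sigma> + 1))"
      by simp
  qed simp
  also have "\<dots> = (\<Sum>\<sigma>\<in>F - {{}}. (-1) ^ (card \<sigma> + 1))"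
  proof (rule sum.group)
    show "(\<lambda>\<sigma>. card \<sigma> - 1) ` (F - {{}}) \<subseteq> {..DIM('a)}"
    proof (rule image_subsetI)
      fix \<sigma> assume "\<sigma> \<in> F - {{}}"
      then have "aff_dim \<sigma> = int (card \<sigma>) - 1"
        using aff_dim_affine_independent[OF not_affine_dependent, of \<sigma>] by simp
      then show "card \<sigma> - 1 \<in> {..DIM('a)}" using aff_dim_le_DIM[of \<sigma>] by auto
    qed
  qed (use finite_F in auto)
  finally show ?thesis .
qed

text \<open>The piecewise linear extension of the vertex values \<open>c\<close>, extended by zero
  off the polyhedron.\<close>

definition pl :: "('a \<Rightarrow> real) \<Rightarrow> 'a \<Rightarrow> real" where
  "pl c x = (\<Sum>v\<in>vertices. coord x v * c v)"

lemma pl_affine: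
  assumes "\<sigma> \<in> F"
  obtains g where "affine_linear g" "\<forall>x\<in>convex hull \<sigma>. pl c x = g x"
proof -
  obtain g where g: "affine_linear g" "\<forall>v\<in>\<sigma>. g v = c v"
    using affine_linear_interpolation[OF not_affine_dependent[OF assms]] by blast
  have "pl c x = g x" if x: "x \<in> convex hull \<sigma>" for x
  proof -
    note w = coord_simplex[OF assms x]
    have "g (\<Sum>v\<in>\<sigma>. coord x v *\<^sub>R v) = (\<Sum>v\<in>\<sigma>. coord x v * g v)"
      using affine_linear_sum[OF g(1) finite_simplex[OF assms]] w(1) by (simp add: weights_def)
    also have "\<dots> = (\<Sum>v\<in>\<sigma>. coord x v *\<^sub>R c v)" using g(2) by simp
    also have "\<dots> = pl c x"
      using weights_sum_superset(2)[OF w(1) simplex_subset_vertices[OF assms] finite_vertices, of c]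
      by (simp add: pl_def)
    finally show ?thesis using w(2) by simp
  qed
  with g(1) that show thesis by blast
qed

lemma linearizes_pl: "linearizes simplices (pl c)"
  unfolding linearizes_def simplices_def using pl_affine by blast

lemma linearizes_imp_pl:
  assumes "linearizes simplices f" "x \<in> realization"
  shows "f x = pl f x"
proof -
  obtain \<sigma> where \<sigma>: "\<sigma> \<in> F" "x \<in> convex hull \<sigma>" using assms by (auto simp: realization_def)
  then obtain g where g: "affine_linear g" "\<And>x. x \<in> convex hull \<sigma> \<Longrightarrow> f x = g x"
    using assms(1) unfolding linearizes_def simplices_def by blast
  note w = coord_simplex[OF \<sigma>]
  have "f x = g (\<Sum>v\<in>\<sigma>. coord x v *\<^sub>R v)" using g(2)[OF \<sigma>(2)] w(2) by simp
  also have "\<dots> = (\<Sum>v\<in>\<sigma>. coord x v * g v)"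
    using affine_linear_sum[OF g(1) finite_simplex[OF \<sigma>(1)]] w(1) by (simp add: weights_def)
  also have "\<dots> = (\<Sum>v\<in>\<sigma>. coord x v *\<^sub>R f v)"
    using g(2) by (simp add: hull_inc)
  also have "\<dots> = pl f x"
    using weights_sum_superset(2)[OF w(1) simplex_subset_vertices[OF \<sigma>(1)] finite_vertices, of f]
    by (simp add: pl_def)
  finally show ?thesis .
qed

lemma pl_in_nabla: "pl c \<in> nabla realization"
proof -
  have "\<forall>\<sigma>\<in>F. \<exists>g. affine_linear g \<and> (\<forall>x\<in>convex hull \<sigma>. pl c x = g x)"
    using pl_affine by blast
  then obtain g where g: "\<And>\<sigma>. \<sigma> \<in> F \<Longrightarrow> affine_linear (g \<sigma>)"
    "\<And>\<sigma> x. \<sigma> \<in> F \<Longrightarrow> x \<in> convex hull \<sigma> \<Longrightarrow> pl c x = g \<sigma> x"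
    by (auto dest!: bchoice)
  have "continuous_on (\<Union>\<sigma>\<in>F. convex hull \<sigma>) (pl c)"
  proof (rule continuous_on_closed_Union)
    show "closed (convex hull \<sigma>)" if "\<sigma> \<in> F" for \<sigma>
      using finite_simplex[OF that] by (simp add: compact_imp_closed finite_imp_compact_convex_hull)
    show "continuous_on (convex hull \<sigma>) (pl c)" if "\<sigma> \<in> F" for \<sigma>
      using affine_linear_continuous_on[OF g(1)[OF that]] g(2)[OF that]
      by (simp cong: continuous_on_cong)
  qed (rule finite_F)
  moreover have "\<forall>x. x \<notin> realization \<longrightarrow> pl c x = 0" by (simp add: pl_def coord_outside)
  moreover have "\<forall>x\<in>realization. \<exists>g\<in>g ` F. pl c x = g x" using g(2) by (auto simp: realization_def)
  ultimately show ?thesis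
    unfolding nabla_def realization_def[symmetric] using g(1) finite_F by (auto intro!: exI[of _ "g ` F"])
qed

section \<open>Coordinate functions as Schauder hats\<close>

lemma coord_eq_pl:
  assumes "v \<in> vertices"
  shows "(\<lambda>x. coord x v) = pl (\<lambda>w. if w = v then 1 else 0)"
  using assms finite_vertices by (simp add: pl_def fun_eq_iff if_distrib[of "\<lambda>t. _ * t"] sum.delta cong: if_cong)

lemma continuous_on_coord: "continuous_on realization (\<lambda>x. coord x v)"
proof (cases "v \<in> vertices")
  case True
  then show ?thesis unfolding coord_eq_pl[OF True] using pl_in_nabla by (simp add: nabla_def)
qed (simp add: coord_not_vertex)

lemma schauder_hat_coord:
  assumes "v \<in> vertices"
  shows "schauder_hat realization (\<lambda>x. coord x v)"
  unfolding schauder_hat_def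
proof (intro conjI exI ballI impI)
  show "(\<lambda>x. coord x v) \<in> nabla realization" "linearizes simplices (\<lambda>x. coord x v)"
    unfolding coord_eq_pl[OF assms] by (rule pl_in_nabla, rule linearizes_pl)
  show "triangulates simplices realization" by (rule triangulates_realization)
  show "v \<in> complex_vertices simplices" using assms by (simp add: complex_vertices_simplices)
  show "coord v v = 1" using assms by (simp add: coord_vertex)
  show "coord w v = 0" if "w \<in> complex_vertices simplices" "w \<noteq> v" for w
    using that by (simp add: complex_vertices_simplices coord_vertex)
qed

text \<open>The center is the barycenter \<open>b\<close> of \<open>T\<close>. The carrier of a
  point of the open star contains \<open>T\<close>, hence supports \<open>b\<close> as well; along
  the segment the coordinates interpolate linearly within that one simplex, and those at
  \<open>T\<close> stay positive.\<close>

lemma open_star_starlike: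
  assumes "T \<in> F" "T \<noteq> {}"
  shows "starlike {x. \<forall>t\<in>T. 0 < coord x t}" "{x. \<forall>t\<in>T. 0 < coord x t} \<noteq> {}"
proof -
  define n where "n = real (card T)"
  have n: "n > 0" using assms finite_simplex by (auto simp: n_def card_gt_0_iff)
  define b where "b = (\<Sum>v\<in>T. (1 / n) *\<^sub>R v)"
  have wb: "weights T (\<lambda>v. if v \<in> T then 1 / n else 0)" using n by (auto simp: weights_def n_def)
  have b: "coord b = (\<lambda>v. if v \<in> T then 1 / n else 0)"
    by (rule coord_eqI[OF assms(1) wb]) (simp add: b_def)
  have bS: "b \<in> {x. \<forall>t\<in>T. 0 < coord x t}" using n by (auto simp: b)
  then show "{x. \<forall>t\<in>T. 0 < coord x t} \<noteq> {}" by blast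
  have "closed_segment b x \<subseteq> {x. \<forall>t\<in>T. 0 < coord x t}" if x: "\<forall>t\<in>T. 0 < coord x t" for x
  proof
    fix y assume "y \<in> closed_segment b x"
    then obtain a where a: "0 \<le> a" "a \<le> 1" and y: "y = (1 - a) *\<^sub>R b + a *\<^sub>R x"
      by (auto simp: in_segment)
    obtain t0 where "t0 \<in> T" using assms by auto
    then have xr: "x \<in> realization" using x coord_outside by fastforce
    let ?\<sigma> = "{v. coord x v \<noteq> 0}"
    have \<sigma>: "?\<sigma> \<in> F" "weights ?\<sigma> (coord x)" "x = (\<Sum>v\<in>?\<sigma>. coord x v *\<^sub>R v)"
      using coord_support[OF xr] by auto
    have T\<sigma>: "T \<subseteq> ?\<sigma>" using x by force
    have fin: "finite ?\<sigma>" using \<sigma>(1) finite_simplex by blast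
    have wb': "weights ?\<sigma> (coord b)" using weights_mono[OF wb T\<sigma> fin] by (simp add: b)
    have b': "b = (\<Sum>v\<in>?\<sigma>. coord b v *\<^sub>R v)"
      using weights_sum_superset(2)[OF wb T\<sigma> fin, of "\<lambda>v. v"] unfolding b by (simp add: b_def)
    let ?u = "\<lambda>v. (1 - a) * coord b v + a * coord x v"
    have "coord y = ?u"
    proof (rule coord_eqI[OF \<sigma>(1)])
      have "sum ?u ?\<sigma> = (1 - a) * sum (coord b) ?\<sigma> + a * sum (coord x) ?\<sigma>"
        by (simp add: sum.distrib sum_distrib_left)
      then have "sum ?u ?\<sigma> = 1" using weightsD(3)[OF wb'] weightsD(3)[OF \<sigma>(2)] by simp
      then show "weights ?\<sigma> ?u"
        using a wb' \<sigma>(2) by (auto simp: weights_def)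
      show "y = (\<Sum>v\<in>?\<sigma>. ?u v *\<^sub>R v)"
        unfolding scaleR_add_left sum.distrib scaleR_scaleR[symmetric] scaleR_sum_right[symmetric]
          b'[symmetric] \<sigma>(3)[symmetric] y ..
    qed
    moreover have "0 < ?u t" if "t \<in> T" for t
    proof (cases "a = 1")
      case False
      then have "0 < (1 - a) * coord b t" using a n that by (simp add: b)
      then show ?thesis using a coord_nonneg[of x t] by (simp add: add_pos_nonneg)
    qed (use x that in simp)
    ultimately show "y \<in> {x. \<forall>t\<in>T. 0 < coord x t}" by simp
  qed
  then show "starlike {x. \<forall>t\<in>T. 0 < coord x t}"
    unfolding starlike_def using bS by blast
qed

lemma open_star_subset: "T \<noteq> {} \<Longrightarrow> {x. \<forall>t\<in>T. 0 < coord x t} \<subseteq> realization"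
  using coord_outside by fastforce

lemma open_star_empty:
  assumes "T \<notin> F" "T \<noteq> {}"
  shows "{x. \<forall>t\<in>T. 0 < coord x t} = {}"
proof (rule ccontr)
  assume "\<not> ?thesis"
  then obtain x where x: "\<forall>t\<in>T. 0 < coord x t" by auto
  then have "x \<in> realization" using open_star_subset[OF assms(2)] by blast
  then have "{v. coord x v \<noteq> 0} \<in> F" by (rule coord_support)
  moreover have "T \<subseteq> {v. coord x v \<noteq> 0}" using x by force
  ultimately show False using assms(1) down_closed by blast
qed

lemma euler_char_open_star:
  assumes "T \<noteq> {}"
  shows "finite_betti {x. \<forall>t\<in>T. 0 < coord x t}" (is "finite_betti ?U")
    and "euler_char {x. \<forall>t\<in>T. 0 < coord x t} = (if T \<in> F then 1 else 0)"
proof -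
  have "finite_betti ?U \<and> euler_char ?U = (if T \<in> F then 1 else 0)"
  proof (cases "T \<in> F")
    case True
    have c: "contractible ?U"
      using open_star_starlike(1)[OF True assms] by (rule starlike_imp_contractible)
    from euler_char_contractible[OF c open_star_starlike(2)[OF True assms]] True
    show ?thesis by (simp only: if_True simp_thms)
  next
    case False
    from euler_char_empty[where 'a='a] False show ?thesis
      unfolding open_star_empty[OF False assms] by (simp only: if_False simp_thms)
  qed
  then show "finite_betti ?U" "euler_char ?U = (if T \<in> F then 1 else 0)" by blast+
qed

lemma openin_positive_coord: "openin (top_of_set realization) {x. 0 < coord x v}"
proof -
  have "openin (top_of_set realization) (realization \<inter> (\<lambda>x. coord x v) -` {0<..})"
    using continuous_openin_preimage_gen[OF continuous_on_coord open_greaterThan] .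
  moreover have "realization \<inter> (\<lambda>x. coord x v) -` {0<..} = {x. 0 < coord x v}"
    using coord_outside by force
  ultimately show ?thesis by simp
qed

lemma euler_char_union_open_stars:
  assumes "finite S" "S \<noteq> {}"
  shows "finite_betti (\<Union>v\<in>S. {x. 0 < coord x v})"
    and "euler_char (\<Union>v\<in>S. {x. 0 < coord x v}) =
      (\<Sum>T\<in>Pow S - {{}}. (-1) ^ (card T + 1) * (if T \<in> F then 1 else 0))"
proof -
  \<comment> \<open>Openness in the whole polyhedron survives unions and restricts to the union of
    any two members, where Mayer-Vietoris asks for it.\<close>
  let ?G = "\<lambda>U. openin (top_of_set realization) U \<and> finite_betti U"
  let ?h = "\<lambda>v. {x. 0 < coord x v}"
  have Inf: "Inf_fin (?h ` T) = {x. \<forall>t\<in>T. 0 < coord x t}" if "T \<subseteq> S" "T \<noteq> {}" for T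
    using that finite_subset[OF that(1) assms(1)] by (subst Inf_fin_Inf) auto
  have "?G (Sup_fin (?h ` S)) \<and> euler_char (Sup_fin (?h ` S)) =
      (\<Sum>T\<in>Pow S - {{}}. (-1) ^ (card T + 1) * euler_char (Inf_fin (?h ` T)))"
  proof (rule inclusion_exclusion_lattice[OF _ assms])
    fix U V assume U: "?G U" and V: "?G V" and UV: "?G (inf U V)"
    then have op: "openin (top_of_set realization) (U \<union> V)" by blast
    have "U \<union> V \<subseteq> realization" using openin_imp_subset[OF op] .
    then have op': "openin (top_of_set (U \<union> V)) U" "openin (top_of_set (U \<union> V)) V"
      using U V openin_subset_trans[of realization _ "U \<union> V"] by simp_all
    show "?G (sup U V) \<and> euler_char (sup U V) = euler_char U + euler_char V - euler_char (inf U V)"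
      using euler_char_Mayer_Vietoris[OF op' conjunct2[OF U] conjunct2[OF V] conjunct2[OF UV]] op by simp
  next
    fix T assume T: "T \<subseteq> S" "T \<noteq> {}"
    have "openin (top_of_set realization) (\<Inter>v\<in>T. ?h v)"
      using T finite_subset[OF T(1) assms(1)] openin_positive_coord by (intro openin_INT2) auto
    moreover have "(\<Inter>v\<in>T. ?h v) = {x. \<forall>t\<in>T. 0 < coord x t}" by auto
    ultimately show "?G (Inf_fin (?h ` T))"
      using euler_char_open_star(1)[OF T(2)] Inf[OF T] by simp
  qed
  moreover have "Sup_fin (?h ` S) = (\<Union>v\<in>S. ?h v)" using assms by (subst Sup_fin_Sup) auto
  moreover have "(\<Sum>T\<in>Pow S - {{}}. (-1) ^ (card T + 1) * euler_char (Inf_fin (?h ` T))) =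
      (\<Sum>T\<in>Pow S - {{}}. (-1) ^ (card T + 1) * (if T \<in> F then 1 else 0))"
  proof (rule sum.cong)
    fix T assume "T \<in> Pow S - {{}}"
    then have T: "T \<subseteq> S" "T \<noteq> {}" by auto
    show "(-1) ^ (card T + 1) * euler_char (Inf_fin (?h ` T)) = (-1) ^ (card T + 1) * (if T \<in> F then 1 else 0)"
      unfolding Inf[OF T] euler_char_open_star(2)[OF T(2)] ..
  qed simp
  ultimately show "finite_betti (\<Union>v\<in>S. ?h v)"
    "euler_char (\<Union>v\<in>S. ?h v) = (\<Sum>T\<in>Pow S - {{}}. (-1) ^ (card T + 1) * (if T \<in> F then 1 else 0))"
    by simp_all
qed

lemma realization_eq_union_open_stars: "realization = (\<Union>v\<in>vertices. {x. 0 < coord x v})"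
proof (intro equalityI subsetI)
  fix x assume "x \<in> realization"
  from coord_support(2)[OF this] obtain v where "coord x v \<noteq> 0" by auto
  then show "x \<in> (\<Union>v\<in>vertices. {x. 0 < coord x v})"
    using coord_nonneg[of x v] coord_not_vertex[of v x] by force
qed (use coord_outside in force)

text \<open>The vertex stars cover the polyhedron, and a set of vertices spanning no simplex
  contributes 0, so inclusion-exclusion over all sets of vertices collapses to the simplices. The
  empty polyhedron is separate because inclusion-exclusion starts from a nonempty family.\<close>

theorem euler_char_realization: "euler_char realization = complex_euler_char simplices"
proof (cases "vertices = {}")
  case True
  then have "F - {{}} = {}" "realization = {}"
    by (auto simp: vertices_def realization_def)
  then show ?thesis unfolding complex_euler_char_simplices by (simp only: euler_char_empty sum.empty)
next
  case False
  have "euler_char realization = (\<Sum>T\<in>Pow vertices - {{}}. (-1) ^ (card T + 1) * (if T \<in> F then 1 else 0))"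
    using euler_char_union_open_stars(2)[OF finite_vertices False]
    unfolding realization_eq_union_open_stars[symmetric] .
  also have "\<dots> = (\<Sum>T\<in>F - {{}}. (-1) ^ (card T + 1) * (if T \<in> F then 1 else 0))"
    using simplex_subset_vertices finite_vertices by (intro sum.mono_neutral_right) auto
  also have "\<dots> = complex_euler_char simplices"
    by (simp add: complex_euler_char_simplices)
  finally show ?thesis .
qed

end

section \<open>Passage from geometric complexes to vertex schemes\<close>

lemma vertex_scheme_of_complex:
  assumes "simplicial_complex K"
  shows "vertex_scheme (simplex_vertices ` K)" "vertex_scheme.simplices (simplex_vertices ` K) = K"
proof -
  have K: "finite K" "\<And>S. S \<in> K \<Longrightarrow> \<exists>n. n simplex S" "\<And>S T. S \<in> K \<Longrightarrow> T face_of S \<Longrightarrow> T \<in> K"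
    "\<And>S T. S \<in> K \<Longrightarrow> T \<in> K \<Longrightarrow> (S \<inter> T) face_of S"
    using assms by (auto simp: simplicial_complex_def)
  have sv: "finite (simplex_vertices S)" "\<not> affine_dependent (simplex_vertices S)"
    "convex hull (simplex_vertices S) = S" if S: "S \<in> K" for S
  proof -
    obtain n where n: "n simplex S" using K(2) S by blast
    then obtain C where C: "finite C" "\<not> affine_dependent C" "S = convex hull C" by (auto simp: simplex)
    then have "simplex_vertices S = C"
      by (auto simp: simplex_vertices_def extreme_point_of_convex_hull_affine_independent)
    with C show "finite (simplex_vertices S)" "\<not> affine_dependent (simplex_vertices S)"
      "convex hull (simplex_vertices S) = S" by auto
  qed
  have hull: "simplex_vertices (convex hull \<tau>) = \<tau>" "convex hull \<tau> \<in> K"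
    if "\<tau> \<subseteq> simplex_vertices S" "S \<in> K" for \<tau> S
  proof -
    have "\<not> affine_dependent \<tau>" using affine_dependent_subset[OF _ that(1)] sv(2)[OF that(2)] by blast
    then show "simplex_vertices (convex hull \<tau>) = \<tau>"
      by (auto simp: simplex_vertices_def extreme_point_of_convex_hull_affine_independent)
    have "convex hull \<tau> face_of S"
      using face_of_convex_hull_affine_independent[OF sv(2)[OF that(2)]] sv(3)[OF that(2)] that(1) by metis
    then show "convex hull \<tau> \<in> K" using K(3) that(2) by blast
  qed
  have unique: "u = w" if S: "S \<in> K" and u: "weights (simplex_vertices S) u" and w: "weights (simplex_vertices S) w"
    and eq: "(\<Sum>v\<in>simplex_vertices S. u v *\<^sub>R v) = (\<Sum>v\<in>simplex_vertices S. w v *\<^sub>R v)" for S u w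
  proof (rule ext, rule ccontr)
    fix v assume v: "u v \<noteq> w v"
    then have "v \<in> simplex_vertices S" using u w by (metis weightsD(2))
    moreover have "(\<Sum>v\<in>simplex_vertices S. u v - w v) = 0"
      using weightsD(3)[OF u] weightsD(3)[OF w] by (simp add: sum_subtractf)
    moreover have "(\<Sum>v\<in>simplex_vertices S. (u v - w v) *\<^sub>R v) = 0"
      using eq by (simp add: scaleR_diff_left sum_subtractf)
    ultimately have "affine_dependent (simplex_vertices S)"
      unfolding affine_dependent_explicit_finite[OF sv(1)[OF S]] using v by (intro exI[of _ "\<lambda>v. u v - w v"]) auto
    then show False using sv(2)[OF S] by blast
  qed
  show "vertex_scheme (simplex_vertices ` K)"
  proof
    show "finite (simplex_vertices ` K)" using K(1) by simp
    show "finite \<sigma>" if "\<sigma> \<in> simplex_vertices ` K" for \<sigma> using that sv(1) by auto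
    show "\<tau> \<in> simplex_vertices ` K" if "\<sigma> \<in> simplex_vertices ` K" "\<tau> \<subseteq> \<sigma>" for \<sigma> \<tau>
      using that hull by (metis (no_types, lifting) image_iff)
  next
    fix \<sigma> \<tau> u w
    assume "\<sigma> \<in> simplex_vertices ` K" "\<tau> \<in> simplex_vertices ` K" and u: "weights \<sigma> u" and w: "weights \<tau> w"
      and eq: "(\<Sum>v\<in>\<sigma>. u v *\<^sub>R v) = (\<Sum>v\<in>\<tau>. w v *\<^sub>R v)"
    then obtain S T where S: "S \<in> K" "\<sigma> = simplex_vertices S" and T: "T \<in> K" "\<tau> = simplex_vertices T" by auto
    let ?x = "\<Sum>v\<in>\<sigma>. u v *\<^sub>R v"
    have "?x \<in> S" using S sv[OF S(1)] u convex_hull_weights[of \<sigma>] by auto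
    moreover have "?x \<in> T" using T sv[OF T(1)] w convex_hull_weights[of \<tau>] eq by auto
    ultimately have x: "?x \<in> S \<inter> T" by blast
    have "S \<inter> T face_of S" "T \<inter> S face_of T" using K(4) S T by auto
    \<comment> \<open>The intersection is a face of both simplices, hence spanned by vertices of
      each; a simplex determines its vertices, so the two spanning sets coincide. Weights on the
      common face then decide both \<open>u\<close> and \<open>w\<close>.\<close>
    then obtain \<rho> \<rho>' where \<rho>: "\<rho> \<subseteq> \<sigma>" "S \<inter> T = convex hull \<rho>" and \<rho>': "\<rho>' \<subseteq> \<tau>" "T \<inter> S = convex hull \<rho>'"
      using face_of_convex_hull_affine_independent[OF sv(2)[OF S(1)]] sv(3)[OF S(1)] S(2)
        face_of_convex_hull_affine_independent[OF sv(2)[OF T(1)]] sv(3)[OF T(1)] T(2) by metis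
    have "\<rho> = \<rho>'" using hull(1) \<rho> \<rho>' S T by (metis inf_commute)
    have fin: "finite \<sigma>" "finite \<tau>" using S T sv(1) by auto
    have "finite \<rho>" using \<rho>(1) fin finite_subset by blast
    then obtain z where z: "weights \<rho> z" "?x = (\<Sum>v\<in>\<rho>. z v *\<^sub>R v)"
      using x unfolding \<rho>(2) convex_hull_weights[OF \<open>finite \<rho>\<close>] by blast
    have "u = z"
      using unique[OF S(1), of u z] u weights_mono[OF z(1) \<rho>(1) fin(1)] z(2)
        weights_sum_superset(2)[OF z(1) \<rho>(1) fin(1), of "\<lambda>v. v"] S(2) by simp
    moreover have "w = z"
      using unique[OF T(1), of w z] w weights_mono[OF z(1) _ fin(2)] z(2) \<rho>'(1) \<open>\<rho> = \<rho>'\<close> eq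
        weights_sum_superset(2)[OF z(1) _ fin(2), of "\<lambda>v. v"] T(2) by simp
    ultimately show "u = w" by simp
  qed
  then interpret vertex_scheme "simplex_vertices ` K" .
  show "simplices = K"
    unfolding simplices_def using sv(3) by (auto simp: image_image)
qed

corollary euler_char_triangulation:
  assumes "triangulates K P"
  shows "euler_char P = complex_euler_char K"
proof -
  have K: "simplicial_complex K" "\<Union>K = P" using assms by (auto simp: triangulates_def)
  interpret vertex_scheme "simplex_vertices ` K" by (rule vertex_scheme_of_complex(1)[OF K(1)])
  show ?thesis
    using euler_char_realization Union_simplices vertex_scheme_of_complex(2)[OF K(1)] K(2) by simp
qed

text \<open>A topological invariant equal to the count for every triangulation shows that the
  definite description denotes.\<close>

corollary polyhedron_euler_char_eq:
  assumes "triangulates K P"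
  shows "polyhedron_euler_char P = euler_char P"
  unfolding polyhedron_euler_char_def
  by (rule the_equality) (metis euler_char_triangulation assms)+

section \<open>Star subdivisions, and complements of full subcomplexes\<close>

lemma weightsI_superset:
  fixes u :: "'a::real_vector \<Rightarrow> real"
  assumes "finite V" "\<sigma> \<subseteq> V" "\<And>v. v \<in> \<sigma> \<Longrightarrow> 0 \<le> u v" "\<And>v. v \<notin> \<sigma> \<Longrightarrow> u v = 0" "sum u V = 1"
  shows "weights \<sigma> u" "(\<Sum>v\<in>\<sigma>. u v *\<^sub>R v) = (\<Sum>v\<in>V. u v *\<^sub>R v)"
proof -
  have "sum u \<sigma> = sum u V"
    using assms by (intro sum.mono_neutral_left) auto
  then show "weights \<sigma> u" using assms by (simp add: weights_def)
  show "(\<Sum>v\<in>\<sigma>. u v *\<^sub>R v) = (\<Sum>v\<in>V. u v *\<^sub>R v)"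
    using assms by (intro sum.mono_neutral_left) auto
qed

text \<open>The barycenter computed from the vertex set; \<open>barycenter\<close> takes the simplex
  as a convex set.\<close>

definition mean :: "'a::real_vector set \<Rightarrow> 'a" where
  "mean \<sigma> = (1 / real (card \<sigma>)) *\<^sub>R (\<Sum>v\<in>\<sigma>. v)"

lemma card_scaleR_mean: "finite \<sigma> \<Longrightarrow> \<sigma> \<noteq> {} \<Longrightarrow> real (card \<sigma>) *\<^sub>R mean \<sigma> = (\<Sum>v\<in>\<sigma>. v)"
  by (simp add: mean_def)

lemma sum_indicator_mean:
  assumes "finite V" "T \<subseteq> V" "T \<noteq> {}"
  shows "(\<Sum>v\<in>V. if v \<in> T then c else 0) = real (card T) * c"
    and "(\<Sum>v\<in>V. (if v \<in> T then c else 0) *\<^sub>R v) = (real (card T) * c) *\<^sub>R mean T"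
proof -
  have "(\<Sum>v\<in>V. if v \<in> T then c else 0) = (\<Sum>v\<in>T. c)"
    using assms by (simp add: sum.inter_restrict[symmetric] Int_absorb1)
  then show "(\<Sum>v\<in>V. if v \<in> T then c else 0) = real (card T) * c" by simp
  have "(\<Sum>v\<in>V. (if v \<in> T then c else 0) *\<^sub>R v) = (\<Sum>v\<in>V. if v \<in> T then c *\<^sub>R v else 0)"
    by (intro sum.cong) auto
  also have "\<dots> = (\<Sum>v\<in>T. c *\<^sub>R v)"
    using assms by (simp add: sum.inter_restrict[symmetric] Int_absorb1)
  also have "\<dots> = c *\<^sub>R (real (card T) *\<^sub>R mean T)"
    unfolding scaleR_sum_right[symmetric] card_scaleR_mean[OF finite_subset[OF assms(2,1)] assms(3)] ..
  finally show "(\<Sum>v\<in>V. (if v \<in> T then c else 0) *\<^sub>R v) = (real (card T) * c) *\<^sub>R mean T"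
    by (simp add: mult.commute)
qed

lemma sum_indicator_point:
  fixes b :: "'a::real_vector"
  assumes "finite V" "b \<in> V"
  shows "(\<Sum>v\<in>V. if v = b then c else 0) = (c :: real)"
    and "(\<Sum>v\<in>V. (if v = b then c else 0) *\<^sub>R v) = c *\<^sub>R b"
  using assms by (simp_all add: if_distrib[of "\<lambda>t. t *\<^sub>R _"] cong: if_cong)

section \<open>Star subdivision at the barycenter of a simplex\<close>

context vertex_scheme begin

lemma coord_mean:
  assumes "T \<in> F" "T \<noteq> {}"
  shows "coord (mean T) = (\<lambda>v. if v \<in> T then 1 / real (card T) else 0)" "mean T \<in> convex hull T"
proof -
  have n: "card T > 0" using assms finite_simplex by (simp add: card_gt_0_iff)
  have w: "weights T (\<lambda>v. if v \<in> T then 1 / real (card T) else 0)"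
    using n by (auto simp: weights_def)
  have m: "mean T = (\<Sum>v\<in>T. (if v \<in> T then 1 / real (card T) else 0) *\<^sub>R v)"
    by (simp add: mean_def scaleR_sum_right)
  show "coord (mean T) = (\<lambda>v. if v \<in> T then 1 / real (card T) else 0)"
    by (rule coord_eqI[OF assms(1) w m])
  show "mean T \<in> convex hull T"
    unfolding m by (rule weights_in_realization(1)[OF assms(1) w])
qed

text \<open>A vertex has a unit coordinate vector, whereas the barycenter of \<open>T\<close> is
  positive at every member of \<open>T\<close>. So the new vertex of a star subdivision can coincide
  with an old one only if \<open>T\<close> is a singleton.\<close>

lemma mean_in_simplex:
  assumes "T \<in> F" "T \<noteq> {}" "\<sigma> \<in> F" "mean T \<in> \<sigma>"
  shows "T \<subseteq> \<sigma>"
proof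
  fix t assume t: "t \<in> T"
  have "mean T \<in> vertices" using assms(3,4) by (auto simp: vertices_def)
  then have "coord (mean T) = (\<lambda>w. if w = mean T then 1 else 0)" by (rule coord_vertex)
  moreover have "coord (mean T) t \<noteq> 0"
    using t assms finite_simplex[OF assms(1)] by (auto simp: coord_mean)
  ultimately show "t \<in> \<sigma>" using assms(4) by (auto split: if_splits)
qed

text \<open>Simplices containing \<open>T\<close> give way to cones from \<open>mean T\<close> over
  those faces of the closed star that do not contain \<open>T\<close>.\<close>

definition star_subdivision :: "'a set \<Rightarrow> 'a set set" where
  "star_subdivision T = {\<sigma> \<in> F. \<not> T \<subseteq> \<sigma>} \<union> insert (mean T) ` {\<sigma> \<in> F. \<not> T \<subseteq> \<sigma> \<and> \<sigma> \<union> T \<in> F}"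

text \<open>Moves the weight of the new vertex \<^term>\<open>mean T\<close> of the star subdivision back to \<^term>\<open>T\<close>.\<close>

definition unstar :: "'a set \<Rightarrow> ('a \<Rightarrow> real) \<Rightarrow> 'a \<Rightarrow> real" where
  "unstar T w v = w v - (if v = mean T then w (mean T) else 0) + (if v \<in> T then w (mean T) / real (card T) else 0)"

text \<open>Inverse to \<open>unstar\<close>: the weight common to all members of \<open>T\<close>
  moves to \<open>mean T\<close>, multiplied by \<open>card T\<close> because \<open>mean T\<close>
  distributes its weight evenly over \<open>T\<close>. The corrections are added rather than
  assigned, which keeps both formulas right when \<open>mean T\<close> lies in
  \<open>T\<close>.\<close>

definition restar :: "'a set \<Rightarrow> ('a \<Rightarrow> real) \<Rightarrow> 'a \<Rightarrow> real" where
  "restar T u v = u v - (if v \<in> T then Min (u ` T) else 0) + (if v = mean T then real (card T) * Min (u ` T) else 0)"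

text \<open>The last claim recovers the weights from the represented point alone, and is thus the
  uniqueness that a vertex scheme demands of the subdivision.\<close>

lemma star_weights:
  assumes T: "T \<in> F" "T \<noteq> {}" and \<tau>: "\<tau> \<in> star_subdivision T" and w: "weights \<tau> w"
  shows "(\<Sum>v\<in>\<tau>. w v *\<^sub>R v) \<in> realization" "coord (\<Sum>v\<in>\<tau>. w v *\<^sub>R v) = unstar T w"
    "w = restar T (coord (\<Sum>v\<in>\<tau>. w v *\<^sub>R v))"
proof -
  let ?b = "mean T" and ?n = "real (card T)"
  let ?V = "insert ?b vertices"
  have fT: "finite T" and n: "?n > 0" using T finite_simplex by (auto simp: card_gt_0_iff)
  \<comment> \<open>In both kinds of simplices of the subdivision \<open>\<sigma>\<close> is an old
    simplex: \<open>\<tau>\<close> itself, or the base of the cone.\<close>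
  obtain \<sigma> where \<sigma>: "\<sigma> \<in> F" "\<not> T \<subseteq> \<sigma>" "\<tau> \<subseteq> insert ?b \<sigma>" "?b \<in> \<tau> \<Longrightarrow> \<sigma> \<union> T \<in> F"
  proof -
    have "\<tau> \<in> F \<and> \<not> T \<subseteq> \<tau> \<or> (\<exists>\<sigma>\<in>F. \<not> T \<subseteq> \<sigma> \<and> \<sigma> \<union> T \<in> F \<and> \<tau> = insert ?b \<sigma>)"
      using \<tau> by (auto simp: star_subdivision_def)
    then show thesis
    proof (elim disjE bexE conjE)
      assume "\<tau> \<in> F" "\<not> T \<subseteq> \<tau>"
      then show thesis using that[of \<tau>] mean_in_simplex[OF T, of \<tau>] by blast
    next
      fix \<sigma> assume "\<sigma> \<in> F" "\<not> T \<subseteq> \<sigma>" "\<sigma> \<union> T \<in> F" "\<tau> = insert ?b \<sigma>"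
      then show thesis using that[of \<sigma>] by blast
    qed
  qed
  have b\<sigma>: "?b \<notin> \<sigma>" using mean_in_simplex[OF T \<sigma>(1)] \<sigma>(2) by blast
  have fV: "finite ?V" using finite_vertices by simp
  have \<tau>V: "\<tau> \<subseteq> ?V" using \<sigma>(3) simplex_subset_vertices[OF \<sigma>(1)] by blast
  have TV: "T \<subseteq> ?V" using simplex_subset_vertices[OF T(1)] by blast
  note W = weights_sum_superset[OF w \<tau>V fV]
  have w0: "w v = 0" if "v \<notin> insert ?b \<sigma>" for v using weightsD(2)[OF w] \<sigma>(3) that by blast
  have wpos: "0 \<le> w v" for v using weightsD(1)[OF w] .
  let ?\<rho> = "if ?b \<in> \<tau> then \<sigma> \<union> T else \<sigma>"
  have \<rho>: "?\<rho> \<in> F" using \<sigma> by simp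
  have wb: "?b \<notin> \<tau> \<Longrightarrow> w ?b = 0" using weightsD(2)[OF w] by blast
  note ind = sum_indicator_mean[OF fV TV T(2)] and pt = sum_indicator_point[OF fV, of ?b]
  have "sum (unstar T w) ?V = 1"
    unfolding unstar_def sum.distrib sum_subtractf ind(1) pt(1)[OF insertI1] W(1) using n by simp
  moreover have vec: "(\<Sum>v\<in>?V. unstar T w v *\<^sub>R v) = (\<Sum>v\<in>\<tau>. w v *\<^sub>R v)"
    unfolding unstar_def scaleR_add_left scaleR_diff_left sum.distrib sum_subtractf ind(2) pt(2)[OF insertI1] W(2)
    using n by simp
  moreover have "0 \<le> unstar T w v" for v
    using wpos[of v] wpos[of ?b] by (simp add: unstar_def)
  moreover have "unstar T w v = 0" if "v \<notin> ?\<rho>" for v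
  proof (cases "?b \<in> \<tau>")
    case True
    then have "v \<notin> \<sigma>" "v \<notin> T" using that by auto
    then show ?thesis using w0[of v] by (cases "v = ?b") (auto simp: unstar_def)
  next
    case False
    then have "v \<notin> \<sigma>" "w ?b = 0" using that wb by auto
    then show ?thesis using w0[of v] by (cases "v = ?b") (auto simp: unstar_def)
  qed
  moreover have "?\<rho> \<subseteq> ?V" using simplex_subset_vertices[OF \<rho>] by blast
  ultimately have u: "weights ?\<rho> (unstar T w)" "(\<Sum>v\<in>?\<rho>. unstar T w v *\<^sub>R v) = (\<Sum>v\<in>\<tau>. w v *\<^sub>R v)"
    using weightsI_superset[OF fV, of ?\<rho> "unstar T w"] by auto
  show "(\<Sum>v\<in>\<tau>. w v *\<^sub>R v) \<in> realization"
    using weights_in_realization(2)[OF \<rho> u(1)] u(2) by simp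
  show c: "coord (\<Sum>v\<in>\<tau>. w v *\<^sub>R v) = unstar T w"
    by (rule coord_eqI[OF \<rho> u(1) u(2)[symmetric]])
  \<comment> \<open>A member of \<open>T\<close> outside \<open>\<sigma>\<close> owns only its share
    of the weight of \<open>mean T\<close>, while the other members own at least as much. The
    minimum over \<open>T\<close> therefore reads off that share.\<close>
  obtain t where t: "t \<in> T" "t \<notin> \<sigma>" using \<sigma>(2) by blast
  have ut: "unstar T w t = w ?b / ?n" using t w0[of t] by (cases "t = ?b") (auto simp: unstar_def)
  have us: "w ?b / ?n \<le> unstar T w s" if "s \<in> T" for s
    using that wpos[of s] by (simp add: unstar_def)
  have Min: "Min (unstar T w ` T) = w ?b / ?n"
  proof (rule Min_eqI)
    show "w ?b / ?n \<in> unstar T w ` T" unfolding ut[symmetric] using t(1) by (rule imageI)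
  qed (use fT us in auto)
  show "w = restar T (coord (\<Sum>v\<in>\<tau>. w v *\<^sub>R v))"
    unfolding c using n by (auto simp: fun_eq_iff restar_def Min) (auto simp: unstar_def)
qed

text \<open>If the carrier of \<open>x\<close> contains \<open>T\<close>, then \<open>restar\<close>
  kills a member \<open>t\<close> of \<open>T\<close> with smallest coordinate, and the carrier
  without \<open>t\<close> is the base of a cone; otherwise the carrier survives the
  subdivision.\<close>

lemma star_weights_exist:
  assumes T: "T \<in> F" "T \<noteq> {}" and x: "x \<in> realization"
  obtains \<tau> w where "\<tau> \<in> star_subdivision T" "weights \<tau> w" "x = (\<Sum>v\<in>\<tau>. w v *\<^sub>R v)"
proof (cases "T \<subseteq> {v. coord x v \<noteq> 0}")
  case False
  show thesis
    by (rule that[of "{v. coord x v \<noteq> 0}" "coord x"])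
       (use coord_support[OF x] False in \<open>auto simp: star_subdivision_def\<close>)
next
  case True
  let ?b = "mean T" and ?n = "real (card T)" and ?\<sigma> = "{v. coord x v \<noteq> 0}"
  let ?V = "insert ?b vertices" and ?w = "restar T (coord x)" and ?m = "Min (coord x ` T)"
  have fT: "finite T" and n: "?n > 0" using T finite_simplex by (auto simp: card_gt_0_iff)
  have fV: "finite ?V" using finite_vertices by simp
  have TV: "T \<subseteq> ?V" using simplex_subset_vertices[OF T(1)] by blast
  have "?m \<in> coord x ` T" using fT T(2) by (intro Min_in) auto
  then obtain t where t: "t \<in> T" "coord x t = ?m" by auto
  have m: "?m \<le> coord x s" if "s \<in> T" for s using that fT by simp
  have "?m \<ge> 0" using t coord_nonneg[of x t] by simp
  let ?\<tau> = "insert ?b (?\<sigma> - {t})"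
  have \<sigma>F: "?\<sigma> \<in> F" using coord_support[OF x] by simp
  have b: "?b \<notin> ?\<sigma> - {t}"
    using mean_in_simplex[OF T down_closed[OF \<sigma>F, of "?\<sigma> - {t}"]] t by blast
  have \<tau>: "?\<tau> \<in> star_subdivision T"
  proof -
    have "?\<sigma> - {t} \<in> F" by (rule down_closed[OF \<sigma>F Diff_subset])
    moreover have "\<not> T \<subseteq> ?\<sigma> - {t}" using t by blast
    moreover have "(?\<sigma> - {t}) \<union> T = ?\<sigma>" using True t by blast
    ultimately have "?\<sigma> - {t} \<in> {\<sigma> \<in> F. \<not> T \<subseteq> \<sigma> \<and> \<sigma> \<union> T \<in> F}" using \<sigma>F by simp
    then show ?thesis unfolding star_subdivision_def by blast
  qed
  note ind = sum_indicator_mean[OF fV TV T(2)] and pt = sum_indicator_point[OF fV, of ?b]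
  have \<sigma>V: "?\<sigma> \<subseteq> ?V" using simplex_subset_vertices[OF \<sigma>F] by blast
  note W = weights_sum_superset[OF coord_support(3)[OF x] \<sigma>V fV]
  have "sum ?w ?V = 1"
    unfolding restar_def sum.distrib sum_subtractf ind(1) pt(1)[OF insertI1] W(1) by simp
  moreover have "(\<Sum>v\<in>?V. ?w v *\<^sub>R v) = x"
    unfolding restar_def scaleR_add_left scaleR_diff_left sum.distrib sum_subtractf ind(2) pt(2)[OF insertI1] W(2)
    using coord_support(4)[OF x] by simp
  moreover have "0 \<le> ?w v" for v
    using m[of v] coord_nonneg[of x v] \<open>?m \<ge> 0\<close> by (auto simp: restar_def)
  moreover have "?w v = 0" if "v \<notin> ?\<tau>" for v
  proof (cases "v = t")
    case True
    then show ?thesis using that t by (auto simp: restar_def)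
  next
    case False
    then have "coord x v = 0" "v \<noteq> ?b" "v \<notin> T" using that True by auto
    then show ?thesis by (simp add: restar_def)
  qed
  moreover have "?\<tau> \<subseteq> ?V" using \<sigma>V by blast
  ultimately have "weights ?\<tau> ?w" "x = (\<Sum>v\<in>?\<tau>. ?w v *\<^sub>R v)"
    using weightsI_superset[OF fV, of ?\<tau> ?w] by auto
  with \<tau> show thesis by (rule that)
qed

lemma vertex_scheme_star_subdivision:
  assumes T: "T \<in> F" "T \<noteq> {}"
  shows "vertex_scheme (star_subdivision T)"
proof
  show "finite (star_subdivision T)" using finite_F by (simp add: star_subdivision_def)
  show "finite \<sigma>" if "\<sigma> \<in> star_subdivision T" for \<sigma>
    using that finite_simplex by (auto simp: star_subdivision_def)
  show "w = w'" if "\<sigma> \<in> star_subdivision T" "\<tau> \<in> star_subdivision T" "weights \<sigma> w" "weights \<tau> w'"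
    "(\<Sum>v\<in>\<sigma>. w v *\<^sub>R v) = (\<Sum>v\<in>\<tau>. w' v *\<^sub>R v)" for \<sigma> \<tau> w w'
    using star_weights(3)[OF T that(1,3)] star_weights(3)[OF T that(2,4)] that(5) by simp
  show "\<tau> \<in> star_subdivision T" if \<sigma>: "\<sigma> \<in> star_subdivision T" and \<tau>: "\<tau> \<subseteq> \<sigma>" for \<sigma> \<tau>
  proof -
    have "\<sigma> \<in> F \<and> \<not> T \<subseteq> \<sigma> \<or> (\<exists>\<rho>\<in>F. \<not> T \<subseteq> \<rho> \<and> \<rho> \<union> T \<in> F \<and> \<sigma> = insert (mean T) \<rho>)"
      using \<sigma> by (auto simp: star_subdivision_def)
    then show ?thesis
    proof (elim disjE bexE conjE)
      assume "\<sigma> \<in> F" "\<not> T \<subseteq> \<sigma>"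
      then show ?thesis using down_closed[of \<sigma> \<tau>] \<tau> by (auto simp: star_subdivision_def)
    next
      fix \<rho> assume \<rho>: "\<rho> \<in> F" "\<not> T \<subseteq> \<rho>" "\<rho> \<union> T \<in> F" "\<sigma> = insert (mean T) \<rho>"
      have sub: "\<tau> - {mean T} \<subseteq> \<rho>" using \<tau> \<rho>(4) by blast
      have 1: "\<tau> - {mean T} \<in> F" using down_closed[OF \<rho>(1) sub] .
      have 2: "\<not> T \<subseteq> \<tau> - {mean T}" using \<rho>(2) sub by blast
      have 3: "(\<tau> - {mean T}) \<union> T \<in> F" using down_closed[OF \<rho>(3)] sub by blast
      show ?thesis
      proof (cases "mean T \<in> \<tau>")
        case True
        then have "\<tau> = insert (mean T) (\<tau> - {mean T})" by blast
        moreover have "insert (mean T) (\<tau> - {mean T}) \<in> star_subdivision T"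
          unfolding star_subdivision_def by (intro UnI2 imageI CollectI conjI 1 2 3)
        ultimately show ?thesis by simp
      next
        case False
        then have "\<tau> - {mean T} = \<tau>" by blast
        with 1 2 show ?thesis by (simp add: star_subdivision_def)
      qed
    qed
  qed
qed

text \<open>
  The hat of the new vertex in the star subdivision at \<open>T\<close>; its support is the open star of \<open>T\<close>.
\<close>

theorem schauder_hat_Min_coord:
  assumes T: "T \<in> F" "T \<noteq> {}"
  shows "schauder_hat realization (\<lambda>x. real (card T) * Min ((\<lambda>t. coord x t) ` T))"
proof -
  interpret S: vertex_scheme "star_subdivision T" by (rule vertex_scheme_star_subdivision[OF T])
  have finT: "finite T" using finite_simplex[OF T(1)] .
  have realization_eq: "S.realization = realization"
  proof (intro equalityI subsetI)
    fix x assume "x \<in> S.realization"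
    then show "x \<in> realization"
      using star_weights(1)[OF T S.coord_support(1,3)] S.coord_support(4) by metis
  next
    fix x assume "x \<in> realization"
    then obtain \<tau> w where "\<tau> \<in> star_subdivision T" "weights \<tau> w" "x = (\<Sum>v\<in>\<tau>. w v *\<^sub>R v)"
      using star_weights_exist[OF T] by blast
    then show "x \<in> S.realization" using S.weights_in_realization(2) by blast
  qed
  have "S.coord x (mean T) = real (card T) * Min (coord x ` T)" for x
  proof (cases "x \<in> realization")
    case True
    then have x: "x \<in> S.realization" by (simp add: realization_eq)
    have "S.coord x = restar T (coord x)"
      using star_weights(3)[OF T S.coord_support(1,3)[OF x]] S.coord_support(4)[OF x] by simp
    \<comment> \<open>The old coordinate at \<open>mean T\<close> is zero unless \<open>T\<close> is
      a single vertex. In both cases the first two terms of \<open>restar\<close> cancel at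
      \<open>mean T\<close> and leave \<open>card T\<close> times the minimum.\<close>
    moreover have "coord x (mean T) = (if mean T \<in> T then Min (coord x ` T) else 0)"
    proof (cases "mean T \<in> vertices")
      case True
      then have "T \<subseteq> {mean T}" using mean_in_simplex[OF T, of "{mean T}"] by (simp add: vertex_iff)
      then have "T = {mean T}" using T(2) by blast
      then show ?thesis by (metis Min_singleton image_empty image_insert insertI1)
    next
      case False
      then have "mean T \<notin> T" using simplex_subset_vertices[OF T(1)] by blast
      then show ?thesis using coord_not_vertex[OF False] by simp
    qed
    ultimately show ?thesis by (simp add: restar_def)
  next
    case False
    then have "coord x ` T = {0}" using T(2) by (auto simp: coord_outside)
    moreover have "S.coord x (mean T) = 0" using False by (simp add: S.coord_outside realization_eq)
    ultimately show ?thesis by simp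
  qed
  moreover have "mean T \<in> S.vertices"
  proof -
    have "{} \<in> F" using down_closed[OF T(1)] by simp
    then have "{mean T} \<in> star_subdivision T" using T by (auto simp: star_subdivision_def)
    then show ?thesis by (simp add: S.vertex_iff)
  qed
  ultimately show ?thesis using S.schauder_hat_coord[of "mean T"] by (simp add: realization_eq)
qed

section \<open>Deleting a set of vertices and retracting away from it\<close>

lemma vertex_scheme_avoiding: "vertex_scheme {\<sigma> \<in> F. \<sigma> \<inter> V\<^sub>0 = {}}"
proof
  show "finite {\<sigma> \<in> F. \<sigma> \<inter> V\<^sub>0 = {}}" using finite_F by simp
  show "finite \<sigma>" if "\<sigma> \<in> {\<sigma> \<in> F. \<sigma> \<inter> V\<^sub>0 = {}}" for \<sigma> using that finite_simplex by simp
  show "\<tau> \<in> {\<sigma> \<in> F. \<sigma> \<inter> V\<^sub>0 = {}}" if "\<sigma> \<in> {\<sigma> \<in> F. \<sigma> \<inter> V\<^sub>0 = {}}" "\<tau> \<subseteq> \<sigma>" for \<sigma> \<tau>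
    using that down_closed[of \<sigma> \<tau>] by auto
  show "u = w" if "\<sigma> \<in> {\<sigma> \<in> F. \<sigma> \<inter> V\<^sub>0 = {}}" "\<tau> \<in> {\<sigma> \<in> F. \<sigma> \<inter> V\<^sub>0 = {}}"
    "weights \<sigma> u" "weights \<tau> w" "(\<Sum>v\<in>\<sigma>. u v *\<^sub>R v) = (\<Sum>v\<in>\<tau>. w v *\<^sub>R v)" for \<sigma> \<tau> u w
    using that weights_inject[of \<sigma> \<tau> u w] by simp
qed

text \<open>
  Radial projection away from the vertices in \<open>V\<^sub>0\<close> retracts the complement of the full subcomplex
  spanned by \<open>V\<^sub>0\<close> onto the full subcomplex spanned by the other vertices.
\<close>

lemma homotopy_eqv_avoiding:
  "{x. \<exists>v. v \<notin> V\<^sub>0 \<and> coord x v \<noteq> 0} homotopy_eqv (\<Union>\<sigma>\<in>{\<sigma> \<in> F. \<sigma> \<inter> V\<^sub>0 = {}}. convex hull \<sigma>)"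
proof -
  let ?W = "{x. \<exists>v. v \<notin> V\<^sub>0 \<and> coord x v \<noteq> 0}" and ?A = "\<Union>\<sigma>\<in>{\<sigma> \<in> F. \<sigma> \<inter> V\<^sub>0 = {}}. convex hull \<sigma>"
  \<comment> \<open>\<open>s x\<close> is the total weight of \<open>x\<close> off
    \<open>V\<^sub>0\<close>, positive exactly where the projection is wanted; \<open>r\<close>
    discards the remaining weight and renormalizes.\<close>
  define s where "s x = (\<Sum>v\<in>vertices - V\<^sub>0. coord x v)" for x
  define r where "r x = (\<Sum>v\<in>vertices - V\<^sub>0. (coord x v / s x) *\<^sub>R v)" for x
  have WR: "?W \<subseteq> realization" using coord_outside by blast
  have s: "s x > 0" if x: "x \<in> ?W" for x
  proof -
    obtain v where v: "v \<notin> V\<^sub>0" "coord x v \<noteq> 0" using x by blast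
    then have "v \<in> vertices - V\<^sub>0" using coord_not_vertex by blast
    moreover have "coord x v > 0" using v coord_nonneg[of x v] by simp
    ultimately show ?thesis unfolding s_def using finite_vertices coord_nonneg by (intro sum_pos2) auto
  qed
  have r: "weights ({v. coord x v \<noteq> 0} - V\<^sub>0) (\<lambda>v. if v \<in> V\<^sub>0 then 0 else coord x v / s x)"
    "r x = (\<Sum>v\<in>{v. coord x v \<noteq> 0} - V\<^sub>0. (if v \<in> V\<^sub>0 then 0 else coord x v / s x) *\<^sub>R v)"
    if x: "x \<in> ?W" for x
  proof -
    let ?u = "\<lambda>v. if v \<in> V\<^sub>0 then 0 else coord x v / s x"
    have "sum ?u vertices = (\<Sum>v\<in>vertices - V\<^sub>0. coord x v / s x)"
      using finite_vertices by (intro sum.mono_neutral_cong_right) auto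
    also have "\<dots> = 1" using s[OF x] by (simp add: s_def sum_divide_distrib[symmetric])
    finally have 1: "sum ?u vertices = 1" .
    have 2: "(\<Sum>v\<in>vertices. ?u v *\<^sub>R v) = r x"
      unfolding r_def using finite_vertices by (intro sum.mono_neutral_cong_right) auto
    have sub: "{v. coord x v \<noteq> 0} - V\<^sub>0 \<subseteq> vertices" using coord_not_vertex by blast
    have nonneg: "0 \<le> ?u v" for v using s[OF x] coord_nonneg[of x v] by simp
    have zero: "?u v = 0" if "v \<notin> {v. coord x v \<noteq> 0} - V\<^sub>0" for v using that by auto
    note W = weightsI_superset[OF finite_vertices sub nonneg zero 1]
    show "weights ({v. coord x v \<noteq> 0} - V\<^sub>0) ?u" by (rule W)
    show "r x = (\<Sum>v\<in>{v. coord x v \<noteq> 0} - V\<^sub>0. ?u v *\<^sub>R v)" by (rule trans[OF 2[symmetric] W(2)[symmetric]])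
  qed
  have face: "{v. coord x v \<noteq> 0} - V\<^sub>0 \<in> F" if "x \<in> ?W" for x
    using down_closed[OF coord_support(1)[OF subsetD[OF WR that]] Diff_subset] .
  have rA: "r x \<in> ?A" if x: "x \<in> ?W" for x
    using weights_in_realization(1)[OF face[OF x] r(1)[OF x]] r(2)[OF x] face[OF x] by auto
  have cr: "coord (r x) = (\<lambda>v. if v \<in> V\<^sub>0 then 0 else coord x v / s x)" if x: "x \<in> ?W" for x
    by (rule coord_eqI[OF face[OF x] r[OF x]])
  have AR: "?A \<subseteq> realization" by (auto simp: realization_def)
  have A0: "coord x v = 0" if x: "x \<in> ?A" and v: "v \<in> V\<^sub>0" for x v
  proof -
    obtain \<sigma> where \<sigma>: "\<sigma> \<in> F" "\<sigma> \<inter> V\<^sub>0 = {}" "x \<in> convex hull \<sigma>" using x by blast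
    show ?thesis using weightsD(2)[OF coord_simplex(1)[OF \<sigma>(1,3)], of v] \<sigma>(2) v by blast
  qed
  have AW: "?A \<subseteq> ?W"
  proof
    fix x assume x: "x \<in> ?A"
    then obtain v where "coord x v \<noteq> 0" using coord_support(2)[of x] AR by blast
    then show "x \<in> ?W" using A0[OF x, of v] by blast
  qed
  have rid: "r x = x" if x: "x \<in> ?A" for x
  proof -
    have xR: "x \<in> realization" using x AR by blast
    have "s x = sum (coord x) vertices"
      unfolding s_def using finite_vertices A0[OF x] by (intro sum.mono_neutral_left) auto
    then have "s x = 1" using sum_coord[OF xR] by simp
    moreover have "(\<Sum>v\<in>vertices - V\<^sub>0. coord x v *\<^sub>R v) = (\<Sum>v\<in>vertices. coord x v *\<^sub>R v)"
      using finite_vertices A0[OF x] by (intro sum.mono_neutral_left) auto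
    ultimately show ?thesis using sum_coord(2)[OF xR] by (simp add: r_def)
  qed
  have cont: "continuous_on ?W r"
  proof -
    have c: "continuous_on ?W (\<lambda>x. coord x v)" for v
      using continuous_on_subset[OF continuous_on_coord WR] .
    then have "continuous_on ?W s" unfolding s_def by (intro continuous_intros)
    then show ?thesis
      unfolding r_def using c s by (intro continuous_intros) (auto simp: less_imp_neq[symmetric])
  qed
  \<comment> \<open>The straight-line homotopy stays in the carrier of \<open>x\<close>, and a
    coordinate off \<open>V\<^sub>0\<close> that is positive at \<open>x\<close> is positive all
    along the segment.\<close>
  have "closed_segment x (r x) \<subseteq> ?W" if x: "x \<in> ?W" for x
  proof
    fix y assume "y \<in> closed_segment x (r x)"
    then obtain a where a: "0 \<le> a" "a \<le> 1" and y: "y = (1 - a) *\<^sub>R x + a *\<^sub>R r x"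
      by (auto simp: in_segment)
    let ?\<sigma> = "{v. coord x v \<noteq> 0}"
    let ?c = "\<lambda>v. if v \<in> V\<^sub>0 then 0 else coord x v / s x"
    let ?u = "\<lambda>v. (1 - a) * coord x v + a * ?c v"
    have xR: "x \<in> realization" using x WR by blast
    note \<sigma> = coord_support[OF xR]
    have fin: "finite ?\<sigma>" using finite_simplex[OF \<sigma>(1)] .
    have sub: "?\<sigma> - V\<^sub>0 \<subseteq> ?\<sigma>" by blast
    have wc: "weights ?\<sigma> ?c" using weights_mono[OF r(1)[OF x] sub fin] .
    have rx: "r x = (\<Sum>v\<in>?\<sigma>. ?c v *\<^sub>R v)"
      using weights_sum_superset(2)[OF r(1)[OF x] sub fin, of "\<lambda>v. v"] r(2)[OF x] by simp
    have "coord y = ?u"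
    proof (rule coord_eqI[OF \<sigma>(1)])
      have "sum ?u ?\<sigma> = (1 - a) * sum (coord x) ?\<sigma> + a * sum ?c ?\<sigma>"
        unfolding sum.distrib sum_distrib_left ..
      then have "sum ?u ?\<sigma> = 1" unfolding weightsD(3)[OF wc] weightsD(3)[OF \<sigma>(3)] by simp
      moreover have "0 \<le> ?u v" for v using a s[OF x] coord_nonneg[of x v] by simp
      ultimately show "weights ?\<sigma> ?u" by (simp add: weights_def)
      show "y = (\<Sum>v\<in>?\<sigma>. ?u v *\<^sub>R v)"
        unfolding scaleR_add_left sum.distrib scaleR_scaleR[symmetric] scaleR_sum_right[symmetric]
          rx[symmetric] \<sigma>(4)[symmetric] y ..
    qed
    moreover obtain v where v: "v \<notin> V\<^sub>0" "coord x v \<noteq> 0" using x by blast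
    have "0 < coord x v" using v coord_nonneg[of x v] by simp
    then have "0 < ?u v"
      using a v s[OF x] by (cases "a = 0") (auto intro!: add_nonneg_pos)
    ultimately have "coord y v \<noteq> 0" by simp
    with v show "y \<in> ?W" by blast
  qed
  then have "homotopic_with_canon (\<lambda>_. True) ?W ?W id r"
    using cont by (intro homotopic_with_linear) (auto simp: id_def)
  moreover have "retraction ?W ?A r"
    unfolding retraction_def using AW cont rA rid by blast
  ultimately show ?thesis
    by (rule deformation_retract_imp_homotopy_eqv)
qed

end

section \<open>The barycentric subdivision\<close>

text \<open>The total is left free, so that one member of the chain can be removed or added in an
  induction. The empty set would contribute nothing to the spread, and excluding it is what makes
  weights recoverable.\<close>

definition chain_weights :: "('a set \<Rightarrow> real) \<Rightarrow> bool" where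
  "chain_weights \<mu> \<longleftrightarrow> finite {\<sigma>. \<mu> \<sigma> \<noteq> 0} \<and> chain_subset {\<sigma>. \<mu> \<sigma> \<noteq> 0} \<and> \<mu> {} = 0 \<and> (\<forall>\<sigma>. 0 \<le> \<mu> \<sigma>)"

text \<open>A layer-cake sum: every member of the chain gives its weight to each of its elements. Up
  to factors \<open>card \<sigma>\<close>, this turns weights at barycenters into coordinates of the
  original complex.\<close>

definition spread :: "('a set \<Rightarrow> real) \<Rightarrow> 'a \<Rightarrow> real" where
  "spread \<mu> v = (\<Sum>\<sigma> | \<mu> \<sigma> \<noteq> 0. if v \<in> \<sigma> then \<mu> \<sigma> else 0)"

lemma spread_superset:
  assumes "finite N" "{\<sigma>. \<mu> \<sigma> \<noteq> 0} \<subseteq> N"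
  shows "spread \<mu> v = (\<Sum>\<sigma>\<in>N. if v \<in> \<sigma> then \<mu> \<sigma> else 0)"
  unfolding spread_def using assms by (intro sum.mono_neutral_left) auto

lemma finite_chain_Union_mem:
  assumes "finite C" "C \<noteq> {}" "chain_subset C"
  shows "\<Union>C \<in> C"
  using assms
proof (induction C rule: finite_ne_induct)
  case (insert \<sigma> C)
  then have "\<Union>C \<in> C" by (auto simp: chain_subset_def)
  then have "\<sigma> \<subseteq> \<Union>C \<or> \<Union>C \<subseteq> \<sigma>" using insert.prems by (simp add: chain_subset_def)
  then have "\<Union>(insert \<sigma> C) = \<Union>C \<or> \<Union>(insert \<sigma> C) = \<sigma>" by auto
  with \<open>\<Union>C \<in> C\<close> show ?case by auto
qed simp

lemma spread_nonneg: "chain_weights \<mu> \<Longrightarrow> 0 \<le> spread \<mu> v"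
  unfolding spread_def chain_weights_def by (intro sum_nonneg) auto

lemma spread_nonzero_iff:
  assumes "chain_weights \<mu>"
  shows "spread \<mu> v \<noteq> 0 \<longleftrightarrow> v \<in> \<Union>{\<sigma>. \<mu> \<sigma> \<noteq> 0}"
proof -
  have \<mu>: "finite {\<sigma>. \<mu> \<sigma> \<noteq> 0}" "\<And>\<sigma>. 0 \<le> \<mu> \<sigma>" using assms by (auto simp: chain_weights_def)
  have "spread \<mu> v = 0 \<longleftrightarrow> (\<forall>\<sigma>\<in>{\<sigma>. \<mu> \<sigma> \<noteq> 0}. (if v \<in> \<sigma> then \<mu> \<sigma> else 0) = 0)"
    unfolding spread_def using \<mu> by (intro sum_nonneg_eq_0_iff) auto
  then show ?thesis by auto
qed

text \<open>The largest member of the chain, and its weight, can be read off from \<^term>\<open>spread \<mu>\<close>.\<close>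

lemma spread_top:
  assumes \<mu>: "chain_weights \<mu>" and ne: "{\<sigma>. \<mu> \<sigma> \<noteq> 0} \<noteq> {}" and M: "M = \<Union>{\<sigma>. \<mu> \<sigma> \<noteq> 0}"
  shows "\<mu> M \<noteq> 0" "\<forall>v\<in>M. \<mu> M \<le> spread \<mu> v" "\<exists>v\<in>M. spread \<mu> v = \<mu> M"
proof -
  let ?C = "{\<sigma>. \<mu> \<sigma> \<noteq> 0}"
  have fin: "finite ?C" and ch: "chain_subset ?C" and e: "\<mu> {} = 0" and pos: "\<And>\<sigma>. 0 \<le> \<mu> \<sigma>"
    using \<mu> by (auto simp: chain_weights_def)
  have MC: "M \<in> ?C" unfolding M using fin ne ch by (rule finite_chain_Union_mem)
  then show "\<mu> M \<noteq> 0" by simp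
  have split: "spread \<mu> v = \<mu> M + (\<Sum>\<sigma>\<in>?C - {M}. if v \<in> \<sigma> then \<mu> \<sigma> else 0)" if "v \<in> M" for v
    unfolding spread_def using sum.remove[OF fin MC, of "\<lambda>\<sigma>. if v \<in> \<sigma> then \<mu> \<sigma> else 0"] that by simp
  show "\<forall>v\<in>M. \<mu> M \<le> spread \<mu> v"
  proof
    fix v assume "v \<in> M"
    moreover have "0 \<le> (\<Sum>\<sigma>\<in>?C - {M}. if v \<in> \<sigma> then \<mu> \<sigma> else 0)"
      using pos by (intro sum_nonneg) auto
    ultimately show "\<mu> M \<le> spread \<mu> v" using split by simp
  qed
  have sub: "\<sigma> \<subseteq> M" if "\<sigma> \<in> ?C" for \<sigma> using that M by blast
  \<comment> \<open>The remaining chain has a largest member of its own, strictly inside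
    \<open>M\<close>, so some vertex of \<open>M\<close> receives weight from \<open>M\<close>
    only.\<close>
  have "\<Union>(?C - {M}) \<noteq> M"
  proof (cases "?C - {M} = {}")
    case True
    have "M \<noteq> {}" using MC e by auto
    with True show ?thesis by (metis Union_empty)
  next
    case False
    have "chain_subset (?C - {M})" using ch by (auto simp: chain_subset_def)
    then have "\<Union>(?C - {M}) \<in> ?C - {M}" using fin False by (intro finite_chain_Union_mem) auto
    then show ?thesis by blast
  qed
  moreover have "\<Union>(?C - {M}) \<subseteq> M" using sub by blast
  ultimately obtain v where v: "v \<in> M" "v \<notin> \<Union>(?C - {M})" by blast
  then have "(\<Sum>\<sigma>\<in>?C - {M}. if v \<in> \<sigma> then \<mu> \<sigma> else 0) = 0" by (intro sum.neutral) auto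
  with v(1) split[of v] show "\<exists>v\<in>M. spread \<mu> v = \<mu> M" by auto
qed

lemma chain_weights_remove:
  assumes "chain_weights \<mu>"
  shows "chain_weights (\<mu>(M := 0))" "\<mu> M \<noteq> 0 \<Longrightarrow> spread \<mu> v = spread (\<mu>(M := 0)) v + (if v \<in> M then \<mu> M else 0)"
proof -
  let ?C = "{\<sigma>. \<mu> \<sigma> \<noteq> 0}"
  have fin: "finite ?C" and ch: "chain_subset ?C" and e: "\<mu> {} = 0" and pos: "\<And>\<sigma>. 0 \<le> \<mu> \<sigma>"
    using assms by (auto simp: chain_weights_def)
  have C': "{\<sigma>. (\<mu>(M := 0)) \<sigma> \<noteq> 0} = ?C - {M}" by auto
  show "chain_weights (\<mu>(M := 0))"
    unfolding chain_weights_def C' using fin ch e pos by (auto simp: chain_subset_def)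
  assume "\<mu> M \<noteq> 0"
  then have MC: "M \<in> ?C" by simp
  have "spread (\<mu>(M := 0)) v = (\<Sum>\<sigma>\<in>?C - {M}. if v \<in> \<sigma> then \<mu> \<sigma> else 0)"
    unfolding spread_def C' by (intro sum.cong) auto
  then show "spread \<mu> v = spread (\<mu>(M := 0)) v + (if v \<in> M then \<mu> M else 0)"
    unfolding spread_def[of \<mu>] sum.remove[OF fin MC] by simp
qed

text \<open>Layers are peeled off from the top: the support of the spread is the largest member, the
  minimum on it is the weight of that member, and removing the same layer on both sides leaves equal
  spreads.\<close>

lemma spread_inject:
  assumes "chain_weights \<mu>" "chain_weights \<nu>" "spread \<mu> = spread \<nu>"
  shows "\<mu> = \<nu>"
  using assms
proof (induction "card {\<sigma>. \<mu> \<sigma> \<noteq> 0}" arbitrary: \<mu> \<nu>)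
  case 0
  have "{\<sigma>. \<mu> \<sigma> \<noteq> 0} = {}" using 0 by (auto simp: chain_weights_def)
  then have "spread \<nu> v = 0" for v
    using spread_nonzero_iff[OF 0(2), of v] 0(4) by simp
  then have e: "\<Union>{\<sigma>. \<nu> \<sigma> \<noteq> 0} = {}"
    using spread_nonzero_iff[OF 0(3)] by blast
  have "{\<sigma>. \<nu> \<sigma> \<noteq> 0} = {}"
  proof (rule ccontr)
    assume "{\<sigma>. \<nu> \<sigma> \<noteq> 0} \<noteq> {}"
    from spread_top(1)[OF 0(3) this refl] show False
      using 0(3) unfolding e by (simp add: chain_weights_def)
  qed
  with \<open>{\<sigma>. \<mu> \<sigma> \<noteq> 0} = {}\<close> show ?case by (auto simp: fun_eq_iff)
next
  case (Suc n)
  define M where "M = \<Union>{\<sigma>. \<mu> \<sigma> \<noteq> 0}"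
  have ne: "{\<sigma>. \<mu> \<sigma> \<noteq> 0} \<noteq> {}" using Suc.hyps(2) by (metis card.empty nat.simps(3))
  have M: "M = \<Union>{\<sigma>. \<nu> \<sigma> \<noteq> 0}"
  proof (intro equalityI subsetI)
    fix v
    show "v \<in> \<Union>{\<sigma>. \<nu> \<sigma> \<noteq> 0}" if "v \<in> M"
      using that unfolding M_def spread_nonzero_iff[OF Suc.prems(1), symmetric]
        spread_nonzero_iff[OF Suc.prems(2), symmetric] Suc.prems(3) .
    show "v \<in> M" if "v \<in> \<Union>{\<sigma>. \<nu> \<sigma> \<noteq> 0}"
      using that unfolding M_def spread_nonzero_iff[OF Suc.prems(1), symmetric]
        spread_nonzero_iff[OF Suc.prems(2), symmetric] Suc.prems(3) .
  qed
  note \<mu>M = spread_top[OF Suc.prems(1) ne M_def]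
  have "M \<noteq> {}" using \<mu>M(3) by blast
  then have ne': "{\<sigma>. \<nu> \<sigma> \<noteq> 0} \<noteq> {}" using M by auto
  note \<nu>M = spread_top[OF Suc.prems(2) ne' M]
  have eqM: "\<mu> M = \<nu> M"
  proof (rule antisym)
    obtain v where "v \<in> M" "spread \<nu> v = \<nu> M" using \<nu>M(3) by blast
    then show "\<mu> M \<le> \<nu> M" using \<mu>M(2) Suc.prems(3) by metis
    obtain v where "v \<in> M" "spread \<mu> v = \<mu> M" using \<mu>M(3) by blast
    then show "\<nu> M \<le> \<mu> M" using \<nu>M(2) Suc.prems(3) by metis
  qed
  have "\<mu>(M := 0) = \<nu>(M := 0)"
  proof (rule Suc.hyps(1))
    have "{\<sigma>. (\<mu>(M := 0)) \<sigma> \<noteq> 0} = {\<sigma>. \<mu> \<sigma> \<noteq> 0} - {M}" by auto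
    then show "n = card {\<sigma>. (\<mu>(M := 0)) \<sigma> \<noteq> 0}"
      using Suc.hyps(2) \<mu>M(1) by simp
    show "chain_weights (\<mu>(M := 0))" "chain_weights (\<nu>(M := 0))"
      by (rule chain_weights_remove(1)[OF Suc.prems(1)], rule chain_weights_remove(1)[OF Suc.prems(2)])
    show "spread (\<mu>(M := 0)) = spread (\<nu>(M := 0))"
    proof
      fix v
      show "spread (\<mu>(M := 0)) v = spread (\<nu>(M := 0)) v"
        using chain_weights_remove(2)[OF Suc.prems(1) \<mu>M(1), of v]
          chain_weights_remove(2)[OF Suc.prems(2) \<nu>M(1), of v] fun_cong[OF Suc.prems(3), of v]
        unfolding eqM by linarith
    qed
  qed
  then show ?case using eqM by (metis fun_upd_idem fun_upd_upd)
qed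

text \<open>Subtracting the minimum \<open>m\<close> on the support of \<open>l\<close> shrinks the
  support strictly. The old support contains all layers of the remainder, so it can be put on top of
  the chain with weight \<open>m\<close>.\<close>

lemma spread_exists:
  assumes "finite {v. l v \<noteq> 0}" "\<And>v. 0 \<le> l v"
  shows "\<exists>\<mu>. chain_weights \<mu> \<and> spread \<mu> = l"
  using assms
proof (induction "card {v. l v \<noteq> 0}" arbitrary: l rule: less_induct)
  case less
  let ?S = "{v. l v \<noteq> 0}"
  show ?case
  proof (cases "?S = {}")
    case True
    have "chain_weights (\<lambda>_. 0 :: real)" by (simp add: chain_weights_def chain_subset_def)
    moreover have "spread (\<lambda>_. 0) = l" using True by (auto simp: spread_def fun_eq_iff)
    ultimately show ?thesis by blast
  next
    case False
    define m where "m = Min (l ` ?S)"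
    have "m \<in> l ` ?S" unfolding m_def using less.prems False by (intro Min_in) auto
    then obtain t where t: "l t = m" "l t \<noteq> 0" by auto
    have m: "m \<le> l v" if "l v \<noteq> 0" for v unfolding m_def using that less.prems by simp
    have mpos: "m > 0" using t less.prems(2)[of t] by simp
    define \<kappa> where "\<kappa> v = l v - (if v \<in> ?S then m else 0)" for v
    have sub: "{v. \<kappa> v \<noteq> 0} \<subset> ?S" using t by (auto simp: \<kappa>_def)
    have "card {v. \<kappa> v \<noteq> 0} < card ?S" using less.prems(1) sub by (rule psubset_card_mono)
    moreover have "finite {v. \<kappa> v \<noteq> 0}" using sub less.prems(1) finite_subset by blast
    moreover have "0 \<le> \<kappa> v" for v using m[of v] by (simp add: \<kappa>_def)
    ultimately obtain \<mu> where \<mu>: "chain_weights \<mu>" "spread \<mu> = \<kappa>" using less.hyps by blast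
    have below: "\<sigma> \<subset> ?S" if "\<mu> \<sigma> \<noteq> 0" for \<sigma>
      using spread_nonzero_iff[OF \<mu>(1)] sub that unfolding \<mu>(2) by blast
    have \<mu>S: "\<mu> ?S = 0" using below by blast
    have C: "{\<sigma>. (\<mu>(?S := m)) \<sigma> \<noteq> 0} = insert ?S {\<sigma>. \<mu> \<sigma> \<noteq> 0}" using mpos by auto
    have "chain_subset (insert ?S {\<sigma>. \<mu> \<sigma> \<noteq> 0})"
      using \<mu>(1) below by (auto simp: chain_weights_def chain_subset_def)
    then have cw: "chain_weights (\<mu>(?S := m))"
      unfolding chain_weights_def C using \<mu>(1) mpos False by (simp add: chain_weights_def)
    have "spread (\<mu>(?S := m)) v = l v" for v
    proof -
      have "(\<mu>(?S := m)) ?S \<noteq> 0" using mpos by simp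
      from chain_weights_remove(2)[OF cw this, of v]
      have "spread (\<mu>(?S := m)) v = spread (\<mu>(?S := 0)) v + (if v \<in> ?S then m else 0)"
        by (simp only: fun_upd_upd fun_upd_same)
      also have "\<mu>(?S := 0) = \<mu>" using \<mu>S by (simp add: fun_upd_idem)
      also have "spread \<mu> v + (if v \<in> ?S then m else 0) = l v" by (simp add: \<mu>(2) \<kappa>_def)
      finally show ?thesis .
    qed
    then have "spread (\<mu>(?S := m)) = l" by (rule ext)
    with cw show ?thesis by (intro exI conjI)
  qed
qed

section \<open>The barycentric subdivision as a vertex scheme\<close>

context vertex_scheme begin

definition barycentric :: "'a set set" where
  "barycentric = {mean ` C | C. C \<subseteq> F - {{}} \<and> chain_subset C}"

lemma inj_on_mean: "inj_on mean (F - {{}})"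
proof (rule inj_on_inverseI)
  fix \<sigma> assume "\<sigma> \<in> F - {{}}"
  then show "{v. coord (mean \<sigma>) v \<noteq> 0} = \<sigma>"
    using finite_simplex[of \<sigma>] by (auto simp: coord_mean)
qed

text \<open>The amount that each vertex of \<open>\<sigma>\<close> receives when the weight at its
  barycenter is distributed evenly.\<close>

definition share :: "('a \<Rightarrow> real) \<Rightarrow> 'a set \<Rightarrow> real" where
  "share w \<sigma> = (if \<sigma> \<in> F - {{}} then w (mean \<sigma>) / real (card \<sigma>) else 0)"

text \<open>Double counting over pairs of a simplex and one of its vertices. It shows that passing
  from barycenters to vertices preserves both the total weight and the represented point.\<close>

lemma spread_sums:
  assumes "{\<sigma>. \<mu> \<sigma> \<noteq> 0} \<subseteq> F - {{}}"
  shows "sum (spread \<mu>) vertices = (\<Sum>\<sigma>\<in>F - {{}}. real (card \<sigma>) * \<mu> \<sigma>)"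
    and "(\<Sum>v\<in>vertices. spread \<mu> v *\<^sub>R v) = (\<Sum>\<sigma>\<in>F - {{}}. (real (card \<sigma>) * \<mu> \<sigma>) *\<^sub>R mean \<sigma>)"
proof -
  have spread: "spread \<mu> v = (\<Sum>\<sigma>\<in>F - {{}}. if v \<in> \<sigma> then \<mu> \<sigma> else 0)" for v
    using finite_F by (intro spread_superset assms) simp
  have sub: "\<sigma> \<subseteq> vertices" if "\<sigma> \<in> F - {{}}" for \<sigma> using that simplex_subset_vertices by blast
  have restrict: "(\<Sum>v\<in>vertices. if v \<in> \<sigma> then f v else 0) = sum f \<sigma>" if "\<sigma> \<in> F - {{}}"
    for \<sigma> and f :: "'a \<Rightarrow> 'b::comm_monoid_add"
    using sub[OF that] finite_vertices by (simp add: sum.inter_restrict[symmetric] Int_absorb1)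
  have "sum (spread \<mu>) vertices = (\<Sum>\<sigma>\<in>F - {{}}. \<Sum>v\<in>vertices. if v \<in> \<sigma> then \<mu> \<sigma> else 0)"
    unfolding spread by (rule sum.swap)
  also have "\<dots> = (\<Sum>\<sigma>\<in>F - {{}}. real (card \<sigma>) * \<mu> \<sigma>)"
    by (intro sum.cong) (simp_all add: restrict)
  finally show "sum (spread \<mu>) vertices = (\<Sum>\<sigma>\<in>F - {{}}. real (card \<sigma>) * \<mu> \<sigma>)" .
  have "(\<Sum>v\<in>vertices. spread \<mu> v *\<^sub>R v) = (\<Sum>v\<in>vertices. \<Sum>\<sigma>\<in>F - {{}}. if v \<in> \<sigma> then \<mu> \<sigma> *\<^sub>R v else 0)"
    unfolding spread scaleR_sum_left by (intro sum.cong) auto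
  also have "\<dots> = (\<Sum>\<sigma>\<in>F - {{}}. \<Sum>v\<in>vertices. if v \<in> \<sigma> then \<mu> \<sigma> *\<^sub>R v else 0)"
    by (rule sum.swap)
  also have "\<dots> = (\<Sum>\<sigma>\<in>F - {{}}. (real (card \<sigma>) * \<mu> \<sigma>) *\<^sub>R mean \<sigma>)"
  proof (rule sum.cong)
    fix \<sigma> assume \<sigma>: "\<sigma> \<in> F - {{}}"
    have "(\<Sum>v\<in>vertices. if v \<in> \<sigma> then \<mu> \<sigma> *\<^sub>R v else 0) = \<mu> \<sigma> *\<^sub>R (\<Sum>v\<in>\<sigma>. v)"
      using restrict[OF \<sigma>] by (simp add: scaleR_sum_right)
    also have "(\<Sum>v\<in>\<sigma>. v) = real (card \<sigma>) *\<^sub>R mean \<sigma>"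
      using \<sigma> finite_simplex by (simp add: card_scaleR_mean)
    finally show "(\<Sum>v\<in>vertices. if v \<in> \<sigma> then \<mu> \<sigma> *\<^sub>R v else 0) = (real (card \<sigma>) * \<mu> \<sigma>) *\<^sub>R mean \<sigma>"
      by (simp add: mult.commute)
  qed simp
  finally show "(\<Sum>v\<in>vertices. spread \<mu> v *\<^sub>R v) = (\<Sum>\<sigma>\<in>F - {{}}. (real (card \<sigma>) * \<mu> \<sigma>) *\<^sub>R mean \<sigma>)" .
qed

lemma card_mult_share: "\<sigma> \<in> F - {{}} \<Longrightarrow> real (card \<sigma>) * share w \<sigma> = w (mean \<sigma>)"
  using finite_simplex by (simp add: share_def)

text \<open>\<open>\<Union>C\<close> is the largest member of the chain, hence a simplex that
  carries all the shares; the spread consists of weights on it for the same point, so uniqueness of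
  coordinates applies.\<close>

lemma barycentric_weights:
  assumes C: "C \<subseteq> F - {{}}" "chain_subset C" and w: "weights (mean ` C) w"
  shows "chain_weights (share w)" "coord (\<Sum>b\<in>mean ` C. w b *\<^sub>R b) = spread (share w)"
    "(\<Sum>b\<in>mean ` C. w b *\<^sub>R b) \<in> convex hull (\<Union>C)" "\<Union>C \<in> F"
proof -
  let ?N = "F - {{}}"
  have fN: "finite ?N" and fC: "finite C" using finite_F C finite_subset by auto
  have share_C: "\<sigma> \<in> C" if "share w \<sigma> \<noteq> 0" for \<sigma>
  proof -
    have \<sigma>: "\<sigma> \<in> ?N" "w (mean \<sigma>) \<noteq> 0" using that by (auto simp: share_def split: if_splits)
    then have "mean \<sigma> \<in> mean ` C" using weightsD(2)[OF w] by blast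
    then show ?thesis using inj_on_image_mem_iff[OF inj_on_mean \<sigma>(1) C(1)] by simp
  qed
  have "{\<sigma>. share w \<sigma> \<noteq> 0} \<subseteq> C" using share_C by blast
  then have "finite {\<sigma>. share w \<sigma> \<noteq> 0}" using fC by (rule finite_subset)
  moreover have "share w {} = 0" by (simp add: share_def)
  moreover have "chain_subset {\<sigma>. share w \<sigma> \<noteq> 0}"
    using C(2) share_C unfolding chain_subset_def by blast
  moreover have "0 \<le> share w \<sigma>" for \<sigma> using weightsD(1)[OF w] by (simp add: share_def)
  ultimately show cw: "chain_weights (share w)"
    unfolding chain_weights_def by blast
  have "C \<noteq> {}" using w by (auto simp: weights_def)
  then have "\<Union>C \<in> C" using fC C(2) by (intro finite_chain_Union_mem)
  then show UF: "\<Union>C \<in> F" using C(1) by blast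
  have sub: "\<Union>C \<subseteq> vertices" using simplex_subset_vertices[OF UF] .
  have fm: "finite (mean ` ?N)" "mean ` C \<subseteq> mean ` ?N" using fN C(1) by auto
  have sh0: "{\<sigma>. share w \<sigma> \<noteq> 0} \<subseteq> ?N" using share_C C(1) by blast
  have "sum (spread (share w)) vertices = (\<Sum>\<sigma>\<in>?N. w (mean \<sigma>))"
    unfolding spread_sums(1)[OF sh0] by (intro sum.cong) (simp_all add: card_mult_share)
  also have "\<dots> = sum w (mean ` ?N)" by (simp add: sum.reindex[OF inj_on_mean])
  also have "\<dots> = 1" using weights_sum_superset(1)[OF w fm(2,1)] .
  finally have 1: "sum (spread (share w)) vertices = 1" .
  have "(\<Sum>v\<in>vertices. spread (share w) v *\<^sub>R v) = (\<Sum>\<sigma>\<in>?N. w (mean \<sigma>) *\<^sub>R mean \<sigma>)"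
    unfolding spread_sums(2)[OF sh0] by (intro sum.cong) (simp_all add: card_mult_share)
  also have "\<dots> = (\<Sum>b\<in>mean ` ?N. w b *\<^sub>R b)" by (simp add: sum.reindex[OF inj_on_mean])
  also have "\<dots> = (\<Sum>b\<in>mean ` C. w b *\<^sub>R b)" using weights_sum_superset(2)[OF w fm(2,1)] .
  finally have 2: "(\<Sum>v\<in>vertices. spread (share w) v *\<^sub>R v) = (\<Sum>b\<in>mean ` C. w b *\<^sub>R b)" .
  have zero: "spread (share w) v = 0" if "v \<notin> \<Union>C" for v
    using spread_nonzero_iff[OF cw, of v] share_C that by blast
  have W: "weights (\<Union>C) (spread (share w))"
    by (rule weightsI_superset(1)[OF finite_vertices sub spread_nonneg[OF cw] zero 1])
  have W2: "(\<Sum>v\<in>\<Union>C. spread (share w) v *\<^sub>R v) = (\<Sum>b\<in>mean ` C. w b *\<^sub>R b)"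
    unfolding 2[symmetric]
    by (rule weightsI_superset(2)[OF finite_vertices sub spread_nonneg[OF cw] zero 1])
  show "coord (\<Sum>b\<in>mean ` C. w b *\<^sub>R b) = spread (share w)"
    by (rule coord_eqI[OF UF W W2[symmetric]])
  show "(\<Sum>b\<in>mean ` C. w b *\<^sub>R b) \<in> convex hull (\<Union>C)"
    using weights_in_realization(1)[OF UF W] unfolding W2 .
qed

lemma barycentric_weights_exist:
  assumes x: "x \<in> realization"
  obtains C w where "C \<subseteq> F - {{}}" "chain_subset C" "weights (mean ` C) w" "x = (\<Sum>b\<in>mean ` C. w b *\<^sub>R b)"
proof -
  let ?N = "F - {{}}"
  note s = coord_support[OF x]
  have "finite {v. coord x v \<noteq> 0}" using finite_simplex[OF s(1)] .
  then obtain \<mu> where \<mu>: "chain_weights \<mu>" "spread \<mu> = coord x"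
    using spread_exists[of "coord x"] coord_nonneg by blast
  let ?C = "{\<sigma>. \<mu> \<sigma> \<noteq> 0}"
  have CN: "?C \<subseteq> ?N"
  proof
    fix \<sigma> assume \<sigma>: "\<sigma> \<in> ?C"
    then have "\<sigma> \<subseteq> {v. coord x v \<noteq> 0}" using spread_nonzero_iff[OF \<mu>(1)] \<mu>(2) by auto
    then have "\<sigma> \<in> F" by (rule down_closed[OF s(1)])
    with \<sigma> \<mu>(1) show "\<sigma> \<in> ?N" by (auto simp: chain_weights_def)
  qed
  \<comment> \<open>Summing over all simplices avoids choosing a preimage of \<open>b\<close>;
    injectivity of \<open>mean\<close> leaves at most one term.\<close>
  define w where "w b = (\<Sum>\<sigma>\<in>?N. if mean \<sigma> = b then real (card \<sigma>) * \<mu> \<sigma> else 0)" for b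
  have fN: "finite ?N" using finite_F by simp
  have \<mu>pos: "0 \<le> \<mu> \<sigma>" for \<sigma> using \<mu>(1) by (simp add: chain_weights_def)
  have w_mean: "w (mean \<sigma>) = real (card \<sigma>) * \<mu> \<sigma>" if "\<sigma> \<in> ?N" for \<sigma>
  proof -
    have "w (mean \<sigma>) = (\<Sum>\<tau>\<in>?N. if \<tau> = \<sigma> then real (card \<tau>) * \<mu> \<tau> else 0)"
      unfolding w_def using inj_onD[OF inj_on_mean] that by (intro sum.cong) auto
    then show ?thesis using fN that by simp
  qed
  have "sum w (mean ` ?N) = (\<Sum>\<sigma>\<in>?N. real (card \<sigma>) * \<mu> \<sigma>)"
    unfolding sum.reindex[OF inj_on_mean] by (intro sum.cong) (simp_all add: w_mean)
  also have "\<dots> = 1" using spread_sums(1)[OF CN] \<mu>(2) sum_coord(1)[OF x] by simp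
  finally have 1: "sum w (mean ` ?N) = 1" .
  have "(\<Sum>b\<in>mean ` ?N. w b *\<^sub>R b) = (\<Sum>\<sigma>\<in>?N. (real (card \<sigma>) * \<mu> \<sigma>) *\<^sub>R mean \<sigma>)"
    unfolding sum.reindex[OF inj_on_mean] by (intro sum.cong) (simp_all add: w_mean)
  also have "\<dots> = x" using spread_sums(2)[OF CN] \<mu>(2) sum_coord(2)[OF x] by simp
  finally have 2: "(\<Sum>b\<in>mean ` ?N. w b *\<^sub>R b) = x" .
  have sub: "mean ` ?C \<subseteq> mean ` ?N" using CN by (rule image_mono)
  have pos: "0 \<le> w b" for b unfolding w_def using \<mu>pos by (intro sum_nonneg) auto
  have zero: "w b = 0" if "b \<notin> mean ` ?C" for b
    unfolding w_def using that by (intro sum.neutral) auto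
  show thesis
  proof (rule that[OF CN])
    show "chain_subset ?C" using \<mu>(1) by (simp add: chain_weights_def)
    show "weights (mean ` ?C) w"
      by (rule weightsI_superset(1)[OF finite_imageI[OF fN] sub pos zero 1])
    show "x = (\<Sum>b\<in>mean ` ?C. w b *\<^sub>R b)"
      unfolding 2[symmetric]
      by (rule weightsI_superset(2)[OF finite_imageI[OF fN] sub pos zero 1, symmetric])
  qed
qed

lemma barycentricE:
  assumes "\<tau> \<in> barycentric"
  obtains C where "C \<subseteq> F - {{}}" "chain_subset C" "\<tau> = mean ` C"
  using assms by (auto simp: barycentric_def)

text \<open>Equal points have equal coordinates, so equal spreads, so equal shares by injectivity of
  \<open>spread\<close>; this fixes the weight at every barycenter.\<close>

lemma vertex_scheme_barycentric: "vertex_scheme barycentric"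
proof
  show "finite barycentric"
  proof (rule finite_subset)
    show "barycentric \<subseteq> (`) mean ` Pow (F - {{}})" by (auto simp: barycentric_def)
    show "finite ((`) mean ` Pow (F - {{}}))" using finite_F by simp
  qed
  show "finite \<tau>" if "\<tau> \<in> barycentric" for \<tau>
    using that finite_F by (auto simp: barycentric_def intro: finite_subset)
  show "\<rho> \<in> barycentric" if \<tau>: "\<tau> \<in> barycentric" and sub: "\<rho> \<subseteq> \<tau>" for \<tau> \<rho>
  proof -
    obtain C where C: "C \<subseteq> F - {{}}" "chain_subset C" "\<tau> = mean ` C" using \<tau> by (rule barycentricE)
    then obtain D where "D \<subseteq> C" "\<rho> = mean ` D" using sub by (metis subset_imageE)
    with C show ?thesis unfolding barycentric_def chain_subset_def by blast
  qed
  show "w = w'" if \<sigma>: "\<sigma> \<in> barycentric" and \<tau>: "\<tau> \<in> barycentric" and w: "weights \<sigma> w" and w': "weights \<tau> w'"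
    and eq: "(\<Sum>v\<in>\<sigma>. w v *\<^sub>R v) = (\<Sum>v\<in>\<tau>. w' v *\<^sub>R v)" for \<sigma> \<tau> w w'
  proof -
    obtain C where C: "C \<subseteq> F - {{}}" "chain_subset C" "\<sigma> = mean ` C" using \<sigma> by (rule barycentricE)
    obtain D where D: "D \<subseteq> F - {{}}" "chain_subset D" "\<tau> = mean ` D" using \<tau> by (rule barycentricE)
    note wC = barycentric_weights[OF C(1,2) w[unfolded C(3)]]
    note wD = barycentric_weights[OF D(1,2) w'[unfolded D(3)]]
    have "spread (share w) = spread (share w')" using wC(2) wD(2) eq C(3) D(3) by simp
    then have share: "share w = share w'" using spread_inject wC(1) wD(1) by blast
    show "w = w'"
    proof
      fix b
      show "w b = w' b"
      proof (cases "b \<in> mean ` (F - {{}})")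
        case True
        then obtain \<sigma> where "\<sigma> \<in> F - {{}}" "b = mean \<sigma>" by blast
        then show ?thesis using card_mult_share[of \<sigma> w] card_mult_share[of \<sigma> w'] share by simp
      next
        case False
        then have "b \<notin> \<sigma>" "b \<notin> \<tau>" using C D by blast+
        then show ?thesis using weightsD(2)[OF w] weightsD(2)[OF w'] by simp
      qed
    qed
  qed
qed

end

section \<open>The supplement of the zero set\<close>

context vertex_scheme begin

lemma convex_hull_subset_iff:
  assumes "\<sigma> \<in> F" "\<tau> \<in> F"
  shows "convex hull \<sigma> \<subseteq> convex hull \<tau> \<longleftrightarrow> \<sigma> \<subseteq> \<tau>"
proof
  assume sub: "convex hull \<sigma> \<subseteq> convex hull \<tau>"
  show "\<sigma> \<subseteq> \<tau>"
  proof
    fix v assume v: "v \<in> \<sigma>"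
    then have vv: "v \<in> vertices" using assms(1) by (auto simp: vertices_def)
    have "v \<in> convex hull \<tau>" using v sub hull_inc[of v \<sigma> convex] by blast
    then have "{w. coord v w \<noteq> 0} \<subseteq> \<tau>"
      using in_convex_hull_iff[OF assms(2) vertex_in_realization[OF vv]] by blast
    then show "v \<in> \<tau>" using coord_vertex[OF vv] by auto
  qed
qed (rule hull_mono)

lemma barycenter_convex_hull: "\<sigma> \<in> F \<Longrightarrow> barycenter (convex hull \<sigma>) = mean \<sigma>"
  by (simp add: barycenter_def mean_def simplex_vertices_convex_hull)

text \<open>Translates chains of convex sets into chains of vertex sets. A general \<open>Z\<close>
  covers the full complex and the zero subcomplex at once.\<close>

lemma barycentric_subdivision_image:
  assumes "Z \<subseteq> F"
  shows "barycentric_subdivision ((\<lambda>\<sigma>. convex hull \<sigma>) ` Z) =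
    {convex hull (mean ` C) | C. C \<subseteq> Z - {{}} \<and> chain_subset C}"
proof -
  have sub: "C \<subseteq> F" if "C \<subseteq> Z - {{}}" for C using that assms by blast
  have mean: "barycenter ` (\<lambda>\<sigma>. convex hull \<sigma>) ` C = mean ` C" if "C \<subseteq> Z - {{}}" for C
    using sub[OF that] barycenter_convex_hull by (force simp: image_image)
  have chain: "chain_subset ((\<lambda>\<sigma>. convex hull \<sigma>) ` C) \<longleftrightarrow> chain_subset C" if "C \<subseteq> Z - {{}}" for C
  proof -
    have "convex hull \<sigma> \<subseteq> convex hull \<tau> \<longleftrightarrow> \<sigma> \<subseteq> \<tau>" if "\<sigma> \<in> C" "\<tau> \<in> C" for \<sigma> \<tau>
      using that sub[OF \<open>C \<subseteq> Z - {{}}\<close>] convex_hull_subset_iff by blast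
    then show ?thesis by (simp add: chain_subset_def)
  qed
  have ex: "\<exists>C \<subseteq> Z - {{}}. \<C> = (\<lambda>\<sigma>. convex hull \<sigma>) ` C"
    if sub: "\<C> \<subseteq> (\<lambda>\<sigma>. convex hull \<sigma>) ` Z - {{}}" for \<C>
  proof -
    have "\<C> \<subseteq> (\<lambda>\<sigma>. convex hull \<sigma>) ` (Z - {{}})"
    proof
      fix S assume "S \<in> \<C>"
      then obtain \<sigma> where \<sigma>: "\<sigma> \<in> Z" "S = convex hull \<sigma>" "S \<noteq> {}" using sub by blast
      then have "\<sigma> \<in> Z - {{}}" by auto
      then show "S \<in> (\<lambda>\<sigma>. convex hull \<sigma>) ` (Z - {{}})" unfolding \<sigma>(2) by (rule imageI)
    qed
    then show ?thesis by (metis subset_imageE)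
  qed
  have img: "(\<lambda>\<sigma>. convex hull \<sigma>) ` C \<subseteq> (\<lambda>\<sigma>. convex hull \<sigma>) ` Z - {{}}" if "C \<subseteq> Z - {{}}" for C
    using that by auto
  show ?thesis
  proof (intro equalityI subsetI)
    fix S assume "S \<in> barycentric_subdivision ((\<lambda>\<sigma>. convex hull \<sigma>) ` Z)"
    then obtain \<C> where \<C>: "S = convex hull (barycenter ` \<C>)"
      "\<C> \<subseteq> (\<lambda>\<sigma>. convex hull \<sigma>) ` Z - {{}}" "chain_subset \<C>"
      unfolding barycentric_subdivision_def by blast
    obtain C where C: "C \<subseteq> Z - {{}}" "\<C> = (\<lambda>\<sigma>. convex hull \<sigma>) ` C" using ex[OF \<C>(2)] by blast
    have "S = convex hull (mean ` C)" "chain_subset C"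
      using \<C>(1,3) chain[OF C(1)] mean[OF C(1)] unfolding C(2) by simp_all
    with C(1) show "S \<in> {convex hull (mean ` C) | C. C \<subseteq> Z - {{}} \<and> chain_subset C}" by blast
  next
    fix S assume "S \<in> {convex hull (mean ` C) | C. C \<subseteq> Z - {{}} \<and> chain_subset C}"
    then obtain C where C: "S = convex hull (mean ` C)" "C \<subseteq> Z - {{}}" "chain_subset C" by blast
    show "S \<in> barycentric_subdivision ((\<lambda>\<sigma>. convex hull \<sigma>) ` Z)"
      unfolding barycentric_subdivision_def
    proof (intro CollectI exI conjI)
      show "S = convex hull (barycenter ` (\<lambda>\<sigma>. convex hull \<sigma>) ` C)"
        unfolding mean[OF C(2)] by (rule C(1))
      show "chain_subset ((\<lambda>\<sigma>. convex hull \<sigma>) ` C)" unfolding chain[OF C(2)] by (rule C(3))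
    qed (rule img[OF C(2)])
  qed
qed

lemma barycentric_subdivision_simplices:
  "barycentric_subdivision simplices = (\<lambda>\<tau>. convex hull \<tau>) ` barycentric"
  unfolding simplices_def barycentric_subdivision_image[OF subset_refl] barycentric_def by blast

lemma complex_vertices_barycentric_subdivision:
  assumes "Z \<subseteq> F"
  shows "complex_vertices (barycentric_subdivision ((\<lambda>\<sigma>. convex hull \<sigma>) ` Z)) = mean ` (Z - {{}})"
proof (intro equalityI subsetI)
  fix v assume "v \<in> complex_vertices (barycentric_subdivision ((\<lambda>\<sigma>. convex hull \<sigma>) ` Z))"
  then obtain C where C: "{v} = convex hull (mean ` C)" "C \<subseteq> Z - {{}}"
    unfolding complex_vertices_def barycentric_subdivision_image[OF assms] by blast
  then have "C \<noteq> {}" by auto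
  then obtain \<sigma> where \<sigma>: "\<sigma> \<in> C" by blast
  then have "mean \<sigma> \<in> {v}" unfolding C(1) by (intro hull_inc imageI)
  with \<sigma> C(2) show "v \<in> mean ` (Z - {{}})" by blast
next
  fix v assume "v \<in> mean ` (Z - {{}})"
  then obtain \<sigma> where \<sigma>: "\<sigma> \<in> Z - {{}}" "v = mean \<sigma>" by blast
  then have "{v} = convex hull (mean ` {\<sigma>})" "{\<sigma>} \<subseteq> Z - {{}}" "chain_subset {\<sigma>}"
    by (auto simp: chain_subset_def)
  then show "v \<in> complex_vertices (barycentric_subdivision ((\<lambda>\<sigma>. convex hull \<sigma>) ` Z))"
    unfolding complex_vertices_def barycentric_subdivision_image[OF assms] by blast
qed

lemma barycentric_realization: "vertex_scheme.realization barycentric = realization"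
proof -
  interpret B: vertex_scheme barycentric by (rule vertex_scheme_barycentric)
  show ?thesis
  proof (intro equalityI subsetI)
    fix x assume x: "x \<in> B.realization"
    obtain C where C: "C \<subseteq> F - {{}}" "chain_subset C" "{v. B.coord x v \<noteq> 0} = mean ` C"
      by (rule barycentricE[OF B.coord_support(1)[OF x]])
    have "x \<in> convex hull (\<Union>C)" "\<Union>C \<in> F"
      using barycentric_weights(3,4)[OF C(1,2)] B.coord_support(3,4)[OF x] unfolding C(3) by metis+
    then show "x \<in> realization" by (auto simp: realization_def)
  next
    fix x assume "x \<in> realization"
    then obtain C w where C: "C \<subseteq> F - {{}}" "chain_subset C" and w: "weights (mean ` C) w"
      "x = (\<Sum>b\<in>mean ` C. w b *\<^sub>R b)" by (rule barycentric_weights_exist)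
    have "mean ` C \<in> barycentric" using C by (auto simp: barycentric_def)
    then show "x \<in> B.realization" using B.weights_in_realization(2)[OF _ w(1)] w(2) by simp
  qed
qed

text \<open>Each simplex of the subdivision lies in the top simplex of its chain, where
  \<open>f\<close> is already affine.\<close>

lemma linearizes_barycentric:
  assumes "linearizes simplices f"
  shows "linearizes (vertex_scheme.simplices barycentric) f"
proof -
  interpret B: vertex_scheme barycentric by (rule vertex_scheme_barycentric)
  show ?thesis
    unfolding linearizes_def
  proof
    fix S assume "S \<in> B.simplices"
    then obtain \<tau> where \<tau>: "\<tau> \<in> barycentric" "S = convex hull \<tau>"
      unfolding B.simplices_def by (rule imageE)
    obtain C where C: "C \<subseteq> F - {{}}" "chain_subset C" "\<tau> = mean ` C"
      by (rule barycentricE[OF \<tau>(1)])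
    show "\<exists>g. affine_linear g \<and> (\<forall>x\<in>S. f x = g x)"
    proof (cases "C = {}")
      case True
      with affine_linear_zero C(3) \<tau>(2) show ?thesis by auto
    next
      case False
      have "finite C" by (rule finite_subset[OF C(1)]) (use finite_F in simp)
      then have "\<Union>C \<in> C" using False C(2) by (rule finite_chain_Union_mem)
      then have U: "\<Union>C \<in> F" using C(1) by blast
      have "mean \<sigma> \<in> convex hull (\<Union>C)" if "\<sigma> \<in> C" for \<sigma>
      proof -
        have "mean \<sigma> \<in> convex hull \<sigma>" using that C(1) by (intro coord_mean(2)) auto
        then show ?thesis using hull_mono[of \<sigma> "\<Union>C" convex] that by blast
      qed
      then have "S \<subseteq> convex hull (\<Union>C)" unfolding \<tau>(2) C(3) by (intro hull_minimal) auto
      moreover obtain g where "affine_linear g" "\<forall>x\<in>convex hull (\<Union>C). f x = g x"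
        using assms U unfolding linearizes_def simplices_def ball_simps by blast
      ultimately show ?thesis by blast
    qed
  qed
qed

text \<open>At the barycenter \<open>f\<close> is a combination of its nonnegative vertex values
  with strictly positive coefficients. Hence the vertices of the subdivision where \<open>f\<close>
  vanishes are exactly the barycenters of zero simplices.\<close>

lemma zero_on_simplex_iff:
  assumes f: "linearizes simplices f" "\<forall>x\<in>realization. 0 \<le> f x" and \<sigma>: "\<sigma> \<in> F" "\<sigma> \<noteq> {}"
  shows "f (mean \<sigma>) = 0 \<longleftrightarrow> (\<forall>x\<in>convex hull \<sigma>. f x = 0)"
proof
  assume "\<forall>x\<in>convex hull \<sigma>. f x = 0"
  then show "f (mean \<sigma>) = 0" using coord_mean(2)[OF \<sigma>] by blast
next
  assume 0: "f (mean \<sigma>) = 0"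
  have R: "convex hull \<sigma> \<subseteq> realization" using \<sigma>(1) by (auto simp: realization_def)
  have f_pl: "f x = (\<Sum>v\<in>vertices. coord x v * f v)" if "x \<in> convex hull \<sigma>" for x
    using linearizes_imp_pl[OF f(1)] R that unfolding pl_def by blast
  have "(\<Sum>v\<in>vertices. coord (mean \<sigma>) v * f v) = 0"
    using f_pl[OF coord_mean(2)[OF \<sigma>]] 0 by simp
  then have zero: "\<forall>v\<in>vertices. coord (mean \<sigma>) v * f v = 0"
    using f(2) vertex_in_realization coord_nonneg finite_vertices
    by (subst (asm) sum_nonneg_eq_0_iff) (simp_all add: mult_nonneg_nonneg)
  have fv: "f v = 0" if "v \<in> \<sigma>" for v
  proof -
    have "coord (mean \<sigma>) v \<noteq> 0" using that \<sigma> finite_simplex[OF \<sigma>(1)] by (auto simp: coord_mean)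
    then show ?thesis using zero that simplex_subset_vertices[OF \<sigma>(1)] by auto
  qed
  show "\<forall>x\<in>convex hull \<sigma>. f x = 0"
  proof
    fix x assume x: "x \<in> convex hull \<sigma>"
    have "coord x v * f v = 0" for v
      using weightsD(2)[OF coord_simplex(1)[OF \<sigma>(1) x], of v] fv[of v] by (cases "v \<in> \<sigma>") simp_all
    then show "f x = 0" unfolding f_pl[OF x] by (rule sum.neutral[OF ballI])
  qed
qed

text \<open>In the barycentric subdivision the support consists of the points with a nonzero
  coordinate at some vertex where \<open>f\<close> is positive, and the supplement is spanned by
  just these vertices; the retraction away from \<open>V\<^sub>0\<close> links the two.\<close>

theorem euler_char_supp_eq_supplement:
  assumes f: "linearizes simplices f" "\<forall>x\<in>realization. 0 \<le> f x"
  shows "euler_char (supp realization f) =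
    polyhedron_euler_char (\<Union>(supplement (zero_subcomplex simplices f) simplices))"
proof -
  interpret B: vertex_scheme barycentric by (rule vertex_scheme_barycentric)
  define Z where "Z = {\<sigma> \<in> F. \<forall>x\<in>convex hull \<sigma>. f x = 0}"
  define V\<^sub>0 where "V\<^sub>0 = mean ` (Z - {{}})"
  have ZF: "Z \<subseteq> F" by (auto simp: Z_def)
  interpret N: vertex_scheme "{\<tau> \<in> barycentric. \<tau> \<inter> V\<^sub>0 = {}}" by (rule B.vertex_scheme_avoiding)
  have Z: "zero_subcomplex simplices f = (\<lambda>\<sigma>. convex hull \<sigma>) ` Z"
    by (auto simp: zero_subcomplex_def simplices_def Z_def)
  have supplement: "supplement (zero_subcomplex simplices f) simplices = N.simplices"
    unfolding supplement_def Z complex_vertices_barycentric_subdivision[OF ZF] V\<^sub>0_def[symmetric]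
      barycentric_subdivision_simplices N.simplices_def
    using B.simplex_vertices_convex_hull by auto
  have B_pl: "f x = (\<Sum>b\<in>B.vertices. B.coord x b * f b)" if "x \<in> realization" for x
    using B.linearizes_imp_pl[OF linearizes_barycentric[OF f(1)]] that
    unfolding B.pl_def barycentric_realization by blast
  have fb: "0 \<le> f b" if "b \<in> B.vertices" for b
    using f(2) B.vertex_in_realization[OF that] unfolding barycentric_realization by blast
  have V0: "b \<in> V\<^sub>0 \<longleftrightarrow> f b = 0" if "b \<in> B.vertices" for b
  proof -
    have "{b} \<in> barycentric" using that by (simp add: B.vertex_iff)
    then obtain C where "C \<subseteq> F - {{}}" "{b} = mean ` C" by (rule barycentricE)
    then obtain \<sigma> where \<sigma>: "\<sigma> \<in> F - {{}}" "b = mean \<sigma>" by blast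
    have "b \<in> V\<^sub>0 \<longleftrightarrow> \<sigma> \<in> Z - {{}}"
      unfolding V\<^sub>0_def \<sigma>(2) by (rule inj_on_image_mem_iff[OF inj_on_mean \<sigma>(1)]) (use ZF in blast)
    also have "\<dots> \<longleftrightarrow> f b = 0"
      using zero_on_simplex_iff[OF f, of \<sigma>] \<sigma> by (auto simp: Z_def)
    finally show ?thesis .
  qed
  have "supp realization f = {x. \<exists>b. b \<notin> V\<^sub>0 \<and> B.coord x b \<noteq> 0}"
  proof (rule Set.set_eqI)
    fix x
    have "x \<in> supp realization f \<longleftrightarrow> x \<in> realization \<and> (\<Sum>b\<in>B.vertices. B.coord x b * f b) \<noteq> 0"
      using B_pl by (auto simp: supp_def)
    also have "\<dots> \<longleftrightarrow> x \<in> realization \<and> (\<exists>b\<in>B.vertices. B.coord x b * f b \<noteq> 0)"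
      using B.finite_vertices B.coord_nonneg fb
      by (subst sum_nonneg_eq_0_iff) (auto intro!: mult_nonneg_nonneg)
    also have "\<dots> \<longleftrightarrow> x \<in> {x. \<exists>b. b \<notin> V\<^sub>0 \<and> B.coord x b \<noteq> 0}"
    proof -
      have "x \<in> realization" "b \<in> B.vertices" if "B.coord x b \<noteq> 0" for b
        using that B.coord_not_vertex[of b x] B.coord_outside[of x b]
        unfolding barycentric_realization by blast+
      then show ?thesis using V0 by auto
    qed
    finally show "x \<in> supp realization f \<longleftrightarrow> x \<in> {x. \<exists>b. b \<notin> V\<^sub>0 \<and> B.coord x b \<noteq> 0}" .
  qed
  then have "euler_char (supp realization f) = euler_char N.realization"
    using euler_char_homotopy_eqv(1)[OF B.homotopy_eqv_avoiding[of V\<^sub>0]] unfolding N.realization_def by simp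
  also have "\<dots> = polyhedron_euler_char (\<Union>N.simplices)"
    unfolding N.Union_simplices by (rule polyhedron_euler_char_eq[OF N.triangulates_realization, symmetric])
  finally show ?thesis unfolding supplement .
qed

end

section \<open>Piecewise linear functions and pc-valuations\<close>

lemma affine_linear_inner:
  assumes "affine_linear (g :: 'a::euclidean_space \<Rightarrow> real)"
  obtains a b where "g = (\<lambda>x. a \<bullet> x - b)"
proof -
  obtain l c where l: "linear l" "g = (\<lambda>x. l x + c)" using assms by (auto simp: affine_linear_def)
  have "l x = (\<Sum>i\<in>Basis. l i *\<^sub>R i) \<bullet> x" for x
  proof -
    have "l x = l (\<Sum>i\<in>Basis. (x \<bullet> i) *\<^sub>R i)" by (simp add: euclidean_representation)
    also have "\<dots> = (\<Sum>i\<in>Basis. (x \<bullet> i) * l i)" using l(1) by (simp add: linear_sum linear_scale)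
    also have "\<dots> = (\<Sum>i\<in>Basis. l i *\<^sub>R i) \<bullet> x"
      unfolding inner_sum_left inner_scaleR_left by (intro sum.cong) (simp_all add: inner_commute)
    finally show ?thesis .
  qed
  then have "g x = (\<Sum>i\<in>Basis. l i *\<^sub>R i) \<bullet> x - (- c)" for x
    unfolding l(2) by (metis diff_minus_eq_add)
  then show thesis by (intro that ext)
qed

lemma affine_linear_add:
  assumes "affine_linear f" "affine_linear g" shows "affine_linear (\<lambda>x. f x + g x)"
proof -
  obtain l c m d where "linear l" "f = (\<lambda>x. l x + c)" "linear m" "g = (\<lambda>x. m x + d)"
    using assms unfolding affine_linear_def by blast
  then show ?thesis
    unfolding affine_linear_def
    by (intro exI[of _ "\<lambda>x. l x + m x"] exI[of _ "c + d"]) (auto simp: linear_compose_add)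
qed

lemma affine_linear_scale:
  assumes "affine_linear f" shows "affine_linear (\<lambda>x. r * f x)"
proof -
  obtain l c where "linear l" "f = (\<lambda>x. l x + c)" using assms unfolding affine_linear_def by blast
  then show ?thesis
    unfolding affine_linear_def
    by (intro exI[of _ "\<lambda>x. r * l x"] exI[of _ "r * c"])
       (auto simp: distrib_left intro: linear_compose_scale_right[of l r, simplified])
qed

lemma affine_linear_diff:
  assumes "affine_linear f" "affine_linear g" shows "affine_linear (\<lambda>x. f x - g x)"
  using affine_linear_add[OF assms(1) affine_linear_scale[OF assms(2), of "-1"]] by simp

text \<open>The segment from \<open>x\<close> to the relative interior point \<open>z\<close> can be
  prolonged beyond \<open>z\<close> inside \<open>C\<close>; there \<open>h\<close> would be
  negative if it were positive at \<open>x\<close>.\<close>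

lemma affine_linear_vanishes:
  assumes h: "affine_linear (h :: 'a::euclidean_space \<Rightarrow> real)" and C: "convex C" "z \<in> rel_interior C"
    and pos: "\<forall>x\<in>C. 0 \<le> h x" and z: "h z = 0" and x: "x \<in> C"
  shows "h x = 0"
proof -
  have "C \<noteq> {}" using x by blast
  then obtain e where e: "e > 1" "(1 - e) *\<^sub>R x + e *\<^sub>R z \<in> C"
    using convex_rel_interior_iff[OF C(1), of z] C(2) x by blast
  obtain l c where l: "linear l" "h = (\<lambda>x. l x + c)" using h by (auto simp: affine_linear_def)
  have "h ((1 - e) *\<^sub>R x + e *\<^sub>R z) = (1 - e) * l x + e * l z + c"
    unfolding l(2) by (simp add: linear_add[OF l(1)] linear_scale[OF l(1)])
  also have "\<dots> = (1 - e) * h x + e * h z"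
    unfolding l(2) by (simp add: algebra_simps)
  finally have "h ((1 - e) *\<^sub>R x + e *\<^sub>R z) = (1 - e) * h x + e * h z" .
  then have "0 \<le> (1 - e) * h x" using pos e(2) z by fastforce
  moreover have "0 \<le> h x" using pos x by blast
  ultimately show ?thesis using e(1) by (smt (verit) mult_neg_pos)
qed

text \<open>
  Two affine pieces that agree at one relative interior point of the cell agree on the whole cell, so
  the sets where \<open>f\<close> coincides with the distinct pieces form a finite closed partition of the
  connected relative interior.
\<close>

lemma piecewise_affine_on_cell:
  fixes f :: "'a::euclidean_space \<Rightarrow> real"
  assumes C: "convex C" and f: "continuous_on C f" and F: "finite F" "\<forall>g\<in>F. affine_linear g"
    and pw: "\<forall>x\<in>C. \<exists>g\<in>F. f x = g x"
    and ord: "\<And>g h. g \<in> F \<Longrightarrow> h \<in> F \<Longrightarrow> (\<forall>x\<in>C. g x \<le> h x) \<or> (\<forall>x\<in>C. h x \<le> g x)"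
  obtains g where "affine_linear g" "\<forall>x\<in>C. f x = g x"
proof (cases "C = {}")
  case True
  with affine_linear_zero show thesis using that by auto
next
  case False
  let ?R = "rel_interior C"
  have RC: "?R \<subseteq> C" by (rule rel_interior_subset)
  obtain z where z: "z \<in> ?R" using False C rel_interior_eq_empty by blast
  obtain g where g: "g \<in> F" "f z = g z" using pw z RC by blast
  \<comment> \<open>By \<open>ord\<close> the difference of the two pieces has one sign on the cell,
    so a zero in the relative interior makes it vanish identically.\<close>
  have eq: "\<forall>x\<in>C. h x = g x" if h: "h \<in> F" and y: "y \<in> ?R" "h y = g y" for h y
  proof -
    have "affine_linear (\<lambda>x. h x - g x)" "affine_linear (\<lambda>x. g x - h x)"
      using F(2) g(1) h by (auto intro: affine_linear_diff)
    note v = affine_linear_vanishes[OF this(1) C y(1)] affine_linear_vanishes[OF this(2) C y(1)]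
    show ?thesis
      using ord[OF h g(1)]
    proof
      assume "\<forall>x\<in>C. h x \<le> g x"
      then show ?thesis using v(2) y(2) by fastforce
    next
      assume "\<forall>x\<in>C. g x \<le> h x"
      then show ?thesis using v(1) y(2) by fastforce
    qed
  qed
  have fR: "continuous_on ?R f" using continuous_on_subset[OF f RC] .
  have closed: "closedin (top_of_set ?R) {x \<in> ?R. f x = h x}" if "h \<in> F" for h
    using continuous_closedin_preimage_constant[of ?R "\<lambda>x. f x - h x" 0] that F(2)
      continuous_on_diff[OF fR affine_linear_continuous_on] by simp
  let ?F = "{h \<in> F. \<not> (\<forall>x\<in>C. h x = g x)}"
  have "{x \<in> ?R. f x = g x} = ?R - (\<Union>h\<in>?F. {x \<in> ?R. f x = h x})"
  proof (intro equalityI subsetI)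
    fix x assume x: "x \<in> {x \<in> ?R. f x = g x}"
    have "f x \<noteq> h x" if "h \<in> ?F" for h using eq[of h x] that x by auto
    then show "x \<in> ?R - (\<Union>h\<in>?F. {x \<in> ?R. f x = h x})" using x by simp
  next
    fix x assume x: "x \<in> ?R - (\<Union>h\<in>?F. {x \<in> ?R. f x = h x})"
    then have xC: "x \<in> ?R" "x \<in> C" using RC by auto
    obtain h where h: "h \<in> F" "f x = h x" using bspec[OF pw xC(2)] by (rule bexE)
    have "h \<notin> ?F" using x h(2) xC(1) by blast
    then have "h x = g x" using h(1) xC(2) by simp
    then show "x \<in> {x \<in> ?R. f x = g x}" using h(2) xC(1) by simp
  qed
  moreover have "closedin (top_of_set ?R) (\<Union>h\<in>?F. {x \<in> ?R. f x = h x})"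
    using F(1) closed by (intro closedin_Union) auto
  ultimately have "openin (top_of_set ?R) {x \<in> ?R. f x = g x}"
    using openin_diff[OF openin_subtopology_self] by simp
  moreover have "connected ?R" using C by (simp add: convex_connected convex_rel_interior)
  ultimately have "{x \<in> ?R. f x = g x} = ?R"
    using closed[OF g(1)] z g(2) unfolding connected_clopen by blast
  then have fg: "f x - g x = 0" if "x \<in> ?R" for x using that by auto
  \<comment> \<open>The equality extends by continuity, as the cell lies in the closure of its
    relative interior.\<close>
  have "closedin (top_of_set C) {x \<in> C. f x - g x = 0}"
    using F(2) g(1) by (intro continuous_closedin_preimage_constant continuous_on_diff f affine_linear_continuous_on) auto
  then obtain D where D: "closed D" "{x \<in> C. f x - g x = 0} = C \<inter> D" by (auto simp: closedin_closed)
  then have "?R \<subseteq> D" using fg RC by blast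
  then have "closure ?R \<subseteq> D" using D(1) by (rule closure_minimal)
  then have "C \<subseteq> D" using convex_closure_rel_interior[OF C] closure_subset by blast
  then have "\<forall>x\<in>C. f x = g x" using D(2) by auto
  with g(1) F(2) show thesis using that by blast
qed

text \<open>A given triangulation is cut along the hyperplanes where two affine pieces agree. On
  each resulting cell any two pieces are comparable, which forces \<open>f\<close> to be affine
  there; the cells are then triangulated.\<close>

theorem linearizing_triangulation_exists:
  assumes P: "compact_polyhedron P" and f: "f \<in> nabla P"
  obtains K where "triangulates K P" "linearizes K f"
proof -
  obtain K where K: "simplicial_complex K" "\<Union>K = P"
    using P by (auto simp: compact_polyhedron_def triangulates_def)
  obtain F where F: "finite F" "\<forall>g\<in>F. affine_linear g" "\<forall>s\<in>P. \<exists>g\<in>F. f s = g s" and fc: "continuous_on P f"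
    using f by (auto simp: nabla_def)
  have "\<exists>a b. (\<lambda>x. g x - h x) = (\<lambda>x. a \<bullet> x - b)" if "g \<in> F" "h \<in> F" for g h
    using affine_linear_inner[OF affine_linear_diff] F(2) that by metis
  then obtain a b where ab: "\<And>g h. g \<in> F \<Longrightarrow> h \<in> F \<Longrightarrow> (\<lambda>x. g x - h x) = (\<lambda>x. a g h \<bullet> x - b g h)"
    by metis
  define I where "I = (\<lambda>(g, h). (a g h, b g h)) ` (F \<times> F)"
  have fin: "finite K" "finite I" using K(1) F(1) by (auto simp: simplicial_complex_def I_def)
  have poly: "\<And>X. X \<in> K \<Longrightarrow> polytope X" "\<And>X Y. X \<in> K \<Longrightarrow> Y \<in> K \<Longrightarrow> X \<inter> Y face_of X"
    using K(1) simplex_imp_polytope unfolding simplicial_complex_def by blast+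
  have "\<exists>\<G>. \<Union>\<G> = \<Union>K \<and> finite \<G> \<and> (\<forall>C \<in> \<G>. \<exists>D. D \<in> K \<and> C \<subseteq> D) \<and>
    (\<forall>C \<in> K. \<forall>x \<in> C. \<exists>D. D \<in> \<G> \<and> x \<in> D \<and> D \<subseteq> C) \<and> (\<forall>X \<in> \<G>. polytope X) \<and>
    (\<forall>X \<in> \<G>. aff_dim X \<le> int DIM('a)) \<and> (\<forall>X \<in> \<G>. \<forall>Y \<in> \<G>. X \<inter> Y face_of X) \<and>
    (\<forall>X\<in>\<G>. \<forall>x\<in>X. \<forall>y\<in>X. \<forall>a b. (a, b) \<in> I \<longrightarrow> a \<bullet> x \<le> b \<and> a \<bullet> y \<le> b \<or> a \<bullet> x \<ge> b \<and> a \<bullet> y \<ge> b)"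
    by (rule cell_subdivision_lemma) (use fin poly aff_dim_le_DIM in simp_all)
  then obtain \<G> where G: "\<Union>\<G> = \<Union>K" "finite \<G>" "\<forall>X\<in>\<G>. polytope X" "\<forall>X \<in> \<G>. \<forall>Y \<in> \<G>. X \<inter> Y face_of X"
    and side: "\<forall>X\<in>\<G>. \<forall>x\<in>X. \<forall>y\<in>X. \<forall>a b. (a, b) \<in> I \<longrightarrow> a \<bullet> x \<le> b \<and> a \<bullet> y \<le> b \<or> a \<bullet> x \<ge> b \<and> a \<bullet> y \<ge> b"
    by (elim exE conjE) (rule that)
  obtain \<T> where T: "simplicial_complex \<T>" "\<Union>\<T> = \<Union>\<G>" "\<forall>S\<in>\<T>. \<exists>X. X \<in> \<G> \<and> S \<subseteq> X"
    using simplicial_subdivision_of_cell_complex[of \<G>] G(2,3,4) by metis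
  have "linearizes \<T> f"
    unfolding linearizes_def
  proof
    fix S assume "S \<in> \<T>"
    then obtain X where X: "X \<in> \<G>" "S \<subseteq> X" using T(3) by blast
    have XP: "X \<subseteq> P" using X(1) G(1) K(2) by blast
    obtain g where "affine_linear g" "\<forall>x\<in>X. f x = g x"
    proof (rule piecewise_affine_on_cell)
      show "convex X" using bspec[OF G(3) X(1)] by (rule polytope_imp_convex)
      show "continuous_on X f" using continuous_on_subset[OF fc XP] .
      show "\<forall>x\<in>X. \<exists>g\<in>F. f x = g x" using F(3) XP by blast
      show "(\<forall>x\<in>X. g x \<le> h x) \<or> (\<forall>x\<in>X. h x \<le> g x)" if gh: "g \<in> F" "h \<in> F" for g h
      proof (rule ccontr)
        assume "\<not> ?thesis"
        then obtain x y where xy: "x \<in> X" "h x < g x" "y \<in> X" "g y < h y" by (auto simp: not_le)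
        have "(a g h, b g h) \<in> I" using gh by (auto simp: I_def)
        then have "a g h \<bullet> x \<le> b g h \<and> a g h \<bullet> y \<le> b g h \<or> a g h \<bullet> x \<ge> b g h \<and> a g h \<bullet> y \<ge> b g h"
          using side X(1) xy(1,3) by blast
        moreover have "g x - h x = a g h \<bullet> x - b g h" "g y - h y = a g h \<bullet> y - b g h"
          using fun_cong[OF ab[OF gh], of x] fun_cong[OF ab[OF gh], of y] by auto
        ultimately show False using xy by linarith
      qed
    qed (use F in auto)
    then show "\<exists>g. affine_linear g \<and> (\<forall>x\<in>S. f x = g x)" using X(2) by blast
  qed
  with T(1,2) G(1) K(2) show thesis using that by (auto simp: triangulates_def)
qed

section \<open>Closure properties of the piecewise linear functions and their positive cone\<close>

lemma nablaI:
  assumes "\<And>x. x \<notin> P \<Longrightarrow> f x = 0" "continuous_on P f" "finite F" "\<And>g. g \<in> F \<Longrightarrow> affine_linear g"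
    "\<And>s. s \<in> P \<Longrightarrow> \<exists>g\<in>F. f s = g s"
  shows "f \<in> nabla P"
  unfolding nabla_def using assms by (intro CollectI conjI exI[of _ F]) auto

lemma nablaE:
  assumes "f \<in> nabla P"
  obtains F where "\<forall>x. x \<notin> P \<longrightarrow> f x = 0" "continuous_on P f" "finite F" "\<forall>g\<in>F. affine_linear g"
    "\<forall>s\<in>P. \<exists>g\<in>F. f s = g s"
  using assms unfolding nabla_def by blast

lemma nabla_sup_inf:
  assumes "f \<in> nabla P" "g \<in> nabla P"
  shows "sup f g \<in> nabla P" "inf f g \<in> nabla P"
proof -
  obtain F where f: "\<forall>x. x \<notin> P \<longrightarrow> f x = 0" "continuous_on P f" "finite F" "\<forall>g\<in>F. affine_linear g"
    "\<forall>s\<in>P. \<exists>g\<in>F. f s = g s" using assms(1) by (rule nablaE)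
  obtain G where g: "\<forall>x. x \<notin> P \<longrightarrow> g x = 0" "continuous_on P g" "finite G" "\<forall>g\<in>G. affine_linear g"
    "\<forall>s\<in>P. \<exists>h\<in>G. g s = h s" using assms(2) by (rule nablaE)
  have "\<exists>h\<in>F \<union> G. sup f g s = h s" "\<exists>h\<in>F \<union> G. inf f g s = h s" if "s \<in> P" for s
    using f(5) g(5) that by (cases "f s \<le> g s"; force simp: sup_fun_def inf_fun_def sup_max inf_min max_def min_def)+
  moreover have "continuous_on P (sup f g)" "continuous_on P (inf f g)"
    using continuous_on_max[OF f(2) g(2)] continuous_on_min[OF f(2) g(2)]
    by (simp_all add: sup_fun_def inf_fun_def sup_max inf_min)
  ultimately show "sup f g \<in> nabla P" "inf f g \<in> nabla P"
    using f g by (auto intro!: nablaI[where F = "F \<union> G"] simp: sup_fun_def inf_fun_def)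
qed

lemma nabla_scale:
  assumes "f \<in> nabla P"
  shows "(\<lambda>x. r * f x) \<in> nabla P"
proof -
  obtain F where f: "\<forall>x. x \<notin> P \<longrightarrow> f x = 0" "continuous_on P f" "finite F" "\<forall>g\<in>F. affine_linear g"
    "\<forall>s\<in>P. \<exists>g\<in>F. f s = g s" using assms by (rule nablaE)
  show ?thesis
  proof (rule nablaI)
    show "finite ((\<lambda>g x. r * g x) ` F)" using f(3) by simp
    show "affine_linear h" if "h \<in> (\<lambda>g x. r * g x) ` F" for h
      using that f(4) affine_linear_scale by auto
    show "\<exists>h\<in>(\<lambda>g x. r * g x) ` F. r * f s = h s" if "s \<in> P" for s
      using f(5) that by fastforce
  qed (use f in \<open>auto intro: continuous_intros\<close>)
qed

lemma nabla_add:
  assumes "f \<in> nabla P" "g \<in> nabla P"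
  shows "f + g \<in> nabla P"
proof -
  obtain F where f: "\<forall>x. x \<notin> P \<longrightarrow> f x = 0" "continuous_on P f" "finite F" "\<forall>g\<in>F. affine_linear g"
    "\<forall>s\<in>P. \<exists>g\<in>F. f s = g s" using assms(1) by (rule nablaE)
  obtain G where g: "\<forall>x. x \<notin> P \<longrightarrow> g x = 0" "continuous_on P g" "finite G" "\<forall>g\<in>G. affine_linear g"
    "\<forall>s\<in>P. \<exists>h\<in>G. g s = h s" using assms(2) by (rule nablaE)
  show ?thesis
  proof (rule nablaI)
    show "finite ((\<lambda>(u, v) x. u x + v x) ` (F \<times> G))" using f(3) g(3) by simp
    show "affine_linear h" if "h \<in> (\<lambda>(u, v) x. u x + v x) ` (F \<times> G)" for h
      using that f(4) g(4) affine_linear_add by auto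
    show "\<exists>h\<in>(\<lambda>(u, v) x. u x + v x) ` (F \<times> G). (f + g) s = h s" if s: "s \<in> P" for s
    proof -
      obtain u v where "u \<in> F" "f s = u s" "v \<in> G" "g s = v s" using f(5) g(5) s by blast
      then show ?thesis by (intro bexI[of _ "\<lambda>x. u x + v x"]) auto
    qed
    show "continuous_on P (f + g)" using continuous_on_add[OF f(2) g(2)] by (simp add: plus_fun_def)
  qed (use f(1) g(1) in auto)
qed

lemma positive_cone_nabla_iff:
  "f \<in> positive_cone (nabla P) \<longleftrightarrow> f \<in> nabla P \<and> (\<forall>x. 0 \<le> f x)"
  by (simp add: positive_cone_def le_fun_def)

lemma positive_cone_sup_inf:
  assumes "f \<in> positive_cone (nabla P)" "g \<in> positive_cone (nabla P)"
  shows "sup f g \<in> positive_cone (nabla P)" "inf f g \<in> positive_cone (nabla P)"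
proof -
  have fg: "f \<in> nabla P" "g \<in> nabla P" "0 \<le> f" "0 \<le> g"
    using assms by (auto simp only: positive_cone_def mem_Collect_eq)
  have "0 \<le> sup f g" using fg(3) by (rule le_supI1)
  then show "sup f g \<in> positive_cone (nabla P)"
    unfolding positive_cone_def using nabla_sup_inf(1)[OF fg(1,2)] by blast
  have "0 \<le> inf f g" using fg(3,4) by (rule le_infI)
  then show "inf f g \<in> positive_cone (nabla P)"
    unfolding positive_cone_def using nabla_sup_inf(2)[OF fg(1,2)] by blast
qed

lemma Sup_fin_Inf_fin_fun_apply:
  fixes h :: "'i \<Rightarrow> 'b \<Rightarrow> real"
  assumes "finite S" "S \<noteq> {}"
  shows "Sup_fin (h ` S) x = Max ((\<lambda>i. h i x) ` S)" "Inf_fin (h ` S) x = Min ((\<lambda>i. h i x) ` S)"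
  using assms by (induction S rule: finite_ne_induct) (simp_all add: sup_max inf_min)

text \<open>
  A pc-valuation cannot distinguish functions dominating each other up to a constant: if \<open>y \<le> x\<close>
  then \<open>\<nu> (x + y) = \<nu> (sup x y) = \<nu> x\<close>.
\<close>

lemma pc_valuation_between:
  assumes \<nu>: "pc_valuation (nabla P) \<nu>" and x: "x \<in> positive_cone (nabla P)" and y: "y \<in> nabla P"
    and xy: "x \<le> y" and yx: "\<forall>t. y t \<le> 2 ^ n * x t"
  shows "\<nu> y = \<nu> x"
  using y xy yx
proof (induction n arbitrary: y)
  case 0
  then have "y = x" by (auto simp: le_fun_def fun_eq_iff intro: antisym)
  then show ?case by simp
next
  case (Suc n)
  \<comment> \<open>The truncation of \<open>y\<close> at \<open>2 ^ n * x\<close> is covered by the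
    induction hypothesis. The excess \<open>d\<close> of \<open>y\<close> over \<open>z\<close> is
    at most \<open>z\<close>, so adding it back leaves the valuation unchanged: each step doubles
    the admissible factor.\<close>
  define z where "z = inf y (\<lambda>t. 2 ^ n * x t)"
  have xpos: "0 \<le> x t" for t using x by (simp add: positive_cone_nabla_iff)
  have zn: "z \<in> nabla P"
    unfolding z_def using Suc.prems(1) x by (intro nabla_sup_inf(2) nabla_scale) (simp_all add: positive_cone_nabla_iff)
  have x2: "x t \<le> 2 ^ n * x t" for t
    using mult_right_mono[of 1 "2 ^ n" "x t"] xpos[of t] by simp
  have z: "z t = min (y t) (2 ^ n * x t)" for t by (simp add: z_def inf_fun_def inf_min)
  have yt: "x t \<le> y t" "y t \<le> 2 * (2 ^ n * x t)" for t
    using Suc.prems(2,3) by (simp_all add: le_fun_def mult.assoc)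
  have \<nu>z: "\<nu> z = \<nu> x"
    by (rule Suc.IH[OF zn]) (use x2 yt(1) in \<open>auto simp: le_fun_def z\<close>)
  define d where "d = y + (\<lambda>t. - 1 * z t)"
  have d: "d t = y t - z t" for t by (simp add: d_def)
  have dn: "d \<in> nabla P" unfolding d_def by (intro nabla_add nabla_scale Suc.prems(1) zn)
  have dz: "0 \<le> d t" "d t \<le> z t" "0 \<le> z t" for t
    using yt[of t] x2[of t] xpos[of t] unfolding d z by (auto simp: min_def)
  have "\<nu> (z + d) = \<nu> (sup z d)"
    using \<nu> zn dn dz unfolding pc_valuation_def by (simp add: positive_cone_nabla_iff)
  moreover have "z + d = y" by (auto simp: fun_eq_iff d)
  moreover have "sup z d = z" using dz(2) by (intro sup_absorb1) (simp add: le_fun_def)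
  ultimately show ?case using \<nu>z by simp
qed

text \<open>Both functions are compared with \<open>sup x y\<close>, which lies above each of them
  and below a multiple of each by a power of 2.\<close>

lemma pc_valuation_comparable:
  assumes \<nu>: "pc_valuation (nabla P) \<nu>" and x: "x \<in> positive_cone (nabla P)" and y: "y \<in> positive_cone (nabla P)"
    and c: "\<And>t. x t \<le> c * y t" "\<And>t. y t \<le> c * x t"
  shows "\<nu> x = \<nu> y"
proof -
  obtain n where n: "c < 2 ^ n" using real_arch_pow[of 2 c] by auto
  have one: "1 \<le> (2::real) ^ n" by simp
  have pos: "0 \<le> x t" "0 \<le> y t" for t using x y by (simp_all add: positive_cone_nabla_iff)
  have *: "x t \<le> 2 ^ n * y t" "y t \<le> 2 ^ n * x t" for t
    using c[of t] n mult_right_mono[of c "2 ^ n" "x t"] mult_right_mono[of c "2 ^ n" "y t"] pos[of t] by auto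
  have **: "x t \<le> 2 ^ n * x t" "y t \<le> 2 ^ n * y t" for t
    using one mult_right_mono[of 1 "2 ^ n" "x t"] mult_right_mono[of 1 "2 ^ n" "y t"] pos[of t] by auto
  have s: "sup x y \<in> nabla P" using x y by (intro nabla_sup_inf) (simp_all add: positive_cone_nabla_iff)
  have "\<nu> (sup x y) = \<nu> x"
    by (rule pc_valuation_between[OF \<nu> x s, of n]) (use * ** in \<open>auto simp: sup_max\<close>)
  moreover have "\<nu> (sup x y) = \<nu> y"
    by (rule pc_valuation_between[OF \<nu> y s, of n]) (use * ** in \<open>auto simp: sup_max\<close>)
  ultimately show ?thesis by simp
qed

section \<open>Evaluating a pc-valuation on coordinate functions and their combinations\<close>

context vertex_scheme begin

lemma coord_positive_cone: "(\<lambda>x. coord x v) \<in> positive_cone (nabla realization)"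
proof -
  have "(\<lambda>x. coord x v) \<in> nabla realization"
  proof (cases "v \<in> vertices")
    case True
    then show ?thesis unfolding coord_eq_pl[OF True] by (intro pl_in_nabla)
  next
    case False
    have "(\<lambda>x. coord x v) = pl (\<lambda>_. 0)"
      by (rule ext) (simp add: coord_not_vertex[OF False] pl_def)
    then show ?thesis using pl_in_nabla by metis
  qed
  then show ?thesis by (simp add: positive_cone_nabla_iff coord_nonneg)
qed

lemma Inf_fin_coord_positive_cone:
  assumes "finite T" "T \<noteq> {}"
  shows "Inf_fin ((\<lambda>t x. coord x t) ` T) \<in> positive_cone (nabla realization)"
  using assms
proof (induction T rule: finite_ne_induct)
  case (insert t T)
  then have "Inf_fin ((\<lambda>t x. coord x t) ` insert t T) = inf (\<lambda>x. coord x t) (Inf_fin ((\<lambda>t x. coord x t) ` T))"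
    by simp
  then show ?case
    using positive_cone_sup_inf(2)[OF coord_positive_cone insert.IH] by (simp only:)
qed (simp add: coord_positive_cone)

text \<open>Scaling by \<open>card T\<close> makes the infimum a hat and is invisible to
  \<open>\<nu>\<close>. If \<open>T\<close> spans no simplex, some coordinate from \<open>T\<close>
  vanishes at each point, so the infimum is the zero function.\<close>

lemma pc_valuation_Inf_fin_coord:
  assumes \<nu>: "pc_valuation (nabla realization) \<nu>" and hat: "\<And>h. schauder_hat realization h \<Longrightarrow> \<nu> h = 1"
    and T: "finite T" "T \<noteq> {}"
  shows "\<nu> (Inf_fin ((\<lambda>t x. coord x t) ` T)) = (if T \<in> F then 1 else 0)"
proof (cases "T \<in> F")
  case True
  let ?m = "Inf_fin ((\<lambda>t x. coord x t) ` T)" and ?n = "real (card T)"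
  have n: "1 \<le> ?n" using T by (simp add: Suc_le_eq card_gt_0_iff)
  have m: "?m \<in> positive_cone (nabla realization)" by (rule Inf_fin_coord_positive_cone[OF T])
  then have pos: "0 \<le> ?m x" for x by (simp add: positive_cone_nabla_iff)
  have "(\<lambda>x. ?n * ?m x) \<in> positive_cone (nabla realization)"
    using m nabla_scale[of ?m realization ?n] by (simp add: positive_cone_nabla_iff)
  from pc_valuation_comparable[OF \<nu> m this, of ?n] n pos
  have "\<nu> ?m = \<nu> (\<lambda>x. ?n * ?m x)"
    by (smt (verit) mult_left_mono mult_cancel_right1 mult_right_mono)
  moreover have "schauder_hat realization (\<lambda>x. ?n * ?m x)"
    unfolding Sup_fin_Inf_fin_fun_apply(2)[OF T] by (rule schauder_hat_Min_coord[OF True T(2)])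
  ultimately show ?thesis using hat True by simp
next
  case False
  have "Inf_fin ((\<lambda>t x. coord x t) ` T) = 0"
  proof
    fix x
    have "\<not> (\<forall>t\<in>T. 0 < coord x t)" using open_star_empty[OF False T(2)] by blast
    then obtain t where t: "t \<in> T" "coord x t = 0" using coord_nonneg by (metis order_le_less)
    then have "Min ((\<lambda>t. coord x t) ` T) = 0"
      using T coord_nonneg by (intro Min_eqI) (auto simp: image_iff)
    then show "Inf_fin ((\<lambda>t x. coord x t) ` T) x = 0 x" by (simp add: Sup_fin_Inf_fin_fun_apply(2)[OF T])
  qed
  then show ?thesis using \<nu> False by (simp add: pc_valuation_def)
qed

theorem pc_valuation_eq_euler_char:
  assumes \<nu>: "pc_valuation (nabla realization) \<nu>" and hat: "\<And>h. schauder_hat realization h \<Longrightarrow> \<nu> h = 1"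
    and f: "f \<in> positive_cone (nabla realization)" "linearizes simplices f"
  shows "\<nu> f = real_of_int (euler_char (supp realization f))"
proof -
  define S where "S = {v \<in> vertices. f v \<noteq> 0}"
  have finS: "finite S" using finite_vertices by (simp add: S_def)
  have fpos: "0 \<le> f x" for x using f(1) by (simp add: positive_cone_nabla_iff)
  have f_sum: "f x = (\<Sum>v\<in>S. coord x v * f v)" for x
  proof (cases "x \<in> realization")
    case True
    then have "f x = (\<Sum>v\<in>vertices. coord x v * f v)"
      using linearizes_imp_pl[OF f(2)] by (simp add: pl_def)
    also have "\<dots> = (\<Sum>v\<in>S. coord x v * f v)"
      using finite_vertices by (intro sum.mono_neutral_right) (auto simp: S_def)
    finally show ?thesis .
  next
    case False
    moreover have "f \<in> nabla realization" using f(1) by (simp add: positive_cone_nabla_iff)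
    ultimately show ?thesis by (simp add: nabla_def coord_outside)
  qed
  have fv: "0 < f v" if "v \<in> S" for v using that fpos[of v] by (simp add: S_def)
  have supp: "supp realization f = (\<Union>v\<in>S. {x. 0 < coord x v})"
  proof (rule Set.set_eqI)
    fix x
    have "f x \<noteq> 0 \<longleftrightarrow> (\<exists>v\<in>S. coord x v * f v \<noteq> 0)"
      unfolding f_sum[of x] using finS coord_nonneg fpos
      by (subst sum_nonneg_eq_0_iff) (auto intro!: mult_nonneg_nonneg)
    also have "\<dots> \<longleftrightarrow> (\<exists>v\<in>S. 0 < coord x v)"
      using fv coord_nonneg by (auto simp: less_le)
    finally have "f x \<noteq> 0 \<longleftrightarrow> (\<exists>v\<in>S. 0 < coord x v)" .
    moreover have "x \<in> realization" if "0 < coord x v" for v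
      using that coord_outside[of x v] by fastforce
    ultimately show "x \<in> supp realization f \<longleftrightarrow> x \<in> (\<Union>v\<in>S. {x. 0 < coord x v})"
      by (auto simp: supp_def)
  qed
  show ?thesis
  \<comment> \<open>Inclusion-exclusion requires a nonempty family; without vertices of positive
    value \<open>f\<close> is zero.\<close>
  proof (cases "S = {}")
    case True
    then have "f = 0" using f_sum by (auto simp: fun_eq_iff)
    then have "\<nu> f = 0" using \<nu> by (simp add: pc_valuation_def)
    then show ?thesis unfolding supp True using euler_char_empty(2)[where 'a='a] by simp
  next
    case False
    let ?h = "\<lambda>t x. coord x t" and ?G = "\<lambda>x. x \<in> positive_cone (nabla realization)"
    let ?s = "Sup_fin (?h ` S)"
    have "?G ?s \<and> \<nu> ?s = (\<Sum>T\<in>Pow S - {{}}. (-1) ^ (card T + 1) * \<nu> (Inf_fin (?h ` T)))"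
    proof (rule inclusion_exclusion_lattice[where G = ?G and h = ?h and \<phi> = \<nu>, OF _ finS False])
      fix x y :: "'a \<Rightarrow> real" assume xy: "?G x" "?G y"
      then have "\<nu> (sup x y) = \<nu> x + \<nu> y - \<nu> (inf x y)" using \<nu> by (simp add: pc_valuation_def)
      with positive_cone_sup_inf(1)[OF xy] show "?G (sup x y) \<and> \<nu> (sup x y) = \<nu> x + \<nu> y - \<nu> (inf x y)" by blast
    next
      fix T assume "T \<subseteq> S" "T \<noteq> {}"
      then show "?G (Inf_fin (?h ` T))"
        using finite_subset[OF _ finS] by (intro Inf_fin_coord_positive_cone) auto
    qed
    then have s: "?G ?s" and \<nu>s: "\<nu> ?s = (\<Sum>T\<in>Pow S - {{}}. (-1) ^ (card T + 1) * \<nu> (Inf_fin (?h ` T)))"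
      by simp_all
    have "\<nu> ?s = (\<Sum>T\<in>Pow S - {{}}. (-1) ^ (card T + 1) * (if T \<in> F then 1 else 0))"
      unfolding \<nu>s
    proof (rule sum.cong)
      fix T assume "T \<in> Pow S - {{}}"
      then have "finite T" "T \<noteq> {}" using finite_subset[OF _ finS] by auto
      then show "(-1) ^ (card T + 1) * \<nu> (Inf_fin (?h ` T)) = (-1) ^ (card T + 1) * (if T \<in> F then 1 else 0)"
        using pc_valuation_Inf_fin_coord[OF \<nu> hat] by simp
    qed simp
    also have "\<dots> = real_of_int (\<Sum>T\<in>Pow S - {{}}. (-1) ^ (card T + 1) * (if T \<in> F then 1 else 0))"
      unfolding of_int_sum by (intro sum.cong) simp_all
    also have "\<dots> = real_of_int (euler_char (supp realization f))"
      unfolding supp euler_char_union_open_stars(2)[OF finS False] ..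
    finally have "\<nu> ?s = real_of_int (euler_char (supp realization f))" .
    moreover have "\<nu> f = \<nu> ?s"
    proof (rule pc_valuation_comparable[OF \<nu> f(1) s])
      \<comment> \<open>One constant for both directions: the summands \<open>f v\<close> bound
        \<open>f\<close> by a multiple of the largest coordinate over \<open>S\<close>, and the
        summand \<open>1 / f v\<close> at a vertex attaining it bounds that coordinate by a multiple
        of \<open>f\<close>.\<close>
      let ?c = "\<Sum>v\<in>S. f v + 1 / f v"
      have s_apply: "?s x = Max ((\<lambda>v. coord x v) ` S)" for x by (rule Sup_fin_Inf_fin_fun_apply(1)[OF finS False])
      have spos: "0 \<le> ?s x" for x using s by (simp add: positive_cone_nabla_iff)
      show "f x \<le> ?c * ?s x" for x
      proof -
        have "f x \<le> (\<Sum>v\<in>S. ?s x * f v)"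
          unfolding f_sum[of x]
        proof (rule sum_mono)
          fix v assume v: "v \<in> S"
          then have "coord x v \<le> ?s x" unfolding s_apply using finS by simp
          then show "coord x v * f v \<le> ?s x * f v" using fpos by (rule mult_right_mono)
        qed
        also have "\<dots> \<le> (\<Sum>v\<in>S. ?s x * (f v + 1 / f v))"
          using spos fpos by (intro sum_mono mult_left_mono) simp_all
        also have "\<dots> = ?c * ?s x" unfolding sum_distrib_left[symmetric] by (rule mult.commute)
        finally show ?thesis .
      qed
      show "?s x \<le> ?c * f x" for x
      proof -
        have "?s x \<in> (\<lambda>v. coord x v) ` S" unfolding s_apply using finS False by (intro Max_in) auto
        then obtain v where v: "v \<in> S" "?s x = coord x v" by blast
        have "coord x v * f v \<le> f x"
          unfolding f_sum[of x] using finS v(1) coord_nonneg fpos by (intro member_le_sum) auto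
        then have "?s x \<le> 1 / f v * f x" using fv[OF v(1)] v(2) by (simp add: field_simps)
        also have "\<dots> \<le> (f v + 1 / f v) * f x" using fpos by (intro mult_right_mono) auto
        also have "\<dots> \<le> ?c * f x"
          using finS v(1) fpos by (intro mult_right_mono member_le_sum) auto
        finally show ?thesis .
      qed
    qed
    ultimately show ?thesis by simp
  qed
qed

end

theorem lemma3p3:
  fixes P :: "'a::euclidean_space set"
    and \<nu> :: "('a \<Rightarrow> real) \<Rightarrow> real"
  assumes "compact_polyhedron P"
    and "pc_valuation (nabla P) \<nu>"
    and "\<And>h. schauder_hat P h \<Longrightarrow> \<nu> h = 1"
  shows "\<forall>f\<in>positive_cone (nabla P).
           \<nu> f = real_of_int (alpha_plus P f) \<and>
           (\<forall>K. triangulates K P \<and> linearizes K f \<longrightarrow>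
              alpha_plus P f = polyhedron_euler_char (\<Union>(supplement (zero_subcomplex K f) K)))"
proof (intro ballI conjI allI impI)
  fix f assume f: "f \<in> positive_cone (nabla P)"
  \<comment> \<open>The value of \<open>\<nu>\<close> needs one linearizing triangulation only, as
    \<open>alpha_plus\<close> is defined without any; the formula with the supplement is about an
    arbitrary one.\<close>
  then obtain K where K: "triangulates K P" "linearizes K f"
    using linearizing_triangulation_exists[OF assms(1)] by (auto simp: positive_cone_def)
  then have cK: "simplicial_complex K" by (simp add: triangulates_def)
  interpret vertex_scheme "simplex_vertices ` K" by (rule vertex_scheme_of_complex(1)[OF cK])
  have simplices_eq: "simplices = K" by (rule vertex_scheme_of_complex(2)[OF cK])
  then have realization_eq: "realization = P" using K(1) Union_simplices by (simp add: triangulates_def)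
  show "\<nu> f = real_of_int (alpha_plus P f)"
    unfolding alpha_plus_def
    using pc_valuation_eq_euler_char[of \<nu> f] assms(2,3) f K(2) unfolding simplices_eq realization_eq by blast
next
  fix f K assume f: "f \<in> positive_cone (nabla P)" and K: "triangulates K P \<and> linearizes K f"
  then have cK: "simplicial_complex K" by (simp add: triangulates_def)
  interpret vertex_scheme "simplex_vertices ` K" by (rule vertex_scheme_of_complex(1)[OF cK])
  have simplices_eq: "simplices = K" by (rule vertex_scheme_of_complex(2)[OF cK])
  then have realization_eq: "realization = P" using K Union_simplices by (simp add: triangulates_def)
  show "alpha_plus P f = polyhedron_euler_char (\<Union>(supplement (zero_subcomplex K f) K))"
    unfolding alpha_plus_def
    using euler_char_supp_eq_supplement[of f] K f unfolding simplices_eq realization_eq positive_cone_nabla_iff by blast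
qed

end
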